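(* Let $K$ be an infinite compact subset of $\mathbb R^d$. Then a typical measure $\mu\in\mathcal P(K)$ satisfies $\underline D_\mu(1)=0$ and $\overline D_\mu(1)\in[\overline{\dim}_{B,{\rm conv}}(K),\overline{\dim}_{B,{\rm conv,max}}(K)]$. Moreover, if $[a,b]$ is any interval such that a typical measure $\mu\in\mathcal P(K)$ satisfies $\overline D_\mu(1)\in[a,b]$, then $a\le\overline{\dim}_{B,{\rm conv}}(K)$ and $b\ge\overline{\dim}_{B,{\rm conv,max}}(K)$.
   Context: $\mathcal P(K)$ is the set of Borel probability measures on $K$ with the weak topology; "a typical measure satisfies P" means the set of measures satisfying P contains a dense $G_\delta$ subset of $\mathcal P(K)$. $B(x,r)$ is the open ball. $\underline D_\mu(1)=\liminf_{r\to0}\frac{\int_K\log\mu(B(x,r))\,d\mu(x)}{\log r}$ and $\overline D_\mu(1)$ is the corresponding $\limsup$. $\mathbf P_r(E)$ is the largest number of pairwise disjoint balls of radius $r$ centered in $E$. The convex upper box dimension is $\overline{\dim}_{B,{\rm conv}}(K)=\inf_{N\ge1}\inf_{x_1,\dots,x_N\in K}\inf_{\rho>0}\inf_{p_i>0,\sum_ip_i=1}\limsup_{r\to0}\frac{\sum_{i=1}^Np_i\log\mathbf P_r(K\cap B(x_i,\rho))}{-\log r}$, and the maximal convex upper box dimension is $\overline{\dim}_{B,{\rm conv,max}}(K)=\sup_{y\in K,\rho>0}\overline{\dim}_{B,{\rm conv}}(K\cap B(y,\rho))$. *)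

theory Defs
  imports "HOL-Analysis.Analysis" "HOL-Probability.Probability"
begin

definition prob_measures :: "'a::euclidean_space set \<Rightarrow> 'a measure set" where
  "prob_measures K = {M. sets M = sets (restrict_space borel K) \<and> prob_space M}"

definition weak_topology :: "'a::euclidean_space set \<Rightarrow> 'a measure topology" where
  "weak_topology K = subtopology
     (topology_generated_by
       {{M \<in> prob_measures K. (\<integral>x. f x \<partial>M) \<in> U} | f U.
           continuous_on K (f :: 'a \<Rightarrow> real) \<and> open U})
     (prob_measures K)"

definition typical :: "'a::euclidean_space set \<Rightarrow> ('a measure \<Rightarrow> bool) \<Rightarrow> bool" where
  "typical K P \<longleftrightarrow> (\<exists>G. gdelta_in (weak_topology K) G
      \<and> (weak_topology K) closure_of G = topspace (weak_topology K)
      \<and> (\<forall>M\<in>G. P M))"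

definition renyi1_quot :: "'a::euclidean_space set \<Rightarrow> 'a measure \<Rightarrow> real \<Rightarrow> real" where
  "renyi1_quot K M r = (\<integral>x. ln (measure M (ball x r \<inter> K)) \<partial>M) / ln r"

definition lower_D1 :: "'a::euclidean_space set \<Rightarrow> 'a measure \<Rightarrow> ereal" where
  "lower_D1 K M = Liminf (at_right 0) (\<lambda>r. ereal (renyi1_quot K M r))"

definition upper_D1 :: "'a::euclidean_space set \<Rightarrow> 'a measure \<Rightarrow> ereal" where
  "upper_D1 K M = Limsup (at_right 0) (\<lambda>r. ereal (renyi1_quot K M r))"

definition packing_number :: "'a::euclidean_space set \<Rightarrow> real \<Rightarrow> nat" where
  "packing_number E r = Sup {card C | C. finite C \<and> C \<subseteq> E \<and>
       pairwise (\<lambda>x y. disjnt (ball x r) (ball y r)) C}"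

definition conv_box_dim :: "'a::euclidean_space set \<Rightarrow> ereal" where
  "conv_box_dim K = Inf {Limsup (at_right 0) (\<lambda>r. ereal
        ((\<Sum>i<N. p i * ln (real (packing_number (K \<inter> ball (x i) \<rho>) r))) / (- ln r)))
      | N x \<rho> p. (N::nat) \<ge> 1 \<and> (\<forall>i<N. x i \<in> K \<and> p i > (0::real)) \<and> (\<Sum>i<N. p i) = 1
               \<and> \<rho> > (0::real)}"

definition conv_max_box_dim :: "'a::euclidean_space set \<Rightarrow> ereal" where
  "conv_max_box_dim K = Sup {conv_box_dim (K \<inter> ball y \<rho>) | y \<rho>. y \<in> K \<and> \<rho> > 0}"

end

theory Submission
  imports Defs
begin

text \<open>
  All four assertions reduce to statements about finitely supported measures, which are dense, and
  about weak neighbourhoods of them. With \<open>H\<^sub>r(M) = \<integral> - ln M(B(x,r)) dM(x)\<close>, the quotient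
  in the definition of the Renyi dimensions is \<open>H\<^sub>r(M) / (- ln r)\<close>. A finitely supported measure
  has bounded \<open>H\<^sub>r\<close>, and at a fixed scale this persists nearby, so \<open>H\<^sub>r(M) / (- ln r)\<close> is small at
  arbitrarily small scales for typical \<open>M\<close>. If \<open>M\<close> puts masses close to \<open>p\<^sub>i\<close> on small balls \<open>B\<^sub>i\<close>,
  then \<open>H\<^sub>r(M)\<close> is at most \<open>\<Sum>p\<^sub>i ln P\<^sub>r(B\<^sub>i)\<close> up to a small multiple of \<open>- ln r\<close>, simultaneously for
  all small \<open>r\<close>; choosing the \<open>B\<^sub>i\<close> almost optimal for the convex dimension of small balls yields
  the upper bounds. Conversely, replacing each atom of a finitely supported measure by the uniform
  distribution on a maximal packing of a small ball around it at a suitable scale \<open>r\<close> gives a nearby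
  measure, and a neighbourhood of it, on which \<open>H\<^sub>r\<close> is at least \<open>\<Sum>p\<^sub>i ln P\<^sub>r(B\<^sub>i)\<close>; this yields
  the lower bounds. The category arguments need that the space of probability measures is a Baire
  space: it is compact, by Tychonoff's theorem and the Riesz representation theorem.
\<close>

subsection \<open>Representation of positive functionals on compact sets\<close>

text \<open>The two estimates for \<open>upper_D1\<close> are of different kinds. The packing number
  of \<open>K\<close> is eventually at most a fixed power of \<open>1 / r\<close>, so misplaced mass
  \<epsilon> costs only a constant times \<epsilon> times \<open>- ln r\<close>. Hence the upper
  estimate near a suitable atomic measure holds at all small scales at once, and one open set
  already bounds \<open>upper_D1\<close>. A lower estimate lives at one scale per neighbourhood, so
  dense open sets are built for every bound on the scale and intersected.

  The gap between the two dimensions reflects where mass can be put. If a measure has to stay in a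
  prescribed neighbourhood, its atoms can be moved only within small balls, which is why the upper
  bound takes the supremum over all balls. One nearly optimal weighted family of points anywhere in
  \<open>K\<close> yields a single open set where \<open>upper_D1\<close> is hardly above
  \<open>conv_box_dim K\<close>; this makes the lower end sharp. Measures with mass close to 1 in
  \<open>K \<inter> ball y \<rho>\<close> inherit nearly the whole dimension of that piece; they
  contain a nonempty open set only, so sharpness of the upper end is a category argument relative to
  an open set.\<close>

locale positive_functional =
  fixes K :: "'a::euclidean_space set" and \<phi> :: "('a \<Rightarrow> real) \<Rightarrow> real"
  assumes compact: "compact K"
    and add: "continuous_on K f \<Longrightarrow> continuous_on K g \<Longrightarrow> \<phi> (\<lambda>x. f x + g x) = \<phi> f + \<phi> g"
    and scale: "continuous_on K f \<Longrightarrow> \<phi> (\<lambda>x. c * f x) = c * \<phi> f"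
    and pos: "continuous_on K f \<Longrightarrow> (\<And>x. x \<in> K \<Longrightarrow> 0 \<le> f x) \<Longrightarrow> 0 \<le> \<phi> f"
    and one: "\<phi> (\<lambda>_. 1) = 1"
begin

lemma diff: "continuous_on K f \<Longrightarrow> continuous_on K g \<Longrightarrow> \<phi> (\<lambda>x. f x - g x) = \<phi> f - \<phi> g"
  using add[of f "\<lambda>x. -1 * g x"] scale[of g "-1"] by (simp add: continuous_on_minus)

lemma mono:
  assumes "continuous_on K f" "continuous_on K g" "\<And>x. x \<in> K \<Longrightarrow> f x \<le> g x"
  shows "\<phi> f \<le> \<phi> g"
  using pos[of "\<lambda>x. g x - f x"] diff[OF assms(2,1)] assms by (simp add: continuous_on_diff)

lemma const: "\<phi> (\<lambda>_. c) = c"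
  using scale[of "\<lambda>_. 1" c] one by simp

lemma sum:
  assumes "finite I" "\<And>i. i \<in> I \<Longrightarrow> continuous_on K (f i)"
  shows "\<phi> (\<lambda>x. \<Sum>i\<in>I. f i x) = (\<Sum>i\<in>I. \<phi> (f i))"
  using assms
proof (induction I rule: finite_induct)
  case (insert i I)
  then show ?case using add[of "f i" "\<lambda>x. \<Sum>i\<in>I. f i x"] by (simp add: continuous_on_sum)
qed (simp add: const)

section \<open>The Riesz content on open sets and its outer measure\<close>

definition tests :: "'a set \<Rightarrow> ('a \<Rightarrow> real) set" where
  "tests U = {f. continuous_on K f \<and> (\<forall>x\<in>K. 0 \<le> f x \<and> f x \<le> indicator U x)}"

text \<open>The content of the Riesz-Markov construction. The test functions are constrained
  pointwise and not by a support inside \<open>U\<close>; truncating or perturbing a test function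
  by a small constant is therefore the basic move below.\<close>

definition content_open :: "'a set \<Rightarrow> ennreal" where
  "content_open U = (SUP f\<in>tests U. ennreal (\<phi> f))"

text \<open>The functional only sees values on \<open>K\<close>; intersecting with \<open>K\<close> makes the complement of \<open>K\<close> null.\<close>

definition riesz_outer :: "'a set \<Rightarrow> ennreal" where
  "riesz_outer A = (INF U\<in>{U. open U \<and> A \<inter> K \<subseteq> U}. content_open U)"

lemma zero_in_tests [simp]: "(\<lambda>_. 0) \<in> tests U"
  by (auto simp: tests_def)

lemma content_open_upper: "f \<in> tests U \<Longrightarrow> ennreal (\<phi> f) \<le> content_open U"
  unfolding content_open_def by (rule SUP_upper)

lemma content_open_approx:
  assumes "e > 0"
  obtains f where "f \<in> tests U" "content_open U \<le> ennreal (\<phi> f) + ennreal e"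
proof -
  have fin: "content_open U \<le> 1"
    unfolding content_open_def
  proof (rule SUP_least)
    fix f assume "f \<in> tests U"
    then have "\<phi> f \<le> \<phi> (\<lambda>_. 1)"
      by (intro mono) (auto simp: tests_def intro: order_trans[OF _ indicator_le_1])
    then show "ennreal (\<phi> f) \<le> 1" using one by simp
  qed
  show thesis
  \<comment> \<open>Subtraction in \<open>ennreal\<close> is truncated, so subtracting
    \<open>ennreal e\<close> is a strict decrease only from a nonzero content.\<close>
  proof (cases "content_open U = 0")
    case True
    then show thesis using that[of "\<lambda>_. 0"] by simp
  next
    case False
    then have "content_open U - ennreal e < content_open U"
      using assms fin
      by (intro ennreal_between) (auto simp: zero_less_iff_neq_zero top.not_eq_extremum[symmetric] top_unique)
    then obtain f where f: "f \<in> tests U" "content_open U - ennreal e < ennreal (\<phi> f)"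
      unfolding content_open_def by (subst (asm) less_SUP_iff) auto
    then have "content_open U \<le> ennreal (\<phi> f) + ennreal e"
      by (metis add.commute ennreal_minus_le_iff le_less)
    with f(1) show thesis using that by blast
  qed
qed

lemma content_open_mono: "U \<inter> K \<subseteq> V \<Longrightarrow> content_open U \<le> content_open V"
  unfolding content_open_def
proof (rule SUP_subset_mono)
  assume "U \<inter> K \<subseteq> V"
  then have "f x \<le> indicator V x" if "x \<in> K" "f x \<le> indicator U x" for f :: "'a \<Rightarrow> real" and x
    using that by (auto simp: indicator_def of_bool_def split: if_splits)
  then show "tests U \<subseteq> tests V"
    unfolding tests_def by blast
qed simp

text \<open>A test function is dominated, up to \<open>e\<close>, by a finite sum of the functions
  \<open>min 1 (k dist(x, - U n))\<close>: these increase with \<open>k\<close>, so compactness gives uniformity as in Dini's theorem.\<close>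

lemma content_open_countably_subadditive:
  fixes U :: "nat \<Rightarrow> 'a set"
  assumes U: "\<And>n. open (U n)"
  shows "content_open (\<Union>n. U n) \<le> (\<Sum>n. content_open (U n))"
proof (unfold content_open_def[of "\<Union>n. U n"], rule SUP_least)
  fix f assume f: "f \<in> tests (\<Union>n. U n)"
  then have cf: "continuous_on K f" by (simp add: tests_def)
  \<comment> \<open>Since \<open>infdist x {} = 0\<close>, the formula would give the zero function
    for \<open>U n = UNIV\<close>.\<close>
  define g where "g n k x = (if U n = UNIV then 1 else min 1 (real k * infdist x (- U n)))" for n k x
  have cg: "continuous_on S (g n k)" for n k S
    unfolding g_def by (cases "U n = UNIV") (auto intro!: continuous_intros)
  have gU: "g n k \<in> tests (U n)" for n k
    unfolding tests_def using cg[of K n k]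
    by (auto simp: g_def indicator_def infdist_nonneg)
  have g0: "0 \<le> g n k x" for n k x by (auto simp: g_def infdist_nonneg)
  show "ennreal (\<phi> f) \<le> (\<Sum>n. content_open (U n))"
  proof (rule ennreal_le_epsilon)
    fix e :: real assume e: "0 < e"
    \<comment> \<open>A single index \<open>k\<close> bounds both the number of sets and the slopes.
      This makes \<open>s k\<close> increasing in \<open>k\<close>, so a finite subcover reduces to
      its largest index.\<close>
    define s where "s k x = (\<Sum>n<k. g n k x)" for k x
    have cs: "continuous_on S (s k)" for k S
      unfolding s_def by (intro continuous_intros cg)
    have smono: "s k x \<le> s l x" if "k \<le> l" for k l x
    proof -
      have "s k x \<le> (\<Sum>n<k. g n l x)" unfolding s_def
      proof (intro sum_mono)
        fix n
        have "min 1 (real k * infdist x (- U n)) \<le> min 1 (real l * infdist x (- U n))"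
          using that by (intro min.mono mult_right_mono) (auto simp: infdist_nonneg)
        then show "g n k x \<le> g n l x" by (simp add: g_def)
      qed
      also have "\<dots> \<le> s l x"
        unfolding s_def using that g0 by (intro sum_mono2) auto
      finally show ?thesis .
    qed
    have "\<exists>k. f x < s k x + e" if x: "x \<in> K" for x
    proof (cases "x \<in> (\<Union>n. U n)")
      case False
      then have "f x \<le> 0" using f x by (force simp: tests_def indicator_def)
      then show ?thesis using e by (intro exI[of _ 0]) (simp add: s_def)
    next
      case True
      then obtain n where n: "x \<in> U n" by auto
      obtain k where k: "n < k" "g n k x = 1"
      proof (cases "U n = UNIV")
        case True then show ?thesis using that[of "Suc n"] by (simp add: g_def)
      next
        case False
        have "infdist x (- U n) > 0"
          using False n U[of n] by (subst infdist_pos_not_in_closed) (auto simp: closed_Compl)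
        then obtain m where m: "1 < real m * infdist x (- U n)"
          using ex_less_of_nat_mult by blast
        have "1 \<le> real (max m (Suc n)) * infdist x (- U n)"
          by (rule order_trans[OF less_imp_le[OF m]]) (auto intro!: mult_right_mono infdist_nonneg)
        then show ?thesis using that[of "max m (Suc n)"] False by (simp add: g_def)
      qed
      have "g n k x \<le> s k x"
        unfolding s_def using k(1) g0 by (intro member_le_sum) auto
      moreover have "f x \<le> 1" using f x by (auto simp: tests_def intro: order_trans[OF _ indicator_le_1])
      ultimately show ?thesis using k e by (intro exI[of _ k]) auto
    qed
    moreover have "openin (top_of_set K) {x \<in> K. f x < s k x + e}" for k
    proof -
      have "openin (top_of_set K) (K \<inter> (\<lambda>x. s k x + e - f x) -` {0<..})"
        by (intro continuous_openin_preimage_gen continuous_intros cs cf)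
      moreover have "K \<inter> (\<lambda>x. s k x + e - f x) -` {0<..} = {x \<in> K. f x < s k x + e}" by auto
      ultimately show ?thesis by simp
    qed
    ultimately have "\<exists>\<D>. \<D> \<subseteq> range (\<lambda>k. {x \<in> K. f x < s k x + e}) \<and> finite \<D> \<and> K \<subseteq> \<Union>\<D>"
      by (intro compact[unfolded compact_eq_openin_cover, rule_format]) fastforce
    then obtain \<D> where \<D>: "\<D> \<subseteq> range (\<lambda>k. {x \<in> K. f x < s k x + e})" "finite \<D>" "K \<subseteq> \<Union>\<D>"
      by blast
    obtain D where "finite D" "\<D> = (\<lambda>k. {x \<in> K. f x < s k x + e}) ` D"
      using finite_subset_image[OF \<D>(2,1)] by blast
    with \<D>(3) have D: "finite D" "K \<subseteq> (\<Union>k\<in>D. {x \<in> K. f x < s k x + e})"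
      by auto
    define k where "k = Max (insert 0 D)"
    have "f x \<le> s k x + e" if x: "x \<in> K" for x
    proof -
      obtain j where j: "j \<in> D" "f x < s j x + e" using subsetD[OF D(2) x] by blast
      then have "j \<le> k" using D(1) by (simp add: k_def)
      then show ?thesis using j smono[of j k x] by auto
    qed
    then have "\<phi> f \<le> \<phi> (\<lambda>x. s k x + e)"
      by (intro mono cf continuous_intros cs) auto
    also have "\<dots> = (\<Sum>n<k. \<phi> (g n k)) + e"
      using sum[of "{..<k}" "\<lambda>n. g n k"] cg add[of "s k" "\<lambda>_. e"] const cs
      by (simp add: s_def[abs_def])
    finally have "ennreal (\<phi> f) \<le> ennreal ((\<Sum>n<k. \<phi> (g n k)) + e)" by (rule ennreal_leI)
    also have "\<dots> = (\<Sum>n<k. ennreal (\<phi> (g n k))) + ennreal e"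
      using e pos cg g0 by (subst ennreal_plus) (auto intro!: sum_nonneg simp: sum_ennreal)
    also have "(\<Sum>n<k. ennreal (\<phi> (g n k))) \<le> (\<Sum>n<k. content_open (U n))"
      by (intro sum_mono content_open_upper gU)
    also have "(\<Sum>n<k. content_open (U n)) \<le> (\<Sum>n. content_open (U n))"
      by (rule sum_le_suminf) auto
    finally show "ennreal (\<phi> f) \<le> (\<Sum>n. content_open (U n)) + ennreal e"
      by (simp add: add_right_mono)
  qed
qed

lemma riesz_outer_open: "open U \<Longrightarrow> riesz_outer U = content_open U"
  unfolding riesz_outer_def
  by (intro antisym INF_lower INF_greatest content_open_mono) auto

lemma riesz_outer_mono: "A \<inter> K \<subseteq> B \<Longrightarrow> riesz_outer A \<le> riesz_outer B"
  unfolding riesz_outer_def by (rule INF_superset_mono) auto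

lemma riesz_outer_approx:
  assumes "e > 0"
  obtains U where "open U" "A \<inter> K \<subseteq> U" "content_open U \<le> riesz_outer A + ennreal e"
proof (cases "riesz_outer A = top")
  case True
  then show thesis using that[of UNIV] by simp
next
  case False
  then have "riesz_outer A < riesz_outer A + ennreal e"
    using assms by (simp add: ennreal_add_left_cancel_less)
  then show thesis
    unfolding riesz_outer_def using that
    by (subst (asm) INF_less_iff) (auto simp: riesz_outer_def[symmetric] less_imp_le)
qed

lemma outer_measure_space_riesz_outer: "outer_measure_space UNIV riesz_outer"
  unfolding outer_measure_space_def
proof (intro conjI)
  have "content_open {} = 0"
    unfolding content_open_def
  proof (intro antisym SUP_least)
    fix f assume "f \<in> tests {}"
    then have "\<phi> f \<le> \<phi> (\<lambda>_. 0)" by (intro mono) (auto simp: tests_def)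
    then show "ennreal (\<phi> f) \<le> 0" using const[of 0] by (simp add: ennreal_neg)
  qed simp
  then show "positive UNIV riesz_outer"
    by (simp add: positive_def riesz_outer_open)
  show "increasing UNIV riesz_outer"
    by (auto simp: increasing_def intro!: riesz_outer_mono)
  show "countably_subadditive UNIV riesz_outer"
    unfolding countably_subadditive_def
  proof safe
    fix A :: "nat \<Rightarrow> 'a set"
    show "riesz_outer (\<Union>i. A i) \<le> (\<Sum>i. riesz_outer (A i))"
    proof (rule ennreal_le_epsilon)
      fix e :: real assume e: "0 < e"
      have "\<exists>U. open U \<and> A n \<inter> K \<subseteq> U \<and> content_open U \<le> riesz_outer (A n) + ennreal (e * (1/2) ^ Suc n)" for n
        using riesz_outer_approx[of "e * (1/2) ^ Suc n" "A n"] e by auto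
      then obtain U where U: "\<And>n. open (U n)" "\<And>n. A n \<inter> K \<subseteq> U n"
        "\<And>n. content_open (U n) \<le> riesz_outer (A n) + ennreal (e * (1/2) ^ Suc n)" by metis
      have "riesz_outer (\<Union>i. A i) \<le> riesz_outer (\<Union>i. U i)"
        using U(2) by (intro riesz_outer_mono) auto
      also have "\<dots> \<le> (\<Sum>n. content_open (U n))"
        using U(1) by (subst riesz_outer_open) (auto intro!: content_open_countably_subadditive)
      also have "\<dots> \<le> (\<Sum>n. riesz_outer (A n) + ennreal (e * (1/2) ^ Suc n))"
        by (intro suminf_le U(3)) auto
      also have "\<dots> = (\<Sum>n. riesz_outer (A n)) + (\<Sum>n. ennreal (e * (1/2) ^ Suc n))"
        by (intro suminf_add[symmetric]) auto
      also have "(\<Sum>n. ennreal (e * (1/2) ^ Suc n)) = ennreal e"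
        using e sums_mult[OF power_half_series, of e]
        by (intro suminf_ennreal_eq) auto
      finally show "riesz_outer (\<Union>i. A i) \<le> (\<Sum>i. riesz_outer (A i)) + ennreal e" .
    qed
  qed
qed

text \<open>Caratheodory's condition for \<open>U\<close>, tested on an open \<open>V\<close>. If
  \<open>f\<close> is nearly optimal for \<open>V \<inter> U\<close>, the part \<open>W\<close> of
  \<open>V\<close> where \<open>f < d\<close> is open and contains \<open>V - U\<close> within
  \<open>K\<close>. Lowering \<open>f\<close> by \<open>d\<close> makes it vanish on
  \<open>W\<close>, so adding a nearly optimal \<open>g\<close> for \<open>W\<close> gives a test
  function for \<open>V\<close>. The two approximations and the lowering cost \<open>d\<close> each,
  whence \<open>d = e / 3\<close>.\<close>

lemma content_open_split:
  assumes U: "open U" and V: "open V"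
  shows "riesz_outer (V \<inter> U) + riesz_outer (V - U) \<le> content_open V"
proof (rule ennreal_le_epsilon)
  fix e :: real assume e: "0 < e"
  define d where "d = e / 3"
  have d: "d > 0" using e by (simp add: d_def)
  obtain f where f: "f \<in> tests (V \<inter> U)" "content_open (V \<inter> U) \<le> ennreal (\<phi> f) + ennreal d"
    using content_open_approx[OF d] by blast
  have cf: "continuous_on K f" using f by (simp add: tests_def)
  have "openin (top_of_set K) (K \<inter> f -` {..<d})"
    by (intro continuous_openin_preimage_gen cf) auto
  then obtain T where T: "open T" "K \<inter> f -` {..<d} = K \<inter> T"
    using openin_open by blast
  define W where "W = V \<inter> T"
  have W: "open W" using V T by (auto simp: W_def)
  have VW: "(V - U) \<inter> K \<subseteq> W"
  proof
    fix x assume x: "x \<in> (V - U) \<inter> K"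
    then have "f x \<le> 0" using f(1) by (force simp: tests_def indicator_def)
    then show "x \<in> W" using T x d by (auto simp: W_def)
  qed
  obtain g where g: "g \<in> tests W" "content_open W \<le> ennreal (\<phi> g) + ennreal d"
    using content_open_approx[OF d] by blast
  have cg: "continuous_on K g" using g by (simp add: tests_def)
  define h where "h x = max 0 (f x - d)" for x
  have ch: "continuous_on K h" unfolding h_def by (intro continuous_intros cf)
  have "\<phi> f \<le> \<phi> (\<lambda>x. h x + d)"
    by (intro mono cf continuous_intros ch) (auto simp: h_def)
  then have fh: "\<phi> f \<le> \<phi> h + d" using add[OF ch, of "\<lambda>_. d"] const by simp
  have "(\<lambda>x. h x + g x) \<in> tests V"
    unfolding tests_def
  proof (intro CollectI conjI ballI)
    show "continuous_on K (\<lambda>x. h x + g x)" by (intro continuous_intros ch cg)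
    fix x assume x: "x \<in> K"
    have g': "0 \<le> g x" "g x \<le> indicator W x" using g x by (auto simp: tests_def)
    have f': "0 \<le> f x" "f x \<le> indicator (V \<inter> U) x" using f x by (auto simp: tests_def)
    show "0 \<le> h x + g x" using g' by (simp add: h_def)
    show "h x + g x \<le> indicator V x"
    proof (cases "x \<in> W")
      case True
      then have "f x < d" "x \<in> V" using T x by (auto simp: W_def)
      then show ?thesis using g' True by (simp add: h_def)
    next
      case False
      then have "g x = 0" using g' by simp
      moreover have "f x \<le> indicator V x" using f' by (auto simp: indicator_def of_bool_def split: if_splits)
      moreover have "(0::real) \<le> indicator V x" by simp
      ultimately show ?thesis using f' d by (simp add: h_def)
    qed
  qed
  then have "ennreal (\<phi> h + \<phi> g) \<le> content_open V"
    using content_open_upper add[OF ch cg] by metis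
  moreover have "riesz_outer (V \<inter> U) + riesz_outer (V - U) \<le> content_open (V \<inter> U) + content_open W"
    using U V riesz_outer_mono[OF VW] W
    by (intro add_mono) (auto simp: riesz_outer_open open_Int)
  moreover have "\<dots> \<le> (ennreal (\<phi> f) + ennreal d) + (ennreal (\<phi> g) + ennreal d)"
    by (intro add_mono f g)
  moreover have "\<dots> = ennreal (\<phi> f + d + (\<phi> g + d))"
    using d pos[OF cf] pos[OF cg] f(1) g(1) by (simp add: tests_def ennreal_plus[symmetric] del: ennreal_plus)
  moreover have "\<dots> \<le> ennreal (\<phi> h + \<phi> g + e)"
    using fh by (intro ennreal_leI) (simp add: d_def)
  moreover have "\<dots> = ennreal (\<phi> h + \<phi> g) + ennreal e"
    using e pos[OF ch] pos[OF cg] g(1) by (intro ennreal_plus) (auto simp: tests_def h_def)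
  ultimately show "riesz_outer (V \<inter> U) + riesz_outer (V - U) \<le> content_open V + ennreal e"
    by (metis add_right_mono order_trans)
qed

lemma open_in_lambda_system: "open U \<Longrightarrow> U \<in> lambda_system UNIV UNIV riesz_outer"
proof -
  assume U: "open U"
  interpret sigma_algebra "UNIV :: 'a set" UNIV
    using sigma_algebra_Pow[of "UNIV :: 'a set"] by simp
  have "riesz_outer (X \<inter> U) + riesz_outer (X - U) = riesz_outer X" for X
  proof (rule antisym)
    show "riesz_outer (X \<inter> U) + riesz_outer (X - U) \<le> riesz_outer X"
      unfolding riesz_outer_def[of X]
    proof (rule INF_greatest, safe)
      fix V assume V: "open V" "X \<inter> K \<subseteq> V"
      have "riesz_outer (X \<inter> U) + riesz_outer (X - U) \<le> riesz_outer (V \<inter> U) + riesz_outer (V - U)"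
        using V by (intro add_mono riesz_outer_mono) auto
      also have "\<dots> \<le> content_open V" using content_open_split U V by blast
      finally show "riesz_outer (X \<inter> U) + riesz_outer (X - U) \<le> content_open V" .
    qed
    have "subadditive UNIV riesz_outer"
      using outer_measure_space_riesz_outer countably_subadditive_subadditive
      by (auto simp: outer_measure_space_def)
    from subadditiveD[OF this, of "X \<inter> U" "X - U"]
    show "riesz_outer X \<le> riesz_outer (X \<inter> U) + riesz_outer (X - U)"
      by (auto simp: Int_Diff_Un)
  qed
  then show ?thesis by (simp add: lambda_system_eq)
qed

section \<open>The representing measure\<close>

definition riesz_measure :: "'a measure" where
  "riesz_measure = restrict_space (measure_of UNIV (sets borel) riesz_outer) K"

lemma sets_riesz_measure: "sets riesz_measure = sets (restrict_space borel K)"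
  unfolding riesz_measure_def by (intro sets_restrict_space_cong) (metis sets_measure_of_conv sets.sigma_sets_eq space_borel subset_UNIV Pow_UNIV)

lemma K_borel [measurable]: "K \<in> sets borel"
  using compact by (simp add: borel_compact)

lemma emeasure_riesz_measure:
  assumes "A \<in> sets borel" "A \<subseteq> K"
  shows "emeasure riesz_measure A = riesz_outer A"
proof -
  interpret sigma_algebra "UNIV :: 'a set" UNIV
    using sigma_algebra_Pow[of "UNIV :: 'a set"] by simp
  have *: "measure_space UNIV (lambda_system UNIV UNIV riesz_outer) riesz_outer"
    by (rule caratheodory_lemma[OF outer_measure_space_riesz_outer])
  then interpret L: sigma_algebra UNIV "lambda_system UNIV UNIV riesz_outer"
    by (simp add: measure_space_def)
  have "sigma_sets UNIV {S :: 'a set. open S} \<subseteq> lambda_system UNIV UNIV riesz_outer"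
    by (rule L.sigma_sets_subset) (auto intro: open_in_lambda_system)
  then have "measure_space UNIV (sets borel) riesz_outer"
    using measure_down[OF * sets.sigma_algebra_axioms[of borel, simplified]]
    by (simp add: sets_borel)
  then have "emeasure (measure_of UNIV (sets borel) riesz_outer) A = riesz_outer A"
    using assms by (intro emeasure_measure_of_sigma) (auto simp: measure_space_def)
  moreover have "emeasure riesz_measure A = emeasure (measure_of UNIV (sets borel) riesz_outer) A"
    unfolding riesz_measure_def using assms
    by (intro emeasure_restrict_space) (auto simp: sets_measure_of_conv)
  ultimately show ?thesis by simp
qed

lemma space_riesz_measure: "space riesz_measure = K"
  using sets_eq_imp_space_eq[OF sets_riesz_measure] by (simp add: space_restrict_space)

lemma prob_space_riesz_measure: "prob_space riesz_measure"
proof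
  have "riesz_outer K = riesz_outer UNIV"
    by (intro antisym riesz_outer_mono) auto
  also have "\<dots> = 1"
  proof (rule antisym)
    have "\<phi> f \<le> 1" if "f \<in> tests UNIV" for f
      using mono[of f "\<lambda>_. 1"] that one by (auto simp: tests_def)
    then show "riesz_outer UNIV \<le> 1"
      by (auto simp: riesz_outer_open content_open_def intro!: SUP_least)
    have "(\<lambda>_. 1) \<in> tests UNIV" by (auto simp: tests_def)
    from content_open_upper[OF this] show "1 \<le> riesz_outer UNIV"
      by (simp add: riesz_outer_open one)
  qed
  finally show "emeasure riesz_measure (space riesz_measure) = 1"
    by (simp add: space_riesz_measure emeasure_riesz_measure)
qed

text \<open>Any open \<open>V\<close> containing \<open>U\<close> within \<open>K\<close> admits
  \<open>g\<close> as a test function. This one-sided comparison suffices for the representation: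
  the opposite inequality between functional and integral comes from negating the integrand.\<close>

lemma riesz_measure_ge:
  assumes "continuous_on K g" "openin (top_of_set K) U" "\<And>x. x \<in> K \<Longrightarrow> 0 \<le> g x \<and> g x \<le> indicator U x"
  shows "\<phi> g \<le> measure riesz_measure U"
proof -
  interpret prob_space riesz_measure by (rule prob_space_riesz_measure)
  obtain T where T: "open T" "U = K \<inter> T" using assms(2) openin_open by blast
  then have U: "U \<in> sets borel" "U \<subseteq> K" by auto
  have "ennreal (\<phi> g) \<le> riesz_outer U"
    unfolding riesz_outer_def
  proof (rule INF_greatest, safe)
    fix V assume V: "open V" "U \<inter> K \<subseteq> V"
    have "g x \<le> indicator V x" if "x \<in> K" for x
      by (rule order_trans[of _ "indicator U x"]) (use assms(3)[OF that] V that in \<open>auto simp: indicator_def\<close>)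
    then have "g \<in> tests V" using assms by (auto simp: tests_def)
    then show "ennreal (\<phi> g) \<le> content_open V" by (rule content_open_upper)
  qed
  also have "\<dots> = ennreal (measure riesz_measure U)"
    using emeasure_riesz_measure[OF U] by (simp add: emeasure_eq_measure)
  finally show ?thesis by simp
qed

end

section \<open>Probability measures on a compact set\<close>

lemma bounded_on_compact:
  assumes "compact K" "continuous_on K (f :: 'a::topological_space \<Rightarrow> real)"
  obtains B where "B > 0" "\<And>x. x \<in> K \<Longrightarrow> \<bar>f x\<bar> \<le> B"
  using compact_imp_bounded[OF compact_continuous_image[OF assms(2,1)]]
  unfolding bounded_pos by auto


context
  fixes K :: "'a::euclidean_space set" and M :: "'a measure"
  assumes M: "M \<in> prob_measures K"
begin

lemma sets_prob_measures: "sets M = sets (restrict_space borel K)"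
  and prob_space_prob_measures: "prob_space M"
  using M by (auto simp: prob_measures_def)

lemma space_prob_measures: "space M = K"
  using sets_eq_imp_space_eq[OF sets_prob_measures] by (simp add: space_restrict_space)

lemma borel_Int_in_sets: "A \<in> sets borel \<Longrightarrow> K \<inter> A \<in> sets M"
  by (auto simp: sets_prob_measures sets_restrict_space)

lemma measurable_continuous_prob_measures:
  fixes f :: "'a \<Rightarrow> real"
  assumes "continuous_on K f"
  shows "f \<in> borel_measurable M"
  using borel_measurable_continuous_on_restrict[OF assms] sets_prob_measures measurable_cong_sets by blast

lemma integrable_continuous_prob_measures:
  fixes f :: "'a \<Rightarrow> real"
  assumes "compact K" "continuous_on K f"
  shows "integrable M f"
proof -
  interpret prob_space M by (rule prob_space_prob_measures)
  obtain B where "\<And>x. x \<in> K \<Longrightarrow> \<bar>f x\<bar> \<le> B" using bounded_on_compact[OF assms] by blast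
  then have "AE x in M. norm (f x) \<le> B" by (auto simp: space_prob_measures)
  then show ?thesis
    using measurable_continuous_prob_measures[OF assms(2)] by (rule integrable_const_bound)
qed

end

section \<open>The functional as an integral\<close>

lemma sum_unit_slices:
  assumes "0 \<le> (y::real)"
  shows "(\<Sum>k<n. max 0 (min 1 (y - real k))) = min y (real n)"
  using assms by (induction n) (auto simp: min_def max_def)

lemma sum_below_le: "0 \<le> (y::real) \<Longrightarrow> (\<Sum>k<n. of_bool (real k < y)) \<le> min (y + 1) (real n)"
  by (induction n) (auto simp: min_def split: if_splits)

context positive_functional
begin

lemma riesz_measure_in_prob_measures: "riesz_measure \<in> prob_measures K"
  by (simp add: prob_measures_def sets_riesz_measure prob_space_riesz_measure)

lemmas integrable_riesz_measure =
  integrable_continuous_prob_measures[OF riesz_measure_in_prob_measures compact]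

text \<open>A discrete layer-cake argument. The function \<open>N f\<close> is the sum of its unit
  slices \<open>g k\<close>, which are continuous and vanish where \<open>N f \<le> k\<close>, so
  \<open>riesz_measure_ge\<close> bounds each by the measure of \<open>U k\<close>. The number of
  sets \<open>U k\<close> containing \<open>x\<close> exceeds \<open>N f x\<close> by at most 1, and
  dividing by \<open>N\<close> leaves the error \<open>1 / N\<close>.\<close>

lemma le_integral_unit:
  assumes f: "continuous_on K f" and f01: "\<And>x. x \<in> K \<Longrightarrow> 0 \<le> f x \<and> f x \<le> 1"
  shows "\<phi> f \<le> (\<integral>x. f x \<partial>riesz_measure)"
proof (rule field_le_epsilon)
  interpret prob_space riesz_measure by (rule prob_space_riesz_measure)
  fix e :: real assume e: "0 < e"
  obtain n where n: "1 / real (Suc n) < e" using nat_approx_posE[OF e] by metis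
  define N where "N = Suc n"
  have N: "N > 0" "1 / real N < e" using n by (auto simp: N_def)
  define g where "g k x = max 0 (min 1 (real N * f x - real k))" for k x
  define U where "U k = {x \<in> K. real k < real N * f x}" for k :: nat
  have cg: "continuous_on K (g k)" for k unfolding g_def by (intro continuous_intros f)
  have oU: "openin (top_of_set K) (U k)" for k
  proof -
    have "openin (top_of_set K) (K \<inter> (\<lambda>x. real N * f x - real k) -` {0<..})"
      by (intro continuous_openin_preimage_gen continuous_intros f)
    moreover have "K \<inter> (\<lambda>x. real N * f x - real k) -` {0<..} = U k" by (auto simp: U_def)
    ultimately show ?thesis by simp
  qed
  have [measurable]: "U k \<in> sets riesz_measure" for k
  proof -
    obtain T where "open T" "U k = K \<inter> T" using oU openin_open by blast
    then show ?thesis by (auto simp: sets_riesz_measure sets_restrict_space)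
  qed
  have "real N * \<phi> f = \<phi> (\<lambda>x. real N * f x)" using scale[OF f] by simp
  also have "\<dots> \<le> \<phi> (\<lambda>x. \<Sum>k<N. g k x)"
  proof (intro mono continuous_intros f cg)
    fix x assume "x \<in> K"
    then have "0 \<le> real N * f x" "real N * f x \<le> real N"
      using f01[of x] by (auto simp: mult_left_le)
    then show "real N * f x \<le> (\<Sum>k<N. g k x)"
      using sum_unit_slices[of "real N * f x" N] by (simp add: g_def)
  qed
  also have "\<dots> = (\<Sum>k<N. \<phi> (g k))" using cg by (intro sum) auto
  also have "\<dots> \<le> (\<Sum>k<N. measure riesz_measure (U k))"
    by (intro sum_mono riesz_measure_ge cg oU) (auto simp: g_def U_def indicator_def)
  also have "\<dots> = (\<integral>x. (\<Sum>k<N. indicator (U k) x) \<partial>riesz_measure)"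
    by (subst Bochner_Integration.integral_sum) (auto intro!: integrable_const_bound[of _ 1])
  also have "\<dots> \<le> (\<integral>x. real N * f x + 1 \<partial>riesz_measure)"
  proof (intro integral_mono)
    show "integrable riesz_measure (\<lambda>x. \<Sum>k<N. indicat_real (U k) x)"
      by (intro Bochner_Integration.integrable_sum) (auto intro!: integrable_const_bound[of _ 1])
    show "integrable riesz_measure (\<lambda>x. real N * f x + 1)"
      using integrable_riesz_measure[OF f] by auto
    fix x assume "x \<in> space riesz_measure"
    then have x: "x \<in> K" by (simp add: space_riesz_measure)
    then show "(\<Sum>k<N. indicat_real (U k) x) \<le> real N * f x + 1"
      using sum_below_le[of "real N * f x" N] f01[of x] by (simp add: U_def indicator_def)
  qed
  also have "\<dots> = real N * (\<integral>x. f x \<partial>riesz_measure) + 1"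
    using integrable_riesz_measure[OF f] by (simp add: prob_space)
  finally have "\<phi> f \<le> (\<integral>x. f x \<partial>riesz_measure) + 1 / real N"
    using N(1) by (simp add: field_simps)
  then show "\<phi> f \<le> (\<integral>x. f x \<partial>riesz_measure) + e" using N(2) by linarith
qed

lemma le_integral:
  assumes f: "continuous_on K f"
  shows "\<phi> f \<le> (\<integral>x. f x \<partial>riesz_measure)"
proof -
  interpret prob_space riesz_measure by (rule prob_space_riesz_measure)
  obtain B where B: "B > 0" "\<And>x. x \<in> K \<Longrightarrow> \<bar>f x\<bar> \<le> B"
    using bounded_on_compact[OF compact f] by blast
  have c: "continuous_on K (\<lambda>x. f x + B)" by (intro continuous_intros f)
  have "\<phi> (\<lambda>x. 1 / (2 * B) * (f x + B)) \<le> (\<integral>x. 1 / (2 * B) * (f x + B) \<partial>riesz_measure)"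
  proof (rule le_integral_unit)
    show "continuous_on K (\<lambda>x. 1 / (2 * B) * (f x + B))" by (intro continuous_intros c)
    show "0 \<le> 1 / (2 * B) * (f x + B) \<and> 1 / (2 * B) * (f x + B) \<le> 1" if "x \<in> K" for x
      using B(1) B(2)[OF that] by (auto simp: field_simps)
  qed
  also have "\<dots> = 1 / (2 * B) * ((\<integral>x. f x \<partial>riesz_measure) + B)"
    using integrable_riesz_measure[OF f] by (simp add: prob_space)
  also have "\<phi> (\<lambda>x. 1 / (2 * B) * (f x + B)) = 1 / (2 * B) * (\<phi> f + B)"
    using scale[OF c, of "1 / (2 * B)"] add[OF f, of "\<lambda>_. B"] const by simp
  finally show ?thesis using B(1) by (simp add: field_simps)
qed

lemma integral_riesz_measure:
  assumes f: "continuous_on K f"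
  shows "(\<integral>x. f x \<partial>riesz_measure) = \<phi> f"
  using le_integral[OF f] le_integral[of "\<lambda>x. -1 * f x"] scale[OF f, of "-1"] f
  by (simp add: continuous_on_minus)

end

subsection \<open>The weak topology\<close>

lemma closedin_conj:
  assumes "closedin T {x \<in> topspace T. P x}" "closedin T {x \<in> topspace T. Q x}"
  shows "closedin T {x \<in> topspace T. P x \<and> Q x}"
proof -
  have "{x \<in> topspace T. P x \<and> Q x} = {x \<in> topspace T. P x} \<inter> {x \<in> topspace T. Q x}" by auto
  then show ?thesis using assms by (simp add: closedin_Int)
qed

definition weak_evals :: "'a::euclidean_space set \<Rightarrow> 'a measure \<Rightarrow> ('a \<Rightarrow> real) \<Rightarrow> real" where
  "weak_evals K M = (\<lambda>f\<in>{f. continuous_on K f}. \<integral>x. f x \<partial>M)"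

lemma weak_evals_apply [simp]: "continuous_on K f \<Longrightarrow> weak_evals K M f = (\<integral>x. f x \<partial>M)"
  by (simp add: weak_evals_def)

lemma weak_evals_extensional [simp]: "weak_evals K M \<in> extensional {f. continuous_on K f}"
  by (simp add: weak_evals_def)

abbreviation cont_functionals :: "'a::euclidean_space set \<Rightarrow> (('a \<Rightarrow> real) \<Rightarrow> real) topology" where
  "cont_functionals K \<equiv> powertop_real {f. continuous_on K f}"

lemma topspace_weak_topology [simp]: "topspace (weak_topology K) = prob_measures K"
proof -
  have "prob_measures K \<in> {{M \<in> prob_measures K. (\<integral>x. f x \<partial>M) \<in> U} | f U.
           continuous_on K (f :: 'a \<Rightarrow> real) \<and> open U}"
    by (rule CollectI, rule exI[of _ "\<lambda>_. 0"], rule exI[of _ UNIV]) auto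
  then show ?thesis unfolding weak_topology_def topspace_subtopology topology_generated_by_topspace by blast
qed

lemma openin_weak_basic:
  fixes f :: "'a::euclidean_space \<Rightarrow> real"
  assumes "continuous_on K f" "open U"
  shows "openin (weak_topology K) {M \<in> prob_measures K. (\<integral>x. f x \<partial>M) \<in> U}"
proof -
  have "{M \<in> prob_measures K. (\<integral>x. f x \<partial>M) \<in> U} \<in> {{M \<in> prob_measures K. (\<integral>x. f x \<partial>M) \<in> U} | f U.
           continuous_on K (f :: 'a \<Rightarrow> real) \<and> open U}"
    by (rule CollectI, rule exI[of _ f], rule exI[of _ U]) (use assms in simp)
  from topology_generated_by_Basis[OF this] show ?thesis
    unfolding weak_topology_def openin_subtopology by (intro exI conjI) auto
qed

text \<open>The weak topology is the one pulled back along the evaluations. Because every weakly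
  open set is a preimage, covers and separations can be carried over from the product of real lines,
  which is how compactness and regularity are obtained.\<close>

lemma openin_weak_topology_iff:
  fixes K :: "'a::euclidean_space set"
  shows "openin (weak_topology K) W \<longleftrightarrow>
     (\<exists>H. openin (cont_functionals K) H \<and> W = {M \<in> prob_measures K. weak_evals K M \<in> H})"
proof safe
  assume "openin (weak_topology K) W"
  then obtain S where S: "generate_topology_on {{M \<in> prob_measures K. (\<integral>x. f x \<partial>M) \<in> U} | f U.
           continuous_on K (f :: 'a \<Rightarrow> real) \<and> open U} S" "W = S \<inter> prob_measures K"
    by (auto simp: weak_topology_def openin_subtopology openin_topology_generated_by_iff)
  from S(1) have "\<exists>H. openin (cont_functionals K) H \<and> S = {M \<in> prob_measures K. weak_evals K M \<in> H}"
  proof induction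
    case Empty
    show ?case by (rule exI[of _ "{}"]) auto
  next
    case (Int a b)
    then obtain A B where "openin (cont_functionals K) A" "a = {M \<in> prob_measures K. weak_evals K M \<in> A}"
      "openin (cont_functionals K) B" "b = {M \<in> prob_measures K. weak_evals K M \<in> B}" by blast
    then show ?case by (intro exI[of _ "A \<inter> B"]) auto
  next
    case (UN \<U>)
    then have "\<forall>k\<in>\<U>. \<exists>H. openin (cont_functionals K) H \<and>
        k = {M \<in> prob_measures K. weak_evals K M \<in> H}" by blast
    then obtain H where H: "\<And>k. k \<in> \<U> \<Longrightarrow> openin (cont_functionals K) (H k)"
        "\<And>k. k \<in> \<U> \<Longrightarrow> k = {M \<in> prob_measures K. weak_evals K M \<in> H k}"
      by (subst (asm) bchoice_iff) blast
    have "(\<Union>k\<in>\<U>. k) = (\<Union>k\<in>\<U>. {M \<in> prob_measures K. weak_evals K M \<in> H k})"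
      by (intro SUP_cong H(2)) simp
    then have "\<Union>\<U> = {M \<in> prob_measures K. weak_evals K M \<in> \<Union>(H ` \<U>)}" by blast
    moreover have "openin (cont_functionals K) (\<Union>(H ` \<U>))" using H(1) by (intro openin_Union) blast
    ultimately show ?case by blast
  next
    case (Basis s)
    then obtain f :: "'a \<Rightarrow> real" and U where fU: "continuous_on K f" "open U" "s = {M \<in> prob_measures K. (\<integral>x. f x \<partial>M) \<in> U}"
      by blast
    have "openin (cont_functionals K) {\<psi> \<in> topspace (cont_functionals K). \<psi> f \<in> U}"
      using fU by (intro openin_continuous_map_preimage[OF continuous_map_product_projection]) auto
    then show ?case
      using fU by (intro exI[of _ "{\<psi> \<in> topspace (cont_functionals K). \<psi> f \<in> U}"]) (simp add: PiE_iff)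
  qed
  then show "\<exists>H. openin (cont_functionals K) H \<and> W = {M \<in> prob_measures K. weak_evals K M \<in> H}"
    using S(2) by blast
next
  fix H assume H: "openin (cont_functionals K) H"
  have "continuous_map (weak_topology K) (cont_functionals K) (weak_evals K)"
    unfolding continuous_map_componentwise
    by (auto simp: continuous_map_def openin_weak_basic)
  from openin_continuous_map_preimage[OF this H]
  show "openin (weak_topology K) {M \<in> prob_measures K. weak_evals K M \<in> H}" by simp
qed

text \<open>A basic open set of the product restricts only finitely many coordinates, so one radius
  serves for all of them.\<close>

lemma weak_nbhd:
  fixes M :: "'a::euclidean_space measure"
  assumes "openin (weak_topology K) W" "M \<in> W"
  obtains F :: "('a \<Rightarrow> real) set" and e where "finite F" "\<And>f. f \<in> F \<Longrightarrow> continuous_on K f" "e > 0"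
    "\<And>N. N \<in> prob_measures K \<Longrightarrow> (\<And>f. f \<in> F \<Longrightarrow> \<bar>(\<integral>x. f x \<partial>N) - (\<integral>x. f x \<partial>M)\<bar> < e) \<Longrightarrow> N \<in> W"
proof -
  obtain H where H: "openin (cont_functionals K) H" "W = {M \<in> prob_measures K. weak_evals K M \<in> H}"
    using openin_weak_topology_iff[THEN iffD1, OF assms(1)] by (elim exE conjE)
  have MH: "weak_evals K M \<in> H" using H(2) assms(2) by blast
  obtain X where X: "weak_evals K M \<in> (\<Pi>\<^sub>E i\<in>{f. continuous_on K f}. X i)" "\<And>i. open (X i)"
    "finite {i. X i \<noteq> UNIV}" "(\<Pi>\<^sub>E i\<in>{f. continuous_on K f}. X i) \<subseteq> H"
    using product_topology_open_contains_basis[OF H(1) MH] by auto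
  define F where "F = {i. X i \<noteq> UNIV} \<inter> {f. continuous_on K f}"
  have finF: "finite F" using X(3) by (simp add: F_def)
  have "\<exists>e>0. ball (\<integral>x. f x \<partial>M) e \<subseteq> X f" if "f \<in> F" for f
  proof -
    have "(\<integral>x. f x \<partial>M) \<in> X f" using PiE_mem[OF X(1), of f] that by (simp add: F_def)
    then show ?thesis using X(2) open_contains_ball by blast
  qed
  then obtain e where e: "\<And>f. f \<in> F \<Longrightarrow> e f > 0 \<and> ball (\<integral>x. f x \<partial>M) (e f) \<subseteq> X f" by metis
  \<comment> \<open>The set \<open>F\<close> may be empty; inserting \<open>1\<close> keeps the
    minimum meaningful.\<close>
  define d where "d = Min (insert 1 (e ` F))"
  have d: "d > 0" "\<And>f. f \<in> F \<Longrightarrow> d \<le> e f" using finF e by (auto simp: d_def)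
  show thesis
  proof (rule that[of F d])
    fix N assume N: "N \<in> prob_measures K" "\<And>f. f \<in> F \<Longrightarrow> \<bar>(\<integral>x. f x \<partial>N) - (\<integral>x. f x \<partial>M)\<bar> < d"
    have "(\<integral>x. f x \<partial>N) \<in> X f" if "continuous_on K f" for f
    proof (cases "f \<in> F")
      case True
      then have "(\<integral>x. f x \<partial>N) \<in> ball (\<integral>x. f x \<partial>M) (e f)"
        using N(2)[OF True] d(2)[OF True] by (simp add: dist_real_def abs_minus_commute)
      then show ?thesis using e[OF True] by blast
    qed (use that in \<open>auto simp: F_def\<close>)
    then have "weak_evals K N \<in> (\<Pi>\<^sub>E i\<in>{f. continuous_on K f}. X i)" by (simp add: PiE_iff)
    then show "N \<in> W" using N(1) H(2) X(4) by blast
  qed (auto simp: F_def d(1) finF[unfolded F_def])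
qed

lemma closedin_Ball:
  assumes "\<And>i. i \<in> I \<Longrightarrow> closedin T {x \<in> topspace T. Q i x}"
  shows "closedin T {x \<in> topspace T. \<forall>i\<in>I. Q i x}"
proof (cases "I = {}")
  case False
  then have "{x \<in> topspace T. \<forall>i\<in>I. Q i x} = (\<Inter>i\<in>I. {x \<in> topspace T. Q i x})" by auto
  then show ?thesis using assms False by (auto intro!: closedin_Inter)
qed simp

text \<open>This is where the Riesz representation enters the topology: the image consists of all
  normalized positive linear functionals. Each requirement is an equation or inequality between
  finitely many coordinates, hence closed in the product topology.\<close>

lemma image_weak_evals:
  assumes K: "compact K"
  shows "weak_evals K ` prob_measures K =
    {\<psi> \<in> topspace (cont_functionals K).
       (\<forall>p\<in>{f. continuous_on K f} \<times> {f. continuous_on K f}. \<psi> (\<lambda>x. fst p x + snd p x) = \<psi> (fst p) + \<psi> (snd p)) \<and>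
       (\<forall>p\<in>UNIV \<times> {f. continuous_on K f}. \<psi> (\<lambda>x. fst p * snd p x) = fst p * \<psi> (snd p)) \<and>
       (\<forall>f\<in>{f. continuous_on K f \<and> (\<forall>x\<in>K. 0 \<le> f x)}. 0 \<le> \<psi> f) \<and> \<psi> (\<lambda>_. 1) = 1}" (is "_ = ?S")
proof safe
  fix M assume M: "M \<in> prob_measures K"
  interpret prob_space M by (rule prob_space_prob_measures[OF M])
  note int = integrable_continuous_prob_measures[OF M K] and sp = space_prob_measures[OF M]
  show "weak_evals K M \<in> topspace (cont_functionals K)" by (simp add: PiE_iff)
  show "weak_evals K M (\<lambda>x. fst (f, g) x + snd (f, g) x) = weak_evals K M (fst (f, g)) + weak_evals K M (snd (f, g))"
    if "continuous_on K f" "continuous_on K g" for f g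
    using that by (simp add: continuous_on_add int)
  show "weak_evals K M (\<lambda>x. fst (c, g) * snd (c, g) x) = fst (c, g) * weak_evals K M (snd (c, g))"
    if "continuous_on K g" for c g
    using that by (simp add: continuous_on_mult_left)
  show "0 \<le> weak_evals K M f" if "continuous_on K f" "\<forall>x\<in>K. 0 \<le> f x" for f
    using that by (auto simp: sp intro!: integral_nonneg_AE)
  show "weak_evals K M (\<lambda>_. 1) = 1" by (simp add: prob_space)
next
  fix \<psi> assume ext: "\<psi> \<in> topspace (cont_functionals K)"
    and a: "\<forall>p\<in>{f. continuous_on K f} \<times> {f. continuous_on K f}. \<psi> (\<lambda>x. fst p x + snd p x) = \<psi> (fst p) + \<psi> (snd p)"
    and s: "\<forall>p\<in>UNIV \<times> {f. continuous_on K f}. \<psi> (\<lambda>x. fst p * snd p x) = fst p * \<psi> (snd p)"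
    and p: "\<forall>f\<in>{f. continuous_on K f \<and> (\<forall>x\<in>K. 0 \<le> f x)}. 0 \<le> \<psi> f" and o: "\<psi> (\<lambda>_. 1) = 1"
  interpret positive_functional K \<psi>
    using K a s p o by unfold_locales auto
  have "\<psi> = weak_evals K riesz_measure"
  proof
    show "\<psi> f = weak_evals K riesz_measure f" for f
      using ext integral_riesz_measure[of f] by (cases "continuous_on K f") (auto simp: weak_evals_def PiE_iff extensional_def)
  qed
  then show "\<psi> \<in> weak_evals K ` prob_measures K" using riesz_measure_in_prob_measures by blast
qed

section \<open>Compactness, regularity and the Baire property\<close>

lemma compactin_image_weak_evals:
  fixes K :: "'a::euclidean_space set"
  assumes K: "compact K"
  shows "compactin (cont_functionals K) (weak_evals K ` prob_measures K)"
proof -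
  let ?C = "{f :: 'a \<Rightarrow> real. continuous_on K f}" and ?T = "cont_functionals K"
  have pr: "continuous_map ?T euclideanreal (\<lambda>\<psi>. \<psi> f)" if "continuous_on K f" for f
    using that by (intro continuous_map_product_projection) auto
  have eq: "closedin ?T {\<psi> \<in> topspace ?T. u \<psi> = v \<psi>}"
    if "continuous_map ?T euclideanreal u" "continuous_map ?T euclideanreal v" for u v
    using that by (intro closedin_continuous_maps_eq[of euclideanreal]) auto
  have nn: "closedin ?T {\<psi> \<in> topspace ?T. 0 \<le> \<psi> f}" if "continuous_on K f" for f
    using closedin_continuous_map_preimage[OF pr[OF that], of "{0..}"] by simp
  have c1: "closedin ?T {\<psi> \<in> topspace ?T. \<forall>p\<in>?C \<times> ?C. \<psi> (\<lambda>x. fst p x + snd p x) = \<psi> (fst p) + \<psi> (snd p)}"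
    by (rule closedin_Ball, rule eq) (auto intro!: pr continuous_map_add continuous_on_add)
  have c2: "closedin ?T {\<psi> \<in> topspace ?T. \<forall>p\<in>UNIV \<times> ?C. \<psi> (\<lambda>x. fst p * snd p x) = fst p * \<psi> (snd p)}"
    by (rule closedin_Ball, rule eq) (auto intro!: pr continuous_map_real_mult continuous_on_mult_left)
  have c3: "closedin ?T {\<psi> \<in> topspace ?T. \<forall>f\<in>{f. continuous_on K f \<and> (\<forall>x\<in>K. 0 \<le> f x)}. 0 \<le> \<psi> f}"
    by (rule closedin_Ball, rule nn) auto
  have c4: "closedin ?T {\<psi> \<in> topspace ?T. \<psi> (\<lambda>_. 1) = 1}"
    by (rule eq) (auto intro!: pr)
  have cl: "closedin ?T (weak_evals K ` prob_measures K)"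
    unfolding image_weak_evals[OF K] by (intro closedin_conj c1 c2 c3 c4)
  have "\<exists>B. \<forall>x\<in>K. \<bar>f x\<bar> \<le> B" if "f \<in> ?C" for f
    using bounded_on_compact[OF K] that by (metis mem_Collect_eq)
  then obtain B where B: "\<And>f x. f \<in> ?C \<Longrightarrow> x \<in> K \<Longrightarrow> \<bar>f x\<bar> \<le> B f" by metis
  have sub: "weak_evals K ` prob_measures K \<subseteq> (\<Pi>\<^sub>E f\<in>?C. {- B f..B f})"
  proof (clarify, rule PiE_I)
    fix M and f :: "'a \<Rightarrow> real" assume M: "M \<in> prob_measures K" and "f \<in> ?C"
    then have f: "continuous_on K f" by simp
    interpret prob_space M by (rule prob_space_prob_measures[OF M])
    note int = integrable_continuous_prob_measures[OF M K f] and sp = space_prob_measures[OF M]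
    have "- B f \<le> f x \<and> f x \<le> B f" if "x \<in> K" for x
      using B[of f x] that f by (simp add: abs_le_iff)
    then have "AE x in M. f x \<le> B f" "AE x in M. - B f \<le> f x"
      by (auto simp: sp)
    then have "(\<integral>x. f x \<partial>M) \<le> B f" "- B f \<le> (\<integral>x. f x \<partial>M)"
      using integral_le_const[OF int] integral_ge_const[OF int] by auto
    then show "weak_evals K M f \<in> {- B f..B f}" using f by auto
  qed (simp add: weak_evals_def)
  have "compactin ?T (\<Pi>\<^sub>E f\<in>?C. {- B f..B f})"
    unfolding compactin_PiE by (intro disjI2 ballI) simp
  then show ?thesis using sub cl by (rule closed_compactin)
qed

lemma compact_space_weak_topology:
  fixes K :: "'a::euclidean_space set"
  assumes K: "compact K"
  shows "compact_space (weak_topology K)"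
  unfolding compact_space_alt
proof (intro allI impI)
  fix \<U> assume \<U>: "(\<forall>U\<in>\<U>. openin (weak_topology K) U) \<and> topspace (weak_topology K) \<subseteq> \<Union>\<U>"
  \<comment> \<open>Every weakly open set being a preimage, the open sets of the product whose
    preimages belong to the cover do cover the image.\<close>
  define \<H> where "\<H> = {H. openin (cont_functionals K) H \<and> {M \<in> prob_measures K. weak_evals K M \<in> H} \<in> \<U>}"
  have "weak_evals K ` prob_measures K \<subseteq> \<Union>\<H>"
  proof safe
    fix M assume M: "M \<in> prob_measures K"
    then obtain U where U: "U \<in> \<U>" "M \<in> U" using \<U> by auto
    then obtain H where "openin (cont_functionals K) H" "U = {M \<in> prob_measures K. weak_evals K M \<in> H}"
      using \<U> openin_weak_topology_iff[of K U] by blast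
    then show "weak_evals K M \<in> \<Union>\<H>" using U by (auto simp: \<H>_def)
  qed
  moreover have "\<forall>H\<in>\<H>. openin (cont_functionals K) H" by (auto simp: \<H>_def)
  ultimately obtain \<F> where \<F>: "finite \<F>" "\<F> \<subseteq> \<H>" "weak_evals K ` prob_measures K \<subseteq> \<Union>\<F>"
    using compactin_image_weak_evals[OF K] unfolding compactin_def by meson
  show "\<exists>\<F>. finite \<F> \<and> \<F> \<subseteq> \<U> \<and> topspace (weak_topology K) \<subseteq> \<Union>\<F>"
    by (rule exI[of _ "(\<lambda>H. {M \<in> prob_measures K. weak_evals K M \<in> H}) ` \<F>"])
       (use \<F> in \<open>auto simp: \<H>_def\<close>)
qed

lemma regular_space_weak_topology:
  fixes K :: "'a::euclidean_space set"
  shows "regular_space (weak_topology K)"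
  unfolding regular_space_def
proof (intro allI impI)
  fix C M assume "closedin (weak_topology K) C \<and> M \<in> topspace (weak_topology K) - C"
  then have C: "openin (weak_topology K) (prob_measures K - C)" "C \<subseteq> prob_measures K"
    and M: "M \<in> prob_measures K" "M \<notin> C" by (auto simp: closedin_def)
  obtain H where H: "openin (cont_functionals K) H" "prob_measures K - C = {M \<in> prob_measures K. weak_evals K M \<in> H}"
    using C(1) openin_weak_topology_iff by blast
  have "regular_space (cont_functionals K)"
    by (simp add: regular_space_product_topology regular_space_euclidean)
  moreover have "closedin (cont_functionals K) (topspace (cont_functionals K) - H)"
    using H by blast
  moreover have "weak_evals K M \<in> topspace (cont_functionals K) - (topspace (cont_functionals K) - H)"
    using H M openin_subset by blast
  ultimately obtain U V where UV: "openin (cont_functionals K) U" "openin (cont_functionals K) V"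
    "weak_evals K M \<in> U" "topspace (cont_functionals K) - H \<subseteq> V" "disjnt U V"
    unfolding regular_space_def by meson
  have "C \<subseteq> {M \<in> prob_measures K. weak_evals K M \<in> V}"
  proof
    fix N assume N: "N \<in> C"
    then have "N \<in> prob_measures K" "weak_evals K N \<notin> H" using H(2) C(2) by blast+
    moreover have "weak_evals K N \<in> topspace (cont_functionals K)" by (simp add: PiE_iff)
    ultimately show "N \<in> {M \<in> prob_measures K. weak_evals K M \<in> V}" using UV(4) by blast
  qed
  moreover have "openin (weak_topology K) {M \<in> prob_measures K. weak_evals K M \<in> G}"
    if "openin (cont_functionals K) G" for G
    using that unfolding openin_weak_topology_iff by blast
  moreover have "disjnt {M \<in> prob_measures K. weak_evals K M \<in> U} {M \<in> prob_measures K. weak_evals K M \<in> V}"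
    using UV(5) by (auto simp: disjnt_iff)
  ultimately show "\<exists>U V. openin (weak_topology K) U \<and> openin (weak_topology K) V \<and> M \<in> U \<and> C \<subseteq> V \<and> disjnt U V"
    using UV(1-3) M(1) by (metis (mono_tags, lifting) mem_Collect_eq)
qed

text \<open>Baire's theorem for locally compact regular spaces, which avoids choosing a metric for
  the weak topology. Intersecting with the whole space gives the expected set when
  \<open>\<G>\<close> is empty.\<close>

lemma weak_topology_Baire:
  fixes K :: "'a::euclidean_space set"
  assumes "compact K" "countable \<G>"
    and "\<And>T. T \<in> \<G> \<Longrightarrow> openin (weak_topology K) T \<and> weak_topology K closure_of T = prob_measures K"
  shows "weak_topology K closure_of (topspace (weak_topology K) \<inter> \<Inter>\<G>) = prob_measures K"
proof -
  have "weak_topology K closure_of \<Inter>\<G> = prob_measures K"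
    using assms compact_space_weak_topology[OF assms(1)] regular_space_weak_topology[of K]
    by (subst Baire_category) (auto intro: compact_imp_locally_compact_space)
  then show ?thesis by (metis closure_of_restrict)
qed

section \<open>Finitely supported measures\<close>

definition atomic :: "'a::euclidean_space set \<Rightarrow> 'a pmf \<Rightarrow> 'a measure" where
  "atomic K q = distr (restrict_space (measure_pmf q) K) (restrict_space borel K) (\<lambda>x. x)"

definition fin_supp :: "'a set \<Rightarrow> 'a pmf \<Rightarrow> bool" where
  "fin_supp K q \<longleftrightarrow> finite (set_pmf q) \<and> set_pmf q \<subseteq> K"

text \<open>Every set is measurable for a \<open>pmf\<close>, whereas \<open>prob_measures\<close>
  prescribes the Borel sets of \<open>K\<close>; the identity passes from one to the other. Starting
  from a \<open>pmf\<close> makes redistribution of atoms a \<open>bind_pmf\<close> and restriction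
  to a set a \<open>cond_pmf\<close>.\<close>

lemma measurable_id_restrict:
  "(\<lambda>x. x) \<in> restrict_space (measure_pmf q) K \<rightarrow>\<^sub>M restrict_space borel (K :: 'a::euclidean_space set)"
  by (rule measurableI) (auto simp: space_restrict_space sets_restrict_space)

lemma atomic_in_prob_measures:
  assumes "fin_supp K q"
  shows "atomic K q \<in> prob_measures (K :: 'a::euclidean_space set)"
proof -
  have "prob_space (restrict_space (measure_pmf q) K)"
  proof (rule prob_space_restrict_space)
    show "emeasure (measure_pmf q) K = 1"
      using assms by (intro measure_pmf.emeasure_eq_1_AE) (auto simp: AE_measure_pmf_iff fin_supp_def)
  qed simp
  then have "prob_space (atomic K q)"
    unfolding atomic_def by (rule prob_space.prob_space_distr[OF _ measurable_id_restrict])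
  then show ?thesis by (simp add: prob_measures_def atomic_def)
qed

lemma integral_atomic:
  fixes f :: "'a::euclidean_space \<Rightarrow> real"
  assumes q: "fin_supp K q" and f: "continuous_on K f"
  shows "(\<integral>x. f x \<partial>atomic K q) = measure_pmf.expectation q f"
proof -
  have "(\<integral>x. f x \<partial>atomic K q) = (\<integral>x. f x \<partial>restrict_space (measure_pmf q) K)"
    unfolding atomic_def
    by (rule integral_distr[OF measurable_id_restrict borel_measurable_continuous_on_restrict[OF f]])
  also have "\<dots> = (\<integral>x. indicator K x *\<^sub>R f x \<partial>measure_pmf q)"
    by (subst integral_restrict_space) (auto simp: set_lebesgue_integral_def)
  also have "\<dots> = measure_pmf.expectation q f"
    using q by (intro integral_cong_AE) (auto simp: AE_measure_pmf_iff fin_supp_def)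
  finally show ?thesis .
qed

lemma finite_pmf_exists:
  assumes "finite I" "\<And>i. i \<in> I \<Longrightarrow> 0 \<le> w i" "(\<Sum>i\<in>I. w i) = (1::real)"
  obtains q where "\<And>i. pmf q i = (if i \<in> I then w i else 0)" "set_pmf q \<subseteq> I"
proof -
  define f where "f i = (if i \<in> I then w i else 0)" for i
  have "(\<integral>\<^sup>+i. ennreal (f i) \<partial>count_space UNIV) = (\<Sum>i\<in>I. ennreal (f i))"
    using assms(1) by (intro nn_integral_count_space') (auto simp: f_def)
  also have "\<dots> = ennreal (\<Sum>i\<in>I. f i)" using assms(2) by (intro sum_ennreal) (auto simp: f_def)
  also have "(\<Sum>i\<in>I. f i) = 1" using assms(3) by (simp add: f_def)
  finally have 1: "(\<integral>\<^sup>+i. ennreal (f i) \<partial>count_space UNIV) = 1" by simp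
  have p: "pmf (embed_pmf f) i = f i" for i
    using assms(2) 1 by (intro pmf_embed_pmf) (auto simp: f_def)
  show thesis
    by (rule that[of "embed_pmf f"]) (auto simp: p f_def set_pmf_iff split: if_splits)
qed

lemma finite_uniform_modulus:
  fixes K :: "'a::euclidean_space set" and F :: "('a \<Rightarrow> real) set"
  assumes K: "compact K" and F: "finite F" "\<And>f. f \<in> F \<Longrightarrow> continuous_on K f" and e: "0 < e"
  obtains d where "d > 0" "\<And>f x y. f \<in> F \<Longrightarrow> x \<in> K \<Longrightarrow> y \<in> K \<Longrightarrow> dist x y < d \<Longrightarrow> \<bar>f x - f y\<bar> < e"
proof -
  have "\<forall>f\<in>F. \<exists>d>0. \<forall>x\<in>K. \<forall>y\<in>K. dist x y < d \<longrightarrow> \<bar>f x - f y\<bar> < e"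
  proof
    fix f assume "f \<in> F"
    then have "uniformly_continuous_on K f" using compact_uniformly_continuous K F(2) by blast
    then show "\<exists>d>0. \<forall>x\<in>K. \<forall>y\<in>K. dist x y < d \<longrightarrow> \<bar>f x - f y\<bar> < e"
      using e unfolding uniformly_continuous_on_def dist_real_def by (metis dist_commute)
  qed
  then obtain d where d: "\<And>f. f \<in> F \<Longrightarrow> d f > 0 \<and> (\<forall>x\<in>K. \<forall>y\<in>K. dist x y < d f \<longrightarrow> \<bar>f x - f y\<bar> < e)"
    by metis
  have "Min (insert 1 (d ` F)) > 0" "\<And>f. f \<in> F \<Longrightarrow> Min (insert 1 (d ` F)) \<le> d f" using F(1) d by auto
  then show thesis using that[of "Min (insert 1 (d ` F))"] d by (meson order_less_le_trans)
qed

lemma expectation_fin_supp: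
  fixes f :: "'a \<Rightarrow> real"
  shows "finite (set_pmf q) \<Longrightarrow> measure_pmf.expectation q f = (\<Sum>x\<in>set_pmf q. pmf q x * f x)"
  by (subst integral_measure_pmf[of "set_pmf q"]) auto

lemma expectation_bind_fin_supp:
  fixes f :: "'a \<Rightarrow> real"
  assumes "finite (set_pmf q)" "\<And>x. x \<in> set_pmf q \<Longrightarrow> finite (set_pmf (h x))"
  shows "measure_pmf.expectation (bind_pmf q h) f = (\<Sum>x\<in>set_pmf q. pmf q x * measure_pmf.expectation (h x) f)"
  using assms by (subst pmf_expectation_bind[of "set_pmf q"]) auto

lemma sum_pmf_fin_supp: "finite (set_pmf q) \<Longrightarrow> (\<Sum>x\<in>set_pmf q. pmf q x) = 1"
  by (rule sum_pmf_eq_1) auto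

lemma abs_expectation_diff_less:
  fixes f :: "'a \<Rightarrow> real"
  assumes "finite (set_pmf q)" "\<And>x. x \<in> set_pmf q \<Longrightarrow> \<bar>f x - c\<bar> < e"
  shows "\<bar>measure_pmf.expectation q f - c\<bar> < e"
proof -
  have "measure_pmf.expectation q f - c = (\<Sum>x\<in>set_pmf q. pmf q x * (f x - c))"
    using assms(1) by (simp add: expectation_fin_supp right_diff_distrib sum_subtractf
        sum_distrib_right[symmetric] sum_pmf_fin_supp)
  also have "\<bar>\<dots>\<bar> \<le> (\<Sum>x\<in>set_pmf q. pmf q x * \<bar>f x - c\<bar>)"
    by (rule order_trans[OF sum_abs]) (simp add: abs_mult)
  also have "\<dots> < (\<Sum>x\<in>set_pmf q. pmf q x * e)"
    using assms by (intro sum_strict_mono) (auto simp: set_pmf_not_empty pmf_positive)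
  also have "\<dots> = e"
    using assms(1) by (simp add: sum_distrib_right[symmetric] sum_pmf_fin_supp)
  finally show ?thesis .
qed

section \<open>Redistribution of atoms and density\<close>

lemma fin_supp_bind:
  "fin_supp K q \<Longrightarrow> (\<And>x. x \<in> set_pmf q \<Longrightarrow> fin_supp K (h x)) \<Longrightarrow> fin_supp K (bind_pmf q h)"
  unfolding fin_supp_def by auto

text \<open>Binding with \<open>h\<close> replaces each atom \<open>x\<close> by the distribution \<open>h x\<close> of the same total mass.\<close>

lemma atomic_perturb:
  fixes K :: "'a::euclidean_space set"
  assumes K: "compact K" and W: "openin (weak_topology K) W" and q: "fin_supp K q" "atomic K q \<in> W"
  obtains \<rho> where "\<rho> > 0"
    "\<And>h. (\<And>x. x \<in> set_pmf q \<Longrightarrow> fin_supp (K \<inter> ball x \<rho>) (h x)) \<Longrightarrow> atomic K (bind_pmf q h) \<in> W"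
proof -
  obtain F :: "('a \<Rightarrow> real) set" and e where F: "finite F" "\<And>f. f \<in> F \<Longrightarrow> continuous_on K f" "e > 0"
    "\<And>N. N \<in> prob_measures K \<Longrightarrow> (\<And>f. f \<in> F \<Longrightarrow> \<bar>(\<integral>x. f x \<partial>N) - (\<integral>x. f x \<partial>atomic K q)\<bar> < e) \<Longrightarrow> N \<in> W"
    using weak_nbhd[OF W q(2)] by blast
  obtain d where d: "d > 0" "\<And>f x y. f \<in> F \<Longrightarrow> x \<in> K \<Longrightarrow> y \<in> K \<Longrightarrow> dist x y < d \<Longrightarrow> \<bar>f x - f y\<bar> < e"
    using finite_uniform_modulus[OF K F(1-3)] by blast
  have fq: "finite (set_pmf q)" "set_pmf q \<subseteq> K" using q by (auto simp: fin_supp_def)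
  show thesis
  proof (rule that[OF d(1)])
    fix h assume h: "\<And>x. x \<in> set_pmf q \<Longrightarrow> fin_supp (K \<inter> ball x d) (h x)"
    have b: "fin_supp K (bind_pmf q h)"
      using h by (intro fin_supp_bind q) (auto simp: fin_supp_def)
    show "atomic K (bind_pmf q h) \<in> W"
    proof (rule F(4)[OF atomic_in_prob_measures[OF b]])
      fix f assume f: "f \<in> F"
      have "(\<integral>x. f x \<partial>atomic K (bind_pmf q h)) - (\<integral>x. f x \<partial>atomic K q)
        = (\<Sum>x\<in>set_pmf q. pmf q x * (measure_pmf.expectation (h x) f - f x))"
        using h fq by (simp add: integral_atomic[OF b F(2)[OF f]] integral_atomic[OF q(1) F(2)[OF f]]
            expectation_bind_fin_supp expectation_fin_supp[OF fq(1)] right_diff_distrib sum_subtractf fin_supp_def)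
      also have "\<bar>\<dots>\<bar> \<le> (\<Sum>x\<in>set_pmf q. pmf q x * \<bar>measure_pmf.expectation (h x) f - f x\<bar>)"
        by (rule order_trans[OF sum_abs]) (simp add: abs_mult)
      also have "\<dots> < (\<Sum>x\<in>set_pmf q. pmf q x * e)"
      proof (intro sum_strict_mono mult_strict_left_mono)
        fix x assume x: "x \<in> set_pmf q"
        show "\<bar>measure_pmf.expectation (h x) f - f x\<bar> < e"
        proof (rule abs_expectation_diff_less)
          show "\<bar>f y - f x\<bar> < e" if "y \<in> set_pmf (h x)" for y
            using h[OF x] that x fq by (intro d(2)[OF f]) (auto simp: fin_supp_def dist_commute)
        qed (use h[OF x] in \<open>simp add: fin_supp_def\<close>)
      qed (use fq in \<open>auto simp: set_pmf_not_empty pmf_positive\<close>)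
      also have "\<dots> = e"
        using fq by (simp add: sum_distrib_right[symmetric] sum_pmf_fin_supp)
      finally show "\<bar>(\<integral>x. f x \<partial>atomic K (bind_pmf q h)) - (\<integral>x. f x \<partial>atomic K q)\<bar> < e" .
    qed
  qed
qed

lemma finite_ball_cover:
  fixes K :: "'a::euclidean_space set"
  assumes K: "compact K" and d: "d > 0"
  obtains C where "finite C" "C \<subseteq> K" "K \<subseteq> (\<Union>c\<in>C. ball c d)"
proof (rule compactE_image[OF K, of K "\<lambda>x. ball x d"])
  show "K \<subseteq> (\<Union>c\<in>K. ball c d)" using d by (auto intro!: centre_in_ball[THEN iffD2])
qed (use that in auto)

lemma finite_borel_partition:
  fixes K :: "'a::euclidean_space set"
  assumes K: "compact K" and d: "d > 0"
  obtains n :: nat and c A where "\<And>i. i < n \<Longrightarrow> c i \<in> K" "\<And>i. i < n \<Longrightarrow> A i \<in> sets borel"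
    "\<And>i. i < n \<Longrightarrow> A i \<subseteq> ball (c i) d" "disjoint_family_on A {..<n}" "K = (\<Union>i<n. A i)"
proof -
  obtain C where C: "finite C" "C \<subseteq> K" "K \<subseteq> (\<Union>x\<in>C. ball x d)"
    by (rule finite_ball_cover[OF K d])
  obtain c where c: "bij_betw c {..<card C} C"
    using ex_bij_betw_nat_finite[OF C(1)] by (auto simp: atLeast0LessThan)
  define A where "A = disjointed (\<lambda>i. K \<inter> ball (c i) d)"
  have "A i \<subseteq> K \<inter> ball (c i) d" for i unfolding A_def by (rule disjointed_subset)
  moreover have "range A \<subseteq> sets borel"
    unfolding A_def using K by (intro sets.range_disjointed_sets) (auto simp: borel_compact)
  moreover have "disjoint_family A" unfolding A_def by (rule disjoint_family_disjointed)
  moreover have "(\<Union>i<card C. A i) = (\<Union>i<card C. K \<inter> ball (c i) d)"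
    unfolding A_def by (metis UN_disjointed_eq finite_UN_disjointed_eq atLeast0LessThan)
  moreover have "(\<Union>i<card C. K \<inter> ball (c i) d) = (\<Union>x\<in>c ` {..<card C}. K \<inter> ball x d)" by simp
  moreover have "\<dots> = K" unfolding bij_betw_imp_surj_on[OF c] using C by auto
  moreover have "c i \<in> K" if "i < card C" for i using C c that by (auto simp: bij_betw_def)
  ultimately show thesis
    by (intro that[of "card C" c A]) (auto simp: disjoint_family_on_def)
qed

text \<open>The set \<open>K\<close> is cut into Borel pieces smaller than a common modulus of
  continuity of the finitely many relevant functions, and the mass of each piece is moved to the
  centre of the ball containing it. The centre lies in \<open>K\<close>, though perhaps not in the
  piece.\<close>

lemma atomic_dense:
  fixes K :: "'a::euclidean_space set"
  assumes K: "compact K" and W: "openin (weak_topology K) W" and M: "M \<in> W"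
  obtains q where "fin_supp K q" "atomic K q \<in> W"
proof -
  obtain F :: "('a \<Rightarrow> real) set" and e where F: "finite F" "\<And>f. f \<in> F \<Longrightarrow> continuous_on K f" "e > 0"
    "\<And>N. N \<in> prob_measures K \<Longrightarrow> (\<And>f. f \<in> F \<Longrightarrow> \<bar>(\<integral>x. f x \<partial>N) - (\<integral>x. f x \<partial>M)\<bar> < e) \<Longrightarrow> N \<in> W"
    using weak_nbhd[OF W M] by blast
  have MP: "M \<in> prob_measures K" using openin_subset[OF W] M by auto
  interpret prob_space M by (rule prob_space_prob_measures[OF MP])
  note sp = space_prob_measures[OF MP] and int = integrable_continuous_prob_measures[OF MP K]
  \<comment> \<open>Integrating the pointwise bound preserves only a weak inequality; halving leaves
    room for the strict one.\<close>
  have e2: "e / 2 > 0" using F(3) by simp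
  obtain d where d: "d > 0" "\<And>f x y. f \<in> F \<Longrightarrow> x \<in> K \<Longrightarrow> y \<in> K \<Longrightarrow> dist x y < d \<Longrightarrow> \<bar>f x - f y\<bar> < e / 2"
    using finite_uniform_modulus[OF K F(1,2) e2] by blast
  obtain n :: nat and c A where A: "\<And>i. i < n \<Longrightarrow> c i \<in> K" "\<And>i. i < n \<Longrightarrow> A i \<in> sets borel"
    "\<And>i. i < n \<Longrightarrow> A i \<subseteq> ball (c i) d" "disjoint_family_on A {..<n}" "K = (\<Union>i<n. A i)"
    using finite_borel_partition[OF K d(1)] by blast
  have AM: "A i \<in> events" if "i < n" for i
    using borel_Int_in_sets[OF MP A(2)[OF that]] A(5) that by (metis Int_absorb1 UN_upper lessThan_iff)
  have ind: "(\<Sum>i<n. indicator (A i) x * g i) = g j" if "j < n" "x \<in> A j" for x j and g :: "nat \<Rightarrow> real"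
  proof -
    have "(\<Sum>i<n. indicator (A i) x * g i) = (\<Sum>i<n. if i = j then g j else 0)"
      using that A(4) by (intro sum.cong) (auto simp: disjoint_family_on_def indicator_def)
    then show ?thesis using that by simp
  qed
  have ex: "\<exists>j<n. x \<in> A j" if "x \<in> K" for x using A(5) that by auto
  have "(\<Sum>i<n. prob (A i)) = 1"
  proof -
    have "(\<Sum>i<n. prob (A i)) = prob (\<Union>i<n. A i)"
      using A(4) AM by (intro finite_measure_finite_Union[symmetric]) auto
    then show ?thesis using A(5) sp prob_space by simp
  qed
  then obtain p where p: "\<And>i. pmf p i = (if i \<in> {..<n} then prob (A i) else 0)" "set_pmf p \<subseteq> {..<n}"
    using finite_pmf_exists[of "{..<n}" "\<lambda>i. prob (A i)"] by auto
  define q where "q = map_pmf c p"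
  have q: "fin_supp K q"
    using p(2) A(1) finite_subset[OF p(2)] by (auto simp: q_def fin_supp_def)
  have "atomic K q \<in> W"
  proof (rule F(4)[OF atomic_in_prob_measures[OF q]])
    fix f assume f: "f \<in> F"
    define s where "s x = (\<Sum>i<n. indicator (A i) x * f (c i))" for x
    have ii: "integrable M (\<lambda>x. indicator (A i) x * f (c i))" if "i \<in> {..<n}" for i
      using AM that by (intro integrable_mult_left integrable_const_bound[of _ 1]) auto
    have si: "integrable M s" unfolding s_def by (intro Bochner_Integration.integrable_sum ii)
    have "(\<integral>x. f x \<partial>atomic K q) = measure_pmf.expectation p (\<lambda>i. f (c i))"
      using integral_atomic[OF q F(2)[OF f]] by (simp add: q_def)
    also have "\<dots> = (\<Sum>i<n. pmf p i * f (c i))"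
      using p(2) by (subst integral_measure_pmf[of "{..<n}"]) auto
    also have "\<dots> = (\<Sum>i<n. prob (A i) * f (c i))" using p(1) by simp
    also have "\<dots> = expectation s"
      unfolding s_def using AM by (subst Bochner_Integration.integral_sum[OF ii]) (auto intro!: sum.cong)
    finally have "(\<integral>x. f x \<partial>atomic K q) - expectation f = expectation (\<lambda>x. s x - f x)"
      using int[OF F(2)[OF f]] si by simp
    note eq = this
    have pt: "\<bar>s x - f x\<bar> \<le> e / 2" if x: "x \<in> K" for x
    proof -
      obtain j where j: "j < n" "x \<in> A j" using ex[OF x] by blast
      then have "dist (c j) x < d" using subsetD[OF A(3)[OF j(1)] j(2)] by simp
      then show ?thesis using d(2)[OF f A(1)[OF j(1)] x] ind[OF j, of "\<lambda>i. f (c i)"] by (simp add: s_def)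
    qed
    have "s x - f x \<le> e / 2 \<and> - (e / 2) \<le> s x - f x" if "x \<in> space M" for x
      using pt[of x] that unfolding sp by linarith
    then have ae: "AE x in M. s x - f x \<le> e / 2" "AE x in M. - (e / 2) \<le> s x - f x"
      by (auto intro!: AE_I2)
    have isf: "integrable M (\<lambda>x. s x - f x)"
      by (intro Bochner_Integration.integrable_diff si int[OF F(2)[OF f]])
    note integral_le_const[OF isf ae(1)] integral_ge_const[OF isf ae(2)]
    then show "\<bar>(\<integral>x. f x \<partial>atomic K q) - expectation f\<bar> < e" unfolding eq using F(3) by linarith
  qed
  with q show thesis using that by blast
qed

subsection \<open>Entropy at a fixed scale\<close>

definition ball_entropy :: "'a::euclidean_space set \<Rightarrow> 'a measure \<Rightarrow> real \<Rightarrow> real" where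
  "ball_entropy K M r = (\<integral>x. - ln (measure M (ball x r \<inter> K)) \<partial>M)"

lemma renyi1_quot_eq: "renyi1_quot K M r = ball_entropy K M r / (- ln r)"
  by (simp add: renyi1_quot_def ball_entropy_def)

context
  fixes K :: "'a::euclidean_space set" and M :: "'a measure"
  assumes M: "M \<in> prob_measures K"
begin

interpretation prob_space M by (rule prob_space_prob_measures[OF M])

lemma ball_in_sets: "ball x r \<inter> K \<in> sets M"
  using borel_Int_in_sets[OF M, of "ball x r"] by (simp add: Int_commute)

text \<open>The ball around \<open>x\<close> is the section at \<open>x\<close> of the set of pairs
  at distance less than \<open>r\<close>, so measurability of section masses applies.\<close>

lemma borel_measurable_measure_ball:
  "(\<lambda>x. measure M (ball x r \<inter> K)) \<in> borel_measurable M"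
proof -
  have id: "(\<lambda>x. x) \<in> borel_measurable M"
    unfolding measurable_cong_sets[OF sets_prob_measures[OF M] refl]
    by (rule measurable_restrict_space1) simp
  have [measurable]: "fst \<in> borel_measurable (M \<Otimes>\<^sub>M M)" "snd \<in> borel_measurable (M \<Otimes>\<^sub>M M)"
    using measurable_compose[OF measurable_fst id] measurable_compose[OF measurable_snd id] by auto
  let ?Q = "{p \<in> space (M \<Otimes>\<^sub>M M). dist (fst p) (snd p) < r}"
  have Q: "?Q \<in> sets (M \<Otimes>\<^sub>M M)" by measurable
  have "(\<lambda>x. emeasure M (Pair x -` ?Q)) \<in> borel_measurable M"
    by (rule measurable_emeasure_Pair[OF Q])
  then have "(\<lambda>x. measure M (Pair x -` ?Q)) \<in> borel_measurable M"
    unfolding measure_def by measurable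
  moreover have "Pair x -` ?Q = ball x r \<inter> K" if "x \<in> space M" for x
    using that by (auto simp: space_pair_measure space_prob_measures[OF M])
  ultimately show ?thesis by (subst measurable_cong) auto
qed

text \<open>Since \<open>ln 0 = 0\<close>, logarithms of ball measures can be compared only where these measures
  are positive.\<close>

lemma AE_measure_ball_pos:
  assumes "finite C"
  shows "AE x in M. \<forall>c\<in>C. x \<in> ball c s \<longrightarrow> 0 < measure M (ball c s \<inter> K)"
proof -
  have "AE x in M. x \<in> ball c s \<longrightarrow> 0 < measure M (ball c s \<inter> K)" for c
  proof (cases "measure M (ball c s \<inter> K) = 0")
    case True
    then have "ball c s \<inter> K \<in> null_sets M"
      using ball_in_sets by (intro null_setsI) (auto simp: emeasure_eq_measure)
    from AE_not_in[OF this] show ?thesis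
      by (rule AE_mp) (auto intro!: AE_I2 simp: space_prob_measures[OF M])
  qed (simp add: less_le)
  then show ?thesis using assms by (simp add: AE_finite_all)
qed

lemma minus_ln_measure_nonneg: "0 \<le> - ln (measure M (A :: 'a set))"
  using prob_le_1[of A] by (cases "measure M A = 0") (simp_all add: less_le)

text \<open>The Gibbs-type bound \<open>- ln u \<le> ln n + 1 / (n u)\<close> replaces Jensen's inequality, so that the
  covering balls need not be disjoint.\<close>

lemma cover_bound:
  assumes A: "A \<in> sets M" and C: "finite C" "A \<subseteq> (\<Union>c\<in>C. ball c (R / 2))"
  shows "integrable M (\<lambda>x. indicator A x * - ln (measure M (ball x R \<inter> K)))" (is ?int)
    and "(\<integral>x. indicator A x * - ln (measure M (ball x R \<inter> K)) \<partial>M) \<le> measure M A * ln (real (card C)) + 1" (is ?le)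
proof -
  have "?int \<and> ?le"
  proof (cases "C = {}")
    case True
    then show ?thesis using C by simp
  next
    case False
    define n where "n = real (card C)"
    have n: "n \<ge> 1" using False C(1) by (simp add: n_def Suc_le_eq card_gt_0_iff)
    define m where "m c = measure M (ball c (R / 2) \<inter> K)" for c
    \<comment> \<open>For \<open>x\<close> in \<open>A\<close> and in the ball around
      \<open>c\<close>, the ball \<open>ball x R\<close> contains that ball, and
      \<open>u \<ge> m c\<close> turns the Gibbs-type bound into a summand of \<open>g\<close>. The
      weights are such that on integration \<open>m c\<close> cancels and each ball contributes at
      most \<open>1 / n\<close>.\<close>
    define g where "g x = indicator A x * ln n + (\<Sum>c\<in>C. indicator (ball c (R / 2) \<inter> K) x * (1 / (n * m c)))" for x
    define h where "h x = indicator A x * - ln (measure M (ball x R \<inter> K))" for x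
    have ii: "integrable M (\<lambda>x. indicator B x * (c :: real))" if "B \<in> sets M" for B c
      using that by (intro integrable_mult_left integrable_const_bound[of _ 1]) auto
    have ig: "integrable M g"
      unfolding g_def by (intro Bochner_Integration.integrable_add Bochner_Integration.integrable_sum ii A ball_in_sets)
    have mh: "h \<in> borel_measurable M"
      unfolding h_def using borel_measurable_measure_ball A by measurable
    have h0: "0 \<le> h x" for x
      using minus_ln_measure_nonneg[of "ball x R \<inter> K"] by (auto simp: h_def indicator_def)
    have AE: "AE x in M. h x \<le> g x"
      using AE_measure_ball_pos[OF C(1), of "R / 2"] AE_space
    proof eventually_elim
      fix x assume pos: "\<forall>c\<in>C. x \<in> ball c (R / 2) \<longrightarrow> 0 < measure M (ball c (R / 2) \<inter> K)" and "x \<in> space M"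
      then have xK: "x \<in> K" by (simp add: space_prob_measures[OF M])
      have s0: "0 \<le> (\<Sum>c\<in>C. indicator (ball c (R / 2) \<inter> K) x * (1 / (n * m c)))"
        using n by (intro sum_nonneg) (auto simp: m_def)
      show "h x \<le> g x"
      proof (cases "x \<in> A")
        case False
        then show ?thesis using s0 by (simp add: h_def g_def)
      next
        case True
        then obtain c where c: "c \<in> C" "x \<in> ball c (R / 2)" using C by auto
        then have mc: "0 < m c" using pos by (simp add: m_def)
        define u where "u = measure M (ball x R \<inter> K)"
        have "ball c (R / 2) \<subseteq> ball x R"
        proof
          fix y assume "y \<in> ball c (R / 2)"
          then show "y \<in> ball x R"
            using c(2) dist_triangle[of x y c] by (simp add: dist_commute)
        qed
        then have mu: "m c \<le> u" unfolding m_def u_def by (intro finite_measure_mono ball_in_sets) auto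
        then have u: "u > 0" using mc by simp
        have "ln (1 / (n * u)) \<le> 1 / (n * u) - 1" using u n by (intro ln_le_minus_one) auto
        then have "- ln u \<le> ln n + 1 / (n * u)" using u n by (simp add: ln_div ln_mult)
        also have "1 / (n * u) \<le> 1 / (n * m c)"
          using mu mc n by (intro divide_left_mono mult_left_mono mult_pos_pos) auto
        also have "1 / (n * m c) = indicator (ball c (R / 2) \<inter> K) x * (1 / (n * m c))"
          using c xK by simp
        also have "\<dots> \<le> (\<Sum>c\<in>C. indicator (ball c (R / 2) \<inter> K) x * (1 / (n * m c)))"
          using C(1) c n by (intro member_le_sum) (auto simp: m_def)
        finally show ?thesis using True by (simp add: h_def g_def u_def)
      qed
    qed
    have ih: "integrable M h"
    proof (rule Bochner_Integration.integrable_bound[OF ig mh])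
      show "AE x in M. norm (h x) \<le> norm (g x)"
        using AE by eventually_elim (use h0 in \<open>auto simp: abs_of_nonneg intro: order_trans[OF _ abs_ge_self]\<close>)
    qed
    have "(\<integral>x. h x \<partial>M) \<le> (\<integral>x. g x \<partial>M)" by (rule integral_mono_AE[OF ih ig AE])
    also have "\<dots> = (\<integral>x. indicator A x * ln n \<partial>M) + (\<Sum>c\<in>C. \<integral>x. indicator (ball c (R / 2) \<inter> K) x * (1 / (n * m c)) \<partial>M)"
      unfolding g_def Bochner_Integration.integral_add[OF ii[OF A]
          Bochner_Integration.integrable_sum[OF ii[OF ball_in_sets]]]
      by (subst Bochner_Integration.integral_sum[OF ii[OF ball_in_sets]]) (rule refl)
    also have "\<dots> = measure M A * ln n + (\<Sum>c\<in>C. m c * (1 / (n * m c)))"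
      using A ball_in_sets by (simp add: m_def)
    \<comment> \<open>Only an inequality: the summand is \<open>0\<close> when
      \<open>m c = 0\<close>.\<close>
    also have "(\<Sum>c\<in>C. m c * (1 / (n * m c))) \<le> (\<Sum>c\<in>C. 1 / n)"
      using n by (intro sum_mono) auto
    also have "\<dots> = 1" using n by (simp add: n_def)
    finally have "(\<integral>x. h x \<partial>M) \<le> measure M A * ln n + 1" by simp
    with ih show ?thesis by (simp add: h_def[abs_def] n_def)
  qed
  then show ?int ?le by auto
qed

end

context
  fixes K :: "'a::euclidean_space set" and M :: "'a measure" and r :: real
  assumes K: "compact K" and M: "M \<in> prob_measures K" and r: "r > 0"
begin

interpretation prob_space M by (rule prob_space_prob_measures[OF M])

lemma integrable_ln_measure_ball: "integrable M (\<lambda>x. - ln (measure M (ball x r \<inter> K)))"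
proof -
  obtain C where C: "finite C" "C \<subseteq> K" "K \<subseteq> (\<Union>c\<in>C. ball c (r / 2))"
    using finite_ball_cover[OF K, of "r / 2"] r by auto
  have "K \<in> sets M" using sets.top[of M] by (simp add: space_prob_measures[OF M])
  from cover_bound(1)[OF M this C(1,3)] show ?thesis
    by (rule Bochner_Integration.integrable_cong[THEN iffD1, rotated -1])
       (auto simp: space_prob_measures[OF M])
qed

lemma ball_entropy_nonneg: "0 \<le> ball_entropy K M r"
  unfolding ball_entropy_def by (intro Bochner_Integration.integral_nonneg minus_ln_measure_nonneg[OF M])

text \<open>The covering bound is applied on each piece and on the rest. Each application adds 1, a
  cost independent of the scale that disappears after division by \<open>- ln r\<close>.\<close>

lemma ball_entropy_le:
  assumes X: "finite X" "disjoint_family_on A X" "\<And>x. x \<in> X \<Longrightarrow> A x \<in> sets M"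
    and C: "\<And>x. x \<in> X \<Longrightarrow> finite (C x)" "\<And>x. x \<in> X \<Longrightarrow> A x \<subseteq> (\<Union>c\<in>C x. ball c (r / 2))"
    and D: "finite D" "K \<subseteq> (\<Union>c\<in>D. ball c (r / 2))"
  shows "ball_entropy K M r \<le> (\<Sum>x\<in>X. measure M (A x) * ln (real (card (C x))) + 1)
           + (1 - (\<Sum>x\<in>X. measure M (A x))) * ln (real (card D)) + 1"
proof -
  define L where "L x = - ln (measure M (ball x r \<inter> K))" for x
  define B where "B = K - (\<Union>x\<in>X. A x)"
  have Ks: "K \<in> sets M" using sets.top[of M] by (simp add: space_prob_measures[OF M])
  have B: "B \<in> sets M" using X Ks by (auto simp: B_def)
  have BD: "B \<subseteq> (\<Union>c\<in>D. ball c (r / 2))" using D by (auto simp: B_def)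
  have "measure M (\<Union>x\<in>X. A x) = (\<Sum>x\<in>X. measure M (A x))"
    using X by (intro finite_measure_finite_Union) auto
  moreover have "measure M B = 1 - measure M (\<Union>x\<in>X. A x)"
    unfolding B_def using X prob_compl[of "\<Union>x\<in>X. A x"]
    by (simp add: space_prob_measures[OF M] sets.finite_UN)
  ultimately have mB: "measure M B = 1 - (\<Sum>x\<in>X. measure M (A x))" by simp
  have dec: "L x = (\<Sum>y\<in>X. indicator (A y) x * L x) + indicator B x * L x" if x: "x \<in> space M" for x
  proof (cases "x \<in> B")
    case True
    then show ?thesis by (auto simp: B_def intro!: sum.neutral)
  next
    case False
    then obtain y where y: "y \<in> X" "x \<in> A y" using x by (auto simp: B_def space_prob_measures[OF M])
    have "(\<Sum>z\<in>X. indicator (A z) x * L x) = (\<Sum>z\<in>X. if z = y then L x else 0)"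
      using y X(2) by (intro sum.cong) (auto simp: disjoint_family_on_def indicator_def)
    then show ?thesis using False y X(1) by simp
  qed
  have iA: "integrable M (\<lambda>x. indicator (A y) x * L x)" if "y \<in> X" for y
    using cover_bound(1)[OF M X(3) C] that unfolding L_def by blast
  have iB: "integrable M (\<lambda>x. indicator B x * L x)"
    using cover_bound(1)[OF M B D(1) BD] unfolding L_def by blast
  have "ball_entropy K M r = (\<integral>x. (\<Sum>y\<in>X. indicator (A y) x * L x) + indicator B x * L x \<partial>M)"
    unfolding ball_entropy_def L_def[symmetric] by (rule Bochner_Integration.integral_cong[OF refl dec])
  also have "\<dots> = (\<Sum>y\<in>X. \<integral>x. indicator (A y) x * L x \<partial>M) + (\<integral>x. indicator B x * L x \<partial>M)"
    using iA iB by (simp add: Bochner_Integration.integral_add Bochner_Integration.integral_sum Bochner_Integration.integrable_sum)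
  also have "\<dots> \<le> (\<Sum>y\<in>X. measure M (A y) * ln (real (card (C y))) + 1) + (measure M B * ln (real (card D)) + 1)"
    unfolding L_def using X C by (intro add_mono sum_mono cover_bound(2)[OF M] B D BD) auto
  finally show ?thesis by (simp add: mB)
qed

lemma ball_entropy_ge:
  assumes X: "finite X" "disjoint_family_on A X" "\<And>x. x \<in> X \<Longrightarrow> A x \<in> sets M"
    and u: "\<And>e x. e \<in> X \<Longrightarrow> x \<in> A e \<Longrightarrow> measure M (ball x r \<inter> K) \<le> u e"
  shows "(\<Sum>e\<in>X. measure M (A e) * max 0 (- ln (u e))) \<le> ball_entropy K M r"
proof -
  obtain C where C: "finite C" "C \<subseteq> K" "K \<subseteq> (\<Union>c\<in>C. ball c (r / 2))"
    using finite_ball_cover[OF K, of "r / 2"] r by auto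
  have ii: "integrable M (\<lambda>x. indicator (A e) x * (c :: real))" if "e \<in> X" for e c
    using X(3)[OF that] by (intro integrable_mult_left integrable_const_bound[of _ 1]) auto
  have AE: "AE x in M. (\<Sum>e\<in>X. indicator (A e) x * max 0 (- ln (u e))) \<le> - ln (measure M (ball x r \<inter> K))"
    using AE_measure_ball_pos[OF M C(1), of "r / 2"] AE_space
  proof eventually_elim
    fix x assume pos: "\<forall>c\<in>C. x \<in> ball c (r / 2) \<longrightarrow> 0 < measure M (ball c (r / 2) \<inter> K)" and xM: "x \<in> space M"
    define v where "v = measure M (ball x r \<inter> K)"
    obtain c where c: "c \<in> C" "x \<in> ball c (r / 2)" using C(3) xM by (auto simp: space_prob_measures[OF M])
    have "ball c (r / 2) \<subseteq> ball x r"
    proof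
      fix y assume "y \<in> ball c (r / 2)"
      then show "y \<in> ball x r"
        using c(2) dist_triangle[of x y c] by (simp add: dist_commute)
    qed
    then have "measure M (ball c (r / 2) \<inter> K) \<le> v"
      unfolding v_def by (intro finite_measure_mono ball_in_sets[OF M]) auto
    then have v: "v > 0" using pos c by fastforce
    show "(\<Sum>e\<in>X. indicator (A e) x * max 0 (- ln (u e))) \<le> - ln (measure M (ball x r \<inter> K))"
    proof (cases "\<exists>e\<in>X. x \<in> A e")
      case False
      then have "(\<Sum>e\<in>X. indicator (A e) x * max 0 (- ln (u e))) = 0" by (intro sum.neutral) auto
      then show ?thesis using minus_ln_measure_nonneg[OF M] by simp
    next
      case True
      then obtain e where e: "e \<in> X" "x \<in> A e" by blast
      have "(\<Sum>z\<in>X. indicator (A z) x * max 0 (- ln (u z))) = (\<Sum>z\<in>X. if z = e then max 0 (- ln (u z)) else 0)"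
        using e X(2) by (intro sum.cong) (auto simp: disjoint_family_on_def indicator_def)
      also have "\<dots> = max 0 (- ln (u e))" using e X(1) by simp
      also have "\<dots> \<le> - ln v"
        using u[OF e] v minus_ln_measure_nonneg[OF M, of "ball x r \<inter> K"] by (auto simp: v_def)
      finally show ?thesis by (simp add: v_def)
    qed
  qed
  have "(\<Sum>e\<in>X. measure M (A e) * max 0 (- ln (u e))) = (\<integral>x. (\<Sum>e\<in>X. indicator (A e) x * max 0 (- ln (u e))) \<partial>M)"
    using X(3) by (subst Bochner_Integration.integral_sum[OF ii]) (auto intro!: sum.cong)
  also have "\<dots> \<le> ball_entropy K M r"
    unfolding ball_entropy_def
    by (intro integral_mono_AE Bochner_Integration.integrable_sum ii integrable_ln_measure_ball AE)
  finally show ?thesis .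
qed

end

subsection \<open>Packing numbers and convex dimensions\<close>

lemma disjnt_ball_iff:
  fixes x y :: "'a::euclidean_space"
  assumes "r > 0"
  shows "disjnt (ball x r) (ball y r) \<longleftrightarrow> 2 * r \<le> dist x y"
proof
  assume d: "disjnt (ball x r) (ball y r)"
  show "2 * r \<le> dist x y"
  proof (rule ccontr)
    assume "\<not> 2 * r \<le> dist x y"
    then have "midpoint x y \<in> ball x r" "midpoint x y \<in> ball y r"
      by (simp_all add: dist_midpoint)
    then show False using d by (auto simp: disjnt_iff)
  qed
next
  assume d: "2 * r \<le> dist x y"
  show "disjnt (ball x r) (ball y r)"
    unfolding disjnt_iff
  proof (intro allI notI)
    fix z assume "z \<in> ball x r \<and> z \<in> ball y r"
    then show False using d dist_triangle[of x y z] by (simp add: dist_commute)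
  qed
qed

definition packing :: "'a::euclidean_space set \<Rightarrow> real \<Rightarrow> 'a set \<Rightarrow> bool" where
  "packing E r C \<longleftrightarrow> finite C \<and> C \<subseteq> E \<and> pairwise (\<lambda>x y. disjnt (ball x r) (ball y r)) C"

text \<open>Volume comparison inside the ball of radius \<open>\<rho> + r\<close>. It makes the
  supremum of natural numbers in \<open>packing_number\<close> an attained maximum and also limits
  its growth as \<open>r\<close> tends to 0.\<close>

lemma card_packing_le:
  fixes E :: "'a::euclidean_space set"
  assumes E: "E \<subseteq> ball 0 \<rho>" and \<rho>: "\<rho> > 0" and r: "r > 0" and C: "packing E r C"
  shows "real (card C) \<le> ((\<rho> + r) / r) ^ DIM('a)"
proof -
  have fin: "finite C" and CE: "C \<subseteq> E" using C by (auto simp: packing_def)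
  have disj: "disjoint_family_on (\<lambda>c. ball c r) C"
    using C by (auto simp: packing_def pairwise_def disjnt_def disjoint_family_on_def)
  define v where "v = unit_ball_vol (real DIM('a))"
  have v: "v > 0" by (simp add: v_def)
  have "(\<Sum>c\<in>C. measure lborel (ball c r)) = measure lborel (\<Union>c\<in>C. ball c r)"
    by (rule measure_finite_Union[symmetric, OF fin _ disj])
       (auto, metis emeasure_lborel_ball_finite infinity_ennreal_def less_irrefl)
  also have "\<dots> \<le> measure lborel (ball (0::'a) (\<rho> + r))"
  proof (rule measure_mono_fmeasurable)
    show "(\<Union>c\<in>C. ball c r) \<subseteq> ball 0 (\<rho> + r)"
    proof
      fix z assume "z \<in> (\<Union>c\<in>C. ball c r)"
      then obtain c where "c \<in> C" "dist c z < r" by auto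
      moreover from this have "dist 0 c < \<rho>" using CE E by auto
      ultimately show "z \<in> ball 0 (\<rho> + r)" using dist_triangle[of 0 z c] by simp
    qed
  qed (use fin emeasure_lborel_ball_finite[of "0::'a" "\<rho> + r"] in \<open>auto simp: fmeasurable_def\<close>)
  finally have "real (card C) * (v * r ^ DIM('a)) \<le> v * (\<rho> + r) ^ DIM('a)"
    using r \<rho> by (simp add: content_ball v_def)
  then show ?thesis using r v by (simp add: power_divide field_simps)
qed

lemma packing_number_eq: "packing_number E r = Sup (card ` {C. packing E r C})"
  unfolding packing_number_def packing_def by (rule arg_cong[of _ _ Sup]) blast

context
  fixes E :: "'a::euclidean_space set" and r :: real
  assumes E: "bounded E" and r: "r > 0"
begin

lemma finite_card_packings: "finite (card ` {C. packing E r C})"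
proof -
  obtain \<rho> where \<rho>: "\<rho> > 0" "E \<subseteq> ball 0 \<rho>"
    using bounded_subset_ballD[OF E] by blast
  have "card ` {C. packing E r C} \<subseteq> {..nat \<lfloor>((\<rho> + r) / r) ^ DIM('a)\<rfloor>}"
    using card_packing_le[OF \<rho>(2,1) r] by (auto simp: le_nat_floor)
  then show ?thesis by (rule finite_subset) simp
qed

lemma packing_number_ge: "packing E r C \<Longrightarrow> card C \<le> packing_number E r"
  unfolding packing_number_eq
  by (rule cSup_upper) (auto intro: bdd_above_finite finite_card_packings)

lemma packing_number_attained:
  obtains C where "packing E r C" "card C = packing_number E r"
proof -
  have ne: "card ` {C. packing E r C} \<noteq> {}"
    by (auto simp: packing_def intro!: exI[of _ "{}"])
  have "packing_number E r \<in> card ` {C. packing E r C}"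
    unfolding packing_number_eq cSup_eq_Max[OF finite_card_packings ne]
    by (rule Max_in[OF finite_card_packings ne])
  then show thesis using that by auto
qed

text \<open>A point at distance at least \<open>2 * r\<close> from all centres could be added to the
  packing.\<close>

lemma maximal_packing_cover:
  assumes C: "packing E r C" "card C = packing_number E r"
  shows "E \<subseteq> (\<Union>c\<in>C. ball c (2 * r))"
proof
  fix y assume y: "y \<in> E"
  show "y \<in> (\<Union>c\<in>C. ball c (2 * r))"
  proof (rule ccontr)
    assume "y \<notin> (\<Union>c\<in>C. ball c (2 * r))"
    then have far: "\<And>c. c \<in> C \<Longrightarrow> 2 * r \<le> dist c y" by auto
    then have "y \<notin> C" using r by force
    have "packing E r (insert y C)"
      using C(1) y far by (auto simp: packing_def pairwise_insert disjnt_ball_iff[OF r] dist_commute)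
    then have "card (insert y C) \<le> packing_number E r" by (rule packing_number_ge)
    then show False using C \<open>y \<notin> C\<close> by (simp add: packing_def)
  qed
qed

lemma packing_number_pos: "E \<noteq> {} \<Longrightarrow> 1 \<le> packing_number E r"
proof -
  assume "E \<noteq> {}"
  then obtain x where "x \<in> E" by blast
  then have "packing E r {x}" by (simp add: packing_def)
  from packing_number_ge[OF this] show ?thesis by simp
qed

lemma packing_number_mono: "F \<subseteq> E \<Longrightarrow> packing_number F r \<le> packing_number E r"
  unfolding packing_number_eq
proof (rule cSup_subset_mono)
  show "card ` {C. packing F r C} \<noteq> {}" by (auto simp: packing_def intro!: exI[of _ "{}"])
  show "bdd_above (card ` {C. packing E r C})" by (rule bdd_above_finite[OF finite_card_packings])
  show "card ` {C. packing F r C} \<subseteq> card ` {C. packing E r C}" if "F \<subseteq> E"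
    using that by (auto simp: packing_def)
qed

end

abbreviation ln_packing :: "'a::euclidean_space set \<Rightarrow> real \<Rightarrow> real" where
  "ln_packing E r \<equiv> ln (real (packing_number E r))"

text \<open>The convention \<open>ln 0 = 0\<close> takes care of the empty set, whose packing number
  is 0.\<close>

lemma ln_packing_nonneg: "0 \<le> ln_packing E r"
  by (cases "packing_number E r = 0") auto

lemma ln_packing_mono:
  assumes "bounded E" "r > 0" "F \<subseteq> E"
  shows "ln_packing F r \<le> ln_packing E r"
  using packing_number_mono[OF assms] ln_packing_nonneg[of E r]
  by (cases "packing_number F r = 0") auto

lemma eventually_less_at_right_0: "0 < (a::real) \<Longrightarrow> \<forall>\<^sub>F r in at_right 0. 0 < r \<and> r < a"
  unfolding eventually_at_right_field by (rule exI[of _ a]) auto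

lemma eventually_less_minus_ln: "\<forall>\<^sub>F r in at_right 0. (a::real) < - ln r"
  using filterlim_at_top_dense[of "\<lambda>r. - ln r" "at_right (0::real)"] ln_at_0
  by (simp add: filterlim_uminus_at_bot)

text \<open>Volume comparison gives the dimension times \<open>ln (2 * \<rho>) - ln r\<close>; the
  additional 1 in the factor absorbs the constant term. What matters later is that the factor does
  not depend on \<open>E\<close>.\<close>

lemma ln_packing_le:
  fixes E :: "'a::euclidean_space set"
  assumes E: "bounded E"
  shows "\<forall>\<^sub>F r in at_right 0. ln_packing E r \<le> (real DIM('a) + 1) * (- ln r)"
proof -
  obtain \<rho> where \<rho>: "\<rho> > 0" "E \<subseteq> ball 0 \<rho>"
    using bounded_subset_ballD[OF E] by blast
  show ?thesis
    using eventually_less_at_right_0[OF \<rho>(1)] eventually_less_minus_ln[of "real DIM('a) * ln (2 * \<rho>)"]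
      eventually_less_minus_ln[of 0]
  proof eventually_elim
    fix r assume r: "0 < r \<and> r < \<rho>" and l: "real DIM('a) * ln (2 * \<rho>) < - ln r" and l0: "0 < - ln r"
    obtain C where C: "packing E r C" "card C = packing_number E r"
      using packing_number_attained[OF E] r by blast
    have "real (packing_number E r) \<le> ((\<rho> + r) / r) ^ DIM('a)"
      using card_packing_le[OF \<rho>(2,1) _ C(1)] r C(2) by simp
    also have "\<dots> \<le> (2 * \<rho> / r) ^ DIM('a)"
      using r \<rho> by (intro power_mono divide_right_mono) auto
    finally have le: "real (packing_number E r) \<le> (2 * \<rho> / r) ^ DIM('a)" .
    show "ln_packing E r \<le> (real DIM('a) + 1) * (- ln r)"
    proof (cases "packing_number E r = 0")
      case True
      then show ?thesis using l0 mult_nonneg_nonneg[of "real DIM('a) + 1" "- ln r"] by simp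
    next
      case False
      then have "ln_packing E r \<le> ln ((2 * \<rho> / r) ^ DIM('a))" using le r \<rho> by simp
      also have "\<dots> = real DIM('a) * (ln (2 * \<rho>) - ln r)"
        using r \<rho> by (simp add: ln_realpow ln_div)
      also have "\<dots> \<le> (real DIM('a) + 1) * (- ln r)" using l by (simp add: algebra_simps)
      finally show ?thesis .
    qed
  qed
qed

text \<open>A weighted family of points becomes a \<open>pmf\<close>. Repeated points merge, which
  leaves the weighted averages unchanged.\<close>

lemma conv_box_dim_lessD:
  fixes L :: "'a::euclidean_space set"
  assumes "conv_box_dim L < ereal t"
  obtains q \<rho> where "fin_supp L q" "\<rho> > 0"
    "\<forall>\<^sub>F r in at_right 0. measure_pmf.expectation q (\<lambda>x. ln_packing (L \<inter> ball x \<rho>) r) \<le> t * (- ln r)"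
proof -
  obtain N x \<rho> p where h: "(N::nat) \<ge> 1" "\<And>i. i < N \<Longrightarrow> x i \<in> L \<and> p i > (0::real)" "(\<Sum>i<N. p i) = 1" "\<rho> > (0::real)"
    "Limsup (at_right 0) (\<lambda>r. ereal ((\<Sum>i<N. p i * ln_packing (L \<inter> ball (x i) \<rho>) r) / (- ln r))) < ereal t"
    using assms unfolding conv_box_dim_def Inf_less_iff by blast
  obtain p' where p': "\<And>i. pmf p' i = (if i \<in> {..<N} then p i else 0)" "set_pmf p' \<subseteq> {..<N}"
    using finite_pmf_exists[of "{..<N}" p] h by (auto simp: less_imp_le)
  show thesis
  proof (rule that[of "map_pmf x p'" \<rho>])
    show "fin_supp L (map_pmf x p')"
      using p'(2) h(2) finite_subset[OF p'(2)] by (auto simp: fin_supp_def)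
    have e: "measure_pmf.expectation (map_pmf x p') f = (\<Sum>i<N. p i * f (x i))" for f :: "'a \<Rightarrow> real"
      using p' by (simp, subst integral_measure_pmf[of "{..<N}"]) auto
    show "\<forall>\<^sub>F r in at_right 0. measure_pmf.expectation (map_pmf x p') (\<lambda>x. ln_packing (L \<inter> ball x \<rho>) r) \<le> t * (- ln r)"
      using Limsup_lessD[OF h(5)] eventually_less_minus_ln[of 0]
      by eventually_elim (simp only: e, simp add: field_simps)
  qed (rule h(4))
qed

text \<open>As an infimum, the dimension bounds the limsup for every \<open>q\<close> and
  \<open>\<rho>\<close> from below, but a limsup guarantees only arbitrarily small good scales, not
  all of them.\<close>

lemma conv_box_dim_greaterD:
  fixes L :: "'a::euclidean_space set"
  assumes t: "ereal t < conv_box_dim L" and q: "fin_supp L q" and \<rho>: "\<rho> > 0"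
  shows "\<exists>\<^sub>F r in at_right 0. t * (- ln r) < measure_pmf.expectation q (\<lambda>x. ln_packing (L \<inter> ball x \<rho>) r)"
  unfolding frequently_def
proof
  assume ev: "\<forall>\<^sub>F r in at_right 0. \<not> t * (- ln r) < measure_pmf.expectation q (\<lambda>x. ln_packing (L \<inter> ball x \<rho>) r)"
  have fq: "finite (set_pmf q)" "set_pmf q \<subseteq> L" using q by (auto simp: fin_supp_def)
  obtain x where x: "bij_betw x {..<card (set_pmf q)} (set_pmf q)"
    using ex_bij_betw_nat_finite[OF fq(1)] by (auto simp: atLeast0LessThan)
  define N where "N = card (set_pmf q)"
  have xs: "x i \<in> set_pmf q" if "i < N" for i using x that by (auto simp: N_def bij_betw_def)
  have e: "(\<Sum>i<N. pmf q (x i) * f (x i)) = measure_pmf.expectation q f" for f :: "'a \<Rightarrow> real"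
    unfolding expectation_fin_supp[OF fq(1)] N_def by (rule sum.reindex_bij_betw[OF x])
  have "conv_box_dim L \<le> Limsup (at_right 0) (\<lambda>r. ereal
        ((\<Sum>i<N. pmf q (x i) * ln_packing (L \<inter> ball (x i) \<rho>) r) / (- ln r)))"
    unfolding conv_box_dim_def
  proof (rule Inf_lower, rule CollectI, rule exI[of _ N], rule exI[of _ x], rule exI[of _ \<rho>],
      rule exI[of _ "\<lambda>i. pmf q (x i)"], intro conjI refl)
    show "1 \<le> N" using fq(1) by (simp add: N_def Suc_le_eq card_gt_0_iff set_pmf_not_empty)
    show "\<forall>i<N. x i \<in> L \<and> 0 < pmf q (x i)" using xs fq by (auto simp: pmf_positive)
    show "(\<Sum>i<N. pmf q (x i)) = 1" using e[of "\<lambda>_. 1"] by simp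
  qed (rule \<rho>)
  also have "\<dots> \<le> ereal t"
  proof (rule Limsup_bounded)
    show "\<forall>\<^sub>F r in at_right 0. ereal
        ((\<Sum>i<N. pmf q (x i) * ln_packing (L \<inter> ball (x i) \<rho>) r) / (- ln r)) \<le> ereal t"
      using ev eventually_less_minus_ln[of 0]
    proof eventually_elim
      fix r assume "\<not> t * (- ln r) < measure_pmf.expectation q (\<lambda>x. ln_packing (L \<inter> ball x \<rho>) r)" "0 < - ln r"
      then show "ereal ((\<Sum>i<N. pmf q (x i) * ln_packing (L \<inter> ball (x i) \<rho>) r) / (- ln r)) \<le> ereal t"
        unfolding e[of "\<lambda>x. ln_packing (L \<inter> ball x \<rho>) r"] by (simp add: field_simps)
    qed
  qed
  finally show False using t by simp
qed

subsection \<open>Neighbourhoods of finitely supported measures\<close>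

lemma finite_separated:
  assumes "finite (X :: 'a::metric_space set)"
  obtains s where "s > 0" "\<And>x y. x \<in> X \<Longrightarrow> y \<in> X \<Longrightarrow> x \<noteq> y \<Longrightarrow> 2 * s \<le> dist x y"
proof -
  define D where "D = insert 1 ((\<lambda>(x, y). dist x y) ` ((X \<times> X) - Id))"
  have D: "finite D" "D \<noteq> {}" "\<And>d. d \<in> D \<Longrightarrow> d > 0" using assms by (auto simp: D_def)
  have "Min D > 0" using D by (simp add: Min_gr_iff)
  moreover have "Min D \<le> dist x y" if "x \<in> X" "y \<in> X" "x \<noteq> y" for x y
    using D(1) that by (intro Min_le) (auto simp: D_def)
  ultimately show thesis by (intro that[of "Min D / 2"]) auto
qed

lemma disjoint_family_separated_balls:
  fixes X :: "'a::euclidean_space set"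
  assumes "\<delta> > 0" "\<And>x y. x \<in> X \<Longrightarrow> y \<in> X \<Longrightarrow> x \<noteq> y \<Longrightarrow> 2 * \<delta> \<le> dist x y"
  shows "disjoint_family_on (\<lambda>x. ball x \<delta> \<inter> K) X"
  unfolding disjoint_family_on_def
proof (intro ballI impI)
  fix x y assume "x \<in> X" "y \<in> X" "x \<noteq> y"
  then have "disjnt (ball x \<delta>) (ball y \<delta>)" using assms by (simp add: disjnt_ball_iff)
  then show "(ball x \<delta> \<inter> K) \<inter> (ball y \<delta> \<inter> K) = {}" by (auto simp: disjnt_def)
qed

text \<open>A tent function centred at \<open>x\<close>. Its integral depends continuously on the
  measure, while the mass of an open ball is only bounded below by it.\<close>

lemma ball_mass_nbhd:
  fixes K :: "'a::euclidean_space set"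
  assumes K: "compact K" and \<delta>: "\<delta> > 0"
  obtains b :: "'a \<Rightarrow> real" where "continuous_on K b" "b x = 1" "\<And>y. 0 \<le> b y" "\<And>y. b y \<le> indicator (ball x \<delta>) y"
    "\<And>M. M \<in> prob_measures K \<Longrightarrow> (\<integral>y. b y \<partial>M) \<le> measure M (ball x \<delta> \<inter> K)"
proof -
  define b where "b y = max 0 (1 - dist x y / \<delta>)" for y
  have c: "continuous_on K b" unfolding b_def using \<delta> by (intro continuous_intros) auto
  have le: "b y \<le> indicator (ball x \<delta>) y" for y
    using \<delta> by (auto simp: b_def indicator_def field_simps)
  show thesis
  proof (rule that[OF c])
    show "b x = 1" "\<And>y. 0 \<le> b y" by (auto simp: b_def)
    fix M assume M: "M \<in> prob_measures K"
    interpret prob_space M by (rule prob_space_prob_measures[OF M])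
    have "(\<integral>y. b y \<partial>M) \<le> (\<integral>y. indicator (ball x \<delta> \<inter> K) y \<partial>M)"
    proof (rule integral_mono[OF integrable_continuous_prob_measures[OF M K c]])
      show "integrable M (indicat_real (ball x \<delta> \<inter> K))"
        using ball_in_sets[OF M] by (intro integrable_const_bound[of _ 1]) auto
      show "b y \<le> indicator (ball x \<delta> \<inter> K) y" if "y \<in> space M" for y
        using le[of y] that by (simp add: space_prob_measures[OF M] indicator_def)
    qed
    then show "(\<integral>y. b y \<partial>M) \<le> measure M (ball x \<delta> \<inter> K)"
      using ball_in_sets[OF M] by simp
  qed (rule le)
qed

text \<open>The third inequality bounds the mass of everything outside the balls around the other
  atoms. It serves balls centred near \<open>x\<close> that stick out of
  \<open>ball x \<delta>\<close> but avoid the other balls.\<close>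

definition atom_masses :: "'a::euclidean_space set \<Rightarrow> 'a pmf \<Rightarrow> real \<Rightarrow> real \<Rightarrow> 'a measure \<Rightarrow> bool" where
  "atom_masses K q \<delta> \<epsilon> M \<longleftrightarrow>
     (\<forall>x\<in>set_pmf q. pmf q x - \<epsilon> \<le> measure M (ball x \<delta> \<inter> K) \<and>
        measure M (ball x \<delta> \<inter> K) \<le> pmf q x + \<epsilon> \<and>
        1 - (\<Sum>y\<in>set_pmf q - {x}. measure M (ball y \<delta> \<inter> K)) \<le> pmf q x + \<epsilon>) \<and>
     1 - (\<Sum>y\<in>set_pmf q. measure M (ball y \<delta> \<inter> K)) \<le> \<epsilon>"

text \<open>The tent functions yield open conditions for lower bounds only. The upper bounds follow
  from total mass 1 and disjointness of the balls; up to \<open>N\<close> losses of \<open>e\<close>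
  accumulate in this way, which explains \<open>e = \<epsilon> / N\<close>.\<close>

lemma atomic_nbhd:
  fixes K :: "'a::euclidean_space set"
  assumes K: "compact K" and q: "fin_supp K q" and \<delta>: "\<delta> > 0" and \<epsilon>: "\<epsilon> > 0"
    and sep: "\<And>x y. x \<in> set_pmf q \<Longrightarrow> y \<in> set_pmf q \<Longrightarrow> x \<noteq> y \<Longrightarrow> 2 * \<delta> \<le> dist x y"
  obtains V where "openin (weak_topology K) V" "atomic K q \<in> V" "\<And>M. M \<in> V \<Longrightarrow> atom_masses K q \<delta> \<epsilon> M"
proof -
  define X where "X = set_pmf q"
  have X: "finite X" "X \<subseteq> K" "X \<noteq> {}" using q by (auto simp: X_def fin_supp_def set_pmf_not_empty)
  define N where "N = real (card X)"
  have N: "N \<ge> 1" using X by (simp add: N_def Suc_le_eq card_gt_0_iff)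
  define e where "e = \<epsilon> / N"
  have e: "e > 0" "N * e = \<epsilon>" "e \<le> \<epsilon>" using \<epsilon> N by (auto simp: e_def field_simps)
  have "\<exists>b :: 'a \<Rightarrow> real. continuous_on K b \<and> b x = 1 \<and> (\<forall>y. 0 \<le> b y) \<and>
      (\<forall>M. M \<in> prob_measures K \<longrightarrow> (\<integral>y. b y \<partial>M) \<le> measure M (ball x \<delta> \<inter> K))" for x
    using ball_mass_nbhd[OF K \<delta>, of x] by metis
  then obtain b :: "'a \<Rightarrow> 'a \<Rightarrow> real" where b: "\<And>x. continuous_on K (b x)" "\<And>x. b x x = 1" "\<And>x y. 0 \<le> b x y"
    "\<And>x M. M \<in> prob_measures K \<Longrightarrow> (\<integral>y. b x y \<partial>M) \<le> measure M (ball x \<delta> \<inter> K)"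
    by metis
  define V where "V = (\<Inter>x\<in>X. {M \<in> prob_measures K. (\<integral>y. b x y \<partial>M) \<in> {pmf q x - e<..}})"
  have m: "pmf q x - e \<le> measure M (ball x \<delta> \<inter> K)" if "M \<in> V" "x \<in> X" for M x
    using that b(4)[of M x] by (force simp: V_def)
  have VP: "V \<subseteq> prob_measures K" using X by (auto simp: V_def)
  have c: "1 - (\<Sum>y\<in>X - {x}. measure M (ball y \<delta> \<inter> K)) \<le> pmf q x + \<epsilon>" if "M \<in> V" "x \<in> X" for M x
  proof -
    have "(\<Sum>y\<in>X - {x}. pmf q y - e) \<le> (\<Sum>y\<in>X - {x}. measure M (ball y \<delta> \<inter> K))"
      using m[OF that(1)] by (intro sum_mono) auto
    moreover have "(\<Sum>y\<in>X - {x}. pmf q y - e) = (1 - pmf q x) - (N - 1) * e"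
      using X that sum_pmf_fin_supp[of q] N by (simp add: sum_subtractf sum_diff1 X_def N_def of_nat_diff)
    ultimately show ?thesis using e by (simp add: algebra_simps)
  qed
  have disj: "disjoint_family_on (\<lambda>x. ball x \<delta> \<inter> K) X"
    using sep by (intro disjoint_family_separated_balls \<delta>) (auto simp: X_def)
  show thesis
  proof (rule that[of V])
    show "openin (weak_topology K) V"
      unfolding V_def
    proof (rule openin_Inter)
      fix S assume "S \<in> (\<lambda>x. {M \<in> prob_measures K. (\<integral>y. b x y \<partial>M) \<in> {pmf q x - e<..}}) ` X"
      then show "openin (weak_topology K) S"
        by (elim imageE, hypsubst) (rule openin_weak_basic[OF b(1) open_greaterThan])
    qed (use X in auto)
    show "atomic K q \<in> V"
    proof -
      have "pmf q x \<le> (\<integral>y. b x y \<partial>atomic K q)" if x: "x \<in> X" for x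
      proof -
        have "pmf q x * b x x \<le> (\<Sum>y\<in>X. pmf q y * b x y)"
          using X x b(3) by (intro member_le_sum) auto
        then show ?thesis
          using integral_atomic[OF q b(1)[of x]] X(1) b(2) by (simp add: expectation_fin_supp X_def)
      qed
      then show ?thesis using atomic_in_prob_measures[OF q] e(1) by (force simp: V_def)
    qed
    show "atom_masses K q \<delta> \<epsilon> M" if M: "M \<in> V" for M
      unfolding atom_masses_def X_def[symmetric]
    proof (intro conjI ballI)
      have MP: "M \<in> prob_measures K" using M VP by auto
      interpret prob_space M by (rule prob_space_prob_measures[OF MP])
      have s1: "(\<Sum>y\<in>X. measure M (ball y \<delta> \<inter> K)) \<le> 1"
        using X disj ball_in_sets[OF MP] finite_measure_finite_Union[of X "\<lambda>y. ball y \<delta> \<inter> K"]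
          prob_le_1[of "\<Union>y\<in>X. ball y \<delta> \<inter> K"] by (simp add: image_subset_iff)
      fix x assume x: "x \<in> X"
      show "pmf q x - \<epsilon> \<le> measure M (ball x \<delta> \<inter> K)" using m[OF M x] e by linarith
      show "1 - (\<Sum>y\<in>X - {x}. measure M (ball y \<delta> \<inter> K)) \<le> pmf q x + \<epsilon>" by (rule c[OF M x])
      then show "measure M (ball x \<delta> \<inter> K) \<le> pmf q x + \<epsilon>"
        using s1 sum.remove[OF X(1) x, of "\<lambda>y. measure M (ball y \<delta> \<inter> K)"] by linarith
    next
      have "(\<Sum>y\<in>X. pmf q y - e) \<le> (\<Sum>y\<in>X. measure M (ball y \<delta> \<inter> K))"
        using m[OF M] by (intro sum_mono) auto
      moreover have "(\<Sum>y\<in>X. pmf q y - e) = 1 - N * e"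
        using X(1) sum_pmf_fin_supp[of q] by (simp add: sum_subtractf X_def N_def)
      ultimately show "1 - (\<Sum>y\<in>X. measure M (ball y \<delta> \<inter> K)) \<le> \<epsilon>" using e by simp
    qed
  qed
qed

lemma small_quot_nbhd:
  fixes K :: "'a::euclidean_space set"
  assumes K: "compact K" and q: "fin_supp K q" and c: "c > 0" and r0: "r0 > 0"
  obtains V r where "openin (weak_topology K) V" "atomic K q \<in> V" "0 < r" "r < r0" "r < 1"
    "\<And>M. M \<in> V \<Longrightarrow> renyi1_quot K M r < c"
proof -
  define X where "X = set_pmf q"
  have X: "finite X" using q by (auto simp: X_def fin_supp_def)
  \<comment> \<open>The entropy will be at most \<open>card X + 2\<close>: each atom has its ball
    covered by a single ball, so only its additive 1 remains; the rest contributes its own 1 and at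
    most 1 for its mass times \<open>L\<close>.\<close>
  obtain r where r: "0 < r" "r < min 1 r0" "(real (card X) + 2) / c < - ln r"
    using eventually_happens'[OF trivial_limit_at_right_real eventually_conj[OF
        eventually_less_at_right_0[of "min 1 r0"] eventually_less_minus_ln[of "(real (card X) + 2) / c"]]] r0
    by auto
  obtain D where D: "finite D" "D \<subseteq> K" "K \<subseteq> (\<Union>c\<in>D. ball c (r / 2))"
    using finite_ball_cover[OF K, of "r / 2"] r by auto
  obtain s where s: "s > 0" "\<And>x y. x \<in> X \<Longrightarrow> y \<in> X \<Longrightarrow> x \<noteq> y \<Longrightarrow> 2 * s \<le> dist x y"
    using finite_separated[OF X] by blast
  define \<delta> where "\<delta> = min s (r / 2)"
  have \<delta>: "\<delta> > 0" "\<delta> \<le> s" "\<delta> \<le> r / 2" using s r by (auto simp: \<delta>_def)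
  define L where "L = ln (real (card D))"
  have L: "L \<ge> 0" unfolding L_def by (cases "card D = 0") auto
  have sep: "2 * \<delta> \<le> dist x y" if "x \<in> set_pmf q" "y \<in> set_pmf q" "x \<noteq> y" for x y
    using s(2)[of x y] that \<delta>(2) by (auto simp: X_def)
  \<comment> \<open>The mass of the rest times \<open>L\<close> stays below 1; adding 1 in the
    denominator covers \<open>L = 0\<close>.\<close>
  have e: "1 / (L + 1) > 0" using L by simp
  obtain V where V: "openin (weak_topology K) V" "atomic K q \<in> V" "\<And>M. M \<in> V \<Longrightarrow> atom_masses K q \<delta> (1 / (L + 1)) M"
    using atomic_nbhd[OF K q \<delta>(1) e sep] by blast
  show thesis
  proof (rule that[OF V(1,2) r(1)])
    fix M assume M: "M \<in> V"
    then have MP: "M \<in> prob_measures K" using openin_subset[OF V(1)] by auto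
    have "ball_entropy K M r \<le> (\<Sum>x\<in>X. measure M (ball x \<delta> \<inter> K) * ln (real (card {x})) + 1)
           + (1 - (\<Sum>x\<in>X. measure M (ball x \<delta> \<inter> K))) * ln (real (card D)) + 1"
    proof (rule ball_entropy_le[OF K MP r(1) X _ ball_in_sets[OF MP] _ _ D(1,3)])
      show "disjoint_family_on (\<lambda>x. ball x \<delta> \<inter> K) X"
        using sep by (intro disjoint_family_separated_balls \<delta>) (auto simp: X_def)
    qed (use \<delta> in auto)
    also have "\<dots> \<le> real (card X) + 1 / (L + 1) * L + 1"
      using mult_right_mono[OF _ L, of "1 - (\<Sum>y\<in>X. measure M (ball y \<delta> \<inter> K))" "1 / (L + 1)"] V(3)[OF M] by (simp add: X_def L_def atom_masses_def)
    also have "\<dots> \<le> real (card X) + 2" using L by (simp add: field_simps)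
    also have "\<dots> < c * (- ln r)" using r(3) c by (simp add: field_simps)
    finally show "renyi1_quot K M r < c"
      unfolding renyi1_quot_eq using r by (subst pos_divide_less_eq) auto
  qed (use r in auto)
qed

text \<open>A competitor in the infimum for the convex dimension, with one radius for all atoms and
  a bound at all small scales. Smaller radii preserve the bound, so the notion can be localized and
  is stable under mixtures.\<close>

definition packs_below :: "'a::euclidean_space set \<Rightarrow> 'a pmf \<Rightarrow> real \<Rightarrow> bool" where
  "packs_below K q t \<longleftrightarrow> fin_supp K q \<and> (\<exists>\<sigma>>0. \<forall>\<^sub>F r in at_right 0.
     measure_pmf.expectation q (\<lambda>x. ln_packing (K \<inter> ball x \<sigma>) r) \<le> t * (- ln r))"

lemma eventually_at_right_0_quarter:
  assumes "\<forall>\<^sub>F r in at_right (0::real). P r"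
  shows "\<forall>\<^sub>F r in at_right 0. P (r / 4)"
proof -
  obtain b where "b > 0" "\<And>r. 0 < r \<Longrightarrow> r < b \<Longrightarrow> P r"
    using assms unfolding eventually_at_right_field by auto
  then show ?thesis unfolding eventually_at_right_field by (intro exI[of _ "4 * b"]) auto
qed

text \<open>Maximal packings at scale \<open>r\<close> give coverings by balls of radius \<open>2 r\<close>, so packing numbers at
  scale \<open>r\<close> control the entropy at scale \<open>4 r\<close>.\<close>

lemma packs_below_nbhd:
  fixes K :: "'a::euclidean_space set"
  assumes K: "compact K" and q: "packs_below K q t" and \<eta>: "\<eta> > 0"
  obtains V where "openin (weak_topology K) V" "atomic K q \<in> V" "\<And>M. M \<in> V \<Longrightarrow> upper_D1 K M \<le> ereal (t + \<eta>)"
proof -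
  define X where "X = set_pmf q"
  have fs: "fin_supp K q" using q by (simp add: packs_below_def)
  then have X: "finite X" "X \<subseteq> K" by (auto simp: X_def fin_supp_def)
  obtain \<sigma> where \<sigma>: "\<sigma> > 0" "\<forall>\<^sub>F r in at_right 0. measure_pmf.expectation q (\<lambda>x. ln_packing (K \<inter> ball x \<sigma>) r) \<le> t * (- ln r)"
    using q by (auto simp: packs_below_def)
  obtain s where s: "s > 0" "\<And>x y. x \<in> X \<Longrightarrow> y \<in> X \<Longrightarrow> x \<noteq> y \<Longrightarrow> 2 * s \<le> dist x y"
    using finite_separated[OF X(1)] by blast
  define \<delta> where "\<delta> = min s \<sigma>"
  have \<delta>: "\<delta> > 0" "\<delta> \<le> s" "\<delta> \<le> \<sigma>" using s \<sigma> by (auto simp: \<delta>_def)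
  have sep: "2 * \<delta> \<le> dist x y" if "x \<in> set_pmf q" "y \<in> set_pmf q" "x \<noteq> y" for x y
    using s(2)[of x y] that \<delta>(2) by (auto simp: X_def)
  define D where "D = real DIM('a) + 1"
  define N where "N = real (card X)"
  \<comment> \<open>There are \<open>N + 1\<close> mass errors of size \<epsilon>, one per atom and
    one for the rest. Each is multiplied by a logarithm of at most \<open>D * (- ln r)\<close>, so
    together they use up half of \<eta>.\<close>
  define \<epsilon> where "\<epsilon> = \<eta> / (2 * D * (N + 1))"
  have D: "D > 0" and N: "N \<ge> 0" by (auto simp: D_def N_def)
  have \<epsilon>: "\<epsilon> > 0" "(N + 1) * \<epsilon> * D = \<eta> / 2" using \<eta> D N by (simp_all add: \<epsilon>_def)
  obtain V where V: "openin (weak_topology K) V" "atomic K q \<in> V" "\<And>M. M \<in> V \<Longrightarrow> atom_masses K q \<delta> \<epsilon> M"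
    using atomic_nbhd[OF K fs \<delta>(1) \<epsilon>(1) sep] by blast
  have bK: "bounded K" using K by (rule compact_imp_bounded)
  show thesis
  proof (rule that[OF V(1,2)])
    fix M assume M: "M \<in> V"
    then have MP: "M \<in> prob_measures K" using openin_subset[OF V(1)] by auto
    \<comment> \<open>The other half of \<eta> absorbs the constants: \<open>ln 4\<close> from
      passing between the scales \<open>R / 4\<close> and \<open>R\<close>, and \<open>N + 1\<close>
      from the pieces.\<close>
    have "\<forall>\<^sub>F R in at_right 0. renyi1_quot K M R \<le> t + \<eta>"
      using eventually_at_right_0_quarter[OF \<sigma>(2)] eventually_at_right_0_quarter[OF ln_packing_le[OF bK]]
        eventually_less_at_right_0[of 1, simplified] eventually_less_minus_ln[of "((t + \<eta> / 2) * ln 4 + N + 1) / (\<eta> / 2)"]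
    proof eventually_elim
      fix R :: real
      assume E1: "measure_pmf.expectation q (\<lambda>x. ln_packing (K \<inter> ball x \<sigma>) (R / 4)) \<le> t * (- ln (R / 4))"
        and E2: "ln_packing K (R / 4) \<le> (real DIM('a) + 1) * (- ln (R / 4))"
        and R: "0 < R \<and> R < 1"
        and E3: "((t + \<eta> / 2) * ln 4 + N + 1) / (\<eta> / 2) < - ln R"
      define r where "r = R / 4"
      have r: "r > 0" using R by (simp add: r_def)
      define a where "a x = ln_packing (K \<inter> ball x \<delta>) r" for x
      define b where "b = ln_packing K r"
      have a: "0 \<le> a x" "a x \<le> b" "a x \<le> ln_packing (K \<inter> ball x \<sigma>) r" for x
        unfolding a_def b_def using \<delta>(3) bK r
        by (auto intro!: ln_packing_nonneg ln_packing_mono bounded_Int)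
      have "\<exists>C. packing (K \<inter> ball x \<delta>) r C \<and> card C = packing_number (K \<inter> ball x \<delta>) r" for x
        using packing_number_attained[of "K \<inter> ball x \<delta>" r] bK r by (metis bounded_Int)
      then obtain C where C: "\<And>x. packing (K \<inter> ball x \<delta>) r (C x)" "\<And>x. card (C x) = packing_number (K \<inter> ball x \<delta>) r"
        by metis
      obtain C0 where C0: "packing K r C0" "card C0 = packing_number K r"
        using packing_number_attained[OF bK r] by blast
      have R2: "R / 2 = 2 * r" by (simp add: r_def)
      have "ball_entropy K M R \<le> (\<Sum>x\<in>X. measure M (ball x \<delta> \<inter> K) * ln (real (card (C x))) + 1)
           + (1 - (\<Sum>x\<in>X. measure M (ball x \<delta> \<inter> K))) * ln (real (card C0)) + 1"
      proof (rule ball_entropy_le[OF K MP _ X(1) _ ball_in_sets[OF MP]])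
        show "disjoint_family_on (\<lambda>x. ball x \<delta> \<inter> K) X"
          using sep by (intro disjoint_family_separated_balls \<delta>) (auto simp: X_def)
        show "finite (C x)" "finite C0" for x using C(1) C0(1) by (auto simp: packing_def)
        show "K \<subseteq> (\<Union>c\<in>C0. ball c (R / 2))"
          unfolding R2 by (rule maximal_packing_cover[OF bK r C0])
        show "ball x \<delta> \<inter> K \<subseteq> (\<Union>c\<in>C x. ball c (R / 2))" for x
          unfolding R2 using maximal_packing_cover[OF _ r C(1,2)[of x]] bK by (simp add: Int_commute bounded_Int)
      qed (use R in auto)
      also have "\<dots> = (\<Sum>x\<in>X. measure M (ball x \<delta> \<inter> K) * a x) + N
           + (1 - (\<Sum>x\<in>X. measure M (ball x \<delta> \<inter> K))) * b + 1"
        by (simp add: C C0 a_def b_def sum.distrib N_def)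
      also have "(\<Sum>x\<in>X. measure M (ball x \<delta> \<inter> K) * a x) \<le> (\<Sum>x\<in>X. (pmf q x + \<epsilon>) * a x)"
        using V(3)[OF M] a(1) by (intro sum_mono mult_right_mono) (auto simp: X_def atom_masses_def)
      also have "\<dots> = (\<Sum>x\<in>X. pmf q x * a x) + \<epsilon> * (\<Sum>x\<in>X. a x)"
        by (simp add: algebra_simps sum.distrib sum_distrib_left)
      also have "(\<Sum>x\<in>X. pmf q x * a x) \<le> (\<Sum>x\<in>X. pmf q x * ln_packing (K \<inter> ball x \<sigma>) r)"
        using a(3) by (intro sum_mono mult_left_mono) auto
      also have "\<dots> = measure_pmf.expectation q (\<lambda>x. ln_packing (K \<inter> ball x \<sigma>) r)"
        using X(1) by (simp add: expectation_fin_supp X_def)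
      also have "\<dots> \<le> t * (- ln r)" using E1 by (simp add: r_def)
      also have "(\<Sum>x\<in>X. a x) \<le> N * b"
        using sum_bounded_above[of X a b] a(2) by (simp add: N_def)
      also have "(1 - (\<Sum>x\<in>X. measure M (ball x \<delta> \<inter> K))) * b \<le> \<epsilon> * b"
        using V(3)[OF M] ln_packing_nonneg[of K r] by (intro mult_right_mono) (auto simp: X_def b_def atom_masses_def)
      finally have "ball_entropy K M R \<le> t * (- ln r) + \<epsilon> * (N * b) + N + \<epsilon> * b + 1"
        using \<epsilon>(1) by simp
      also have "\<dots> = t * (- ln r) + (N + 1) * \<epsilon> * b + (N + 1)" by (simp add: algebra_simps)
      also have "\<dots> \<le> t * (- ln r) + (N + 1) * \<epsilon> * (D * (- ln r)) + (N + 1)"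
      proof (intro add_right_mono add_left_mono mult_left_mono)
        show "b \<le> D * (- ln r)" using E2 by (simp only: b_def D_def r_def)
      qed (use \<epsilon>(1) N in simp)
      also have "(N + 1) * \<epsilon> * (D * (- ln r)) = \<eta> / 2 * (- ln r)" using \<epsilon>(2) by (simp add: mult.assoc[symmetric])
      finally have "ball_entropy K M R \<le> (t + \<eta> / 2) * (- ln r) + (N + 1)" by (simp add: algebra_simps)
      also have "- ln r = - ln R + ln 4" using R by (simp add: r_def ln_div)
      also have "(t + \<eta> / 2) * (- ln R + ln 4) + (N + 1) \<le> (t + \<eta>) * (- ln R)"
        using E3 \<eta> by (simp add: field_simps)
      finally show "renyi1_quot K M R \<le> t + \<eta>"
        unfolding renyi1_quot_eq using R by (subst pos_divide_le_eq) auto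
    qed
    then show "upper_D1 K M \<le> ereal (t + \<eta>)"
      unfolding upper_D1_def by (intro Limsup_bounded) simp
  qed
qed

text \<open>If \<open>x\<close> is within \<open>r / 2\<close> of an atom \<open>e\<close>, then
  \<open>ball x r\<close> misses the balls of radius \<open>r / 2\<close> around all other atoms: a
  common point would put two atoms closer than \<open>r / 2 + r + r / 2\<close>. Its mass is thus at
  most about \<open>pmf q e\<close>, and the entropy at scale \<open>r\<close> is nearly the Shannon
  entropy of \<open>q\<close> or larger.\<close>

lemma entropy_lower_nbhd:
  fixes K :: "'a::euclidean_space set"
  assumes K: "compact K" and q: "fin_supp K q" and r: "r > 0"
    and sep: "\<And>x y. x \<in> set_pmf q \<Longrightarrow> y \<in> set_pmf q \<Longrightarrow> x \<noteq> y \<Longrightarrow> 2 * r \<le> dist x y"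
    and c: "c < measure_pmf.expectation q (\<lambda>x. - ln (pmf q x))"
  obtains V where "openin (weak_topology K) V" "atomic K q \<in> V" "\<And>M. M \<in> V \<Longrightarrow> c < ball_entropy K M r"
proof -
  define X where "X = set_pmf q"
  have X: "finite X" "X \<subseteq> K" using q by (auto simp: X_def fin_supp_def)
  \<comment> \<open>The bound obtained with mass error \<epsilon> is continuous in \<epsilon>, and
    at 0 it is the Shannon entropy, since the masses are at most 1 and the cut-off has no effect
    there.\<close>
  have "((\<lambda>\<epsilon>. \<Sum>x\<in>X. (pmf q x - \<epsilon>) * max 0 (- ln (pmf q x + \<epsilon>))) \<longlongrightarrow>
      (\<Sum>x\<in>X. (pmf q x - 0) * max 0 (- ln (pmf q x + 0)))) (at_right 0)"
    by (intro tendsto_intros) (auto simp: X_def set_pmf_iff)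
  moreover have "(\<Sum>x\<in>X. (pmf q x - 0) * max 0 (- ln (pmf q x + 0))) = measure_pmf.expectation q (\<lambda>x. - ln (pmf q x))"
    unfolding expectation_fin_supp[OF X(1)[unfolded X_def]] X_def
    by (rule sum.cong) (simp_all add: pmf_le_1 pmf_positive)
  ultimately have "\<forall>\<^sub>F \<epsilon> in at_right 0. c < (\<Sum>x\<in>X. (pmf q x - \<epsilon>) * max 0 (- ln (pmf q x + \<epsilon>)))"
    using c by (simp add: order_tendstoD(1))
  then obtain \<epsilon> where \<epsilon>: "\<epsilon> > 0" "c < (\<Sum>x\<in>X. (pmf q x - \<epsilon>) * max 0 (- ln (pmf q x + \<epsilon>)))"
    using eventually_happens'[OF trivial_limit_at_right_real eventually_conj[OF _ eventually_at_right_less[of 0]]] by blast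
  have sep': "2 * (r / 2) \<le> dist x y" if "x \<in> set_pmf q" "y \<in> set_pmf q" "x \<noteq> y" for x y
    using sep[OF that] r by simp
  have r2: "r / 2 > 0" using r by simp
  obtain V where V: "openin (weak_topology K) V" "atomic K q \<in> V" "\<And>M. M \<in> V \<Longrightarrow> atom_masses K q (r / 2) \<epsilon> M"
    using atomic_nbhd[OF K q r2 \<epsilon>(1) sep'] by blast
  have disj: "disjoint_family_on (\<lambda>x. ball x (r / 2) \<inter> K) X"
    using sep' by (intro disjoint_family_separated_balls r2) (auto simp: X_def)
  show thesis
  proof (rule that[OF V(1,2)])
    fix M assume M: "M \<in> V"
    then have MP: "M \<in> prob_measures K" using openin_subset[OF V(1)] by auto
    interpret prob_space M by (rule prob_space_prob_measures[OF MP])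
    have "c < (\<Sum>x\<in>X. (pmf q x - \<epsilon>) * max 0 (- ln (pmf q x + \<epsilon>)))" by (rule \<epsilon>(2))
    also have "\<dots> \<le> (\<Sum>x\<in>X. measure M (ball x (r / 2) \<inter> K) * max 0 (- ln (pmf q x + \<epsilon>)))"
      using V(3)[OF M] by (intro sum_mono mult_right_mono) (auto simp: X_def atom_masses_def)
    also have "\<dots> \<le> ball_entropy K M r"
    proof (rule ball_entropy_ge[OF K MP r X(1) disj ball_in_sets[OF MP]])
      fix e x assume e: "e \<in> X" and x: "x \<in> ball e (r / 2) \<inter> K"
      let ?U = "\<Union>y\<in>X - {e}. ball y (r / 2) \<inter> K"
      have U: "?U \<in> sets M" using X(1) ball_in_sets[OF MP] by (intro sets.finite_UN) auto
      have "ball x r \<inter> K \<subseteq> space M - ?U"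
      proof
        fix z assume z: "z \<in> ball x r \<inter> K"
        have "z \<notin> ball y (r / 2)" if y: "y \<in> X" "y \<noteq> e" for y
        proof
          assume "z \<in> ball y (r / 2)"
          then have "dist e y < 2 * r"
            using z x dist_triangle[of e y x] dist_triangle[of x y z] by (simp add: dist_commute)
          then show False using sep[of e y] e y by (auto simp: X_def)
        qed
        then show "z \<in> space M - ?U" using z by (auto simp: space_prob_measures[OF MP])
      qed
      then have "measure M (ball x r \<inter> K) \<le> measure M (space M - ?U)"
        using U by (intro finite_measure_mono) auto
      also have "\<dots> = 1 - measure M ?U" by (rule prob_compl[OF U])
      also have "measure M ?U = (\<Sum>y\<in>X - {e}. measure M (ball y (r / 2) \<inter> K))"
        using X(1) ball_in_sets[OF MP] disjoint_family_on_mono[OF _ disj, of "X - {e}"]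
        by (intro finite_measure_finite_Union) auto
      also have "1 - \<dots> \<le> pmf q e + \<epsilon>" using V(3)[OF M] e by (simp add: X_def atom_masses_def)
      finally show "measure M (ball x r \<inter> K) \<le> pmf q e + \<epsilon>" .
    qed
    finally show "c < ball_entropy K M r" .
  qed
qed

text \<open>The finitely many atoms lie in the open ball, so for a small radius \<open>d\<close> the
  balls around them stay inside it, and a competitor for the piece becomes one for
  \<open>K\<close>.\<close>

lemma packs_below_local:
  fixes K :: "'a::euclidean_space set"
  assumes K: "compact K" and t: "conv_box_dim (K \<inter> ball y \<rho>) < ereal t"
  obtains q where "fin_supp (K \<inter> ball y \<rho>) q" "packs_below K q t"
proof -
  obtain q \<sigma> where q: "fin_supp (K \<inter> ball y \<rho>) q" "\<sigma> > 0"
    "\<forall>\<^sub>F r in at_right 0. measure_pmf.expectation q (\<lambda>x. ln_packing (K \<inter> ball y \<rho> \<inter> ball x \<sigma>) r) \<le> t * (- ln r)"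
    using conv_box_dim_lessD[OF t] by blast
  define X where "X = set_pmf q"
  have X: "finite X" "X \<subseteq> K \<inter> ball y \<rho>" using q by (auto simp: X_def fin_supp_def)
  define d where "d = Min (insert \<sigma> ((\<lambda>x. \<rho> - dist y x) ` X))"
  have d: "d > 0" "d \<le> \<sigma>" "\<And>x. x \<in> X \<Longrightarrow> d \<le> \<rho> - dist y x"
    using X q(2) by (auto simp: d_def)
  have sub: "K \<inter> ball x d \<subseteq> K \<inter> ball y \<rho> \<inter> ball x \<sigma>" if x: "x \<in> X" for x
  proof -
    have "ball x d \<subseteq> ball y \<rho>"
    proof
      fix z assume "z \<in> ball x d"
      then show "z \<in> ball y \<rho>" using d(3)[OF x] dist_triangle[of y z x] by simp
    qed
    then show ?thesis using d(2) by auto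
  qed
  have "\<forall>\<^sub>F r in at_right 0. measure_pmf.expectation q (\<lambda>x. ln_packing (K \<inter> ball x d) r) \<le> t * (- ln r)"
    using q(3) eventually_at_right_less[of 0]
  proof eventually_elim
    fix r :: real
    assume le: "measure_pmf.expectation q (\<lambda>x. ln_packing (K \<inter> ball y \<rho> \<inter> ball x \<sigma>) r) \<le> t * (- ln r)" and r: "0 < r"
    have "measure_pmf.expectation q (\<lambda>x. ln_packing (K \<inter> ball x d) r)
        \<le> measure_pmf.expectation q (\<lambda>x. ln_packing (K \<inter> ball y \<rho> \<inter> ball x \<sigma>) r)"
      unfolding expectation_fin_supp[OF X(1)[unfolded X_def]]
      using sub K r by (intro sum_mono mult_left_mono ln_packing_mono) (auto simp: X_def compact_imp_bounded bounded_Int)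
    then show "measure_pmf.expectation q (\<lambda>x. ln_packing (K \<inter> ball x d) r) \<le> t * (- ln r)" using le by simp
  qed
  moreover have "fin_supp K q" using q(1) by (auto simp: fin_supp_def)
  ultimately have "packs_below K q t" using d(1) by (auto simp: packs_below_def)
  with q(1) show thesis using that by blast
qed

text \<open>This is the convexity in the convex dimension: all \<open>h x\<close> obey the same
  bound, so their mixtures do too, once the least of the finitely many radii is used
  throughout.\<close>

lemma packs_below_bind:
  fixes K :: "'a::euclidean_space set"
  assumes K: "compact K" and q: "fin_supp K q" and h: "\<And>x. x \<in> set_pmf q \<Longrightarrow> packs_below K (h x) t"
  shows "packs_below K (bind_pmf q h) t"
proof -
  define X where "X = set_pmf q"
  have X: "finite X" "X \<subseteq> K" using q by (auto simp: X_def fin_supp_def)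
  have fh: "fin_supp K (h x)" if "x \<in> X" for x using h that by (auto simp: X_def packs_below_def)
  then have fin: "finite (set_pmf (h x))" if "x \<in> X" for x using that by (auto simp: fin_supp_def)
  have "\<forall>x\<in>X. \<exists>\<sigma>. \<sigma> > 0 \<and> (\<forall>\<^sub>F r in at_right 0.
      measure_pmf.expectation (h x) (\<lambda>z. ln_packing (K \<inter> ball z \<sigma>) r) \<le> t * (- ln r))"
    using h by (simp add: packs_below_def X_def)
  from bchoice[OF this] obtain \<sigma> where "\<forall>x\<in>X. \<sigma> x > 0 \<and> (\<forall>\<^sub>F r in at_right 0.
      measure_pmf.expectation (h x) (\<lambda>z. ln_packing (K \<inter> ball z (\<sigma> x)) r) \<le> t * (- ln r))" ..
  then have \<sigma>: "\<And>x. x \<in> X \<Longrightarrow> \<sigma> x > 0" "\<And>x. x \<in> X \<Longrightarrow> \<forall>\<^sub>F r in at_right 0.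
      measure_pmf.expectation (h x) (\<lambda>z. ln_packing (K \<inter> ball z (\<sigma> x)) r) \<le> t * (- ln r)"
    by blast+
  define s where "s = Min (insert 1 (\<sigma> ` X))"
  have s: "s > 0" "\<And>x. x \<in> X \<Longrightarrow> s \<le> \<sigma> x" using X \<sigma>(1) by (auto simp: s_def)
  have "\<forall>\<^sub>F r in at_right 0. \<forall>x\<in>X. measure_pmf.expectation (h x) (\<lambda>z. ln_packing (K \<inter> ball z (\<sigma> x)) r) \<le> t * (- ln r)"
    using \<sigma>(2) X(1) by (auto intro: eventually_ball_finite)
  then have "\<forall>\<^sub>F r in at_right 0. measure_pmf.expectation (bind_pmf q h) (\<lambda>z. ln_packing (K \<inter> ball z s) r) \<le> t * (- ln r)"
    using eventually_at_right_less[of 0]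
  proof eventually_elim
    fix r :: real
    assume le: "\<forall>x\<in>X. measure_pmf.expectation (h x) (\<lambda>z. ln_packing (K \<inter> ball z (\<sigma> x)) r) \<le> t * (- ln r)" and r: "0 < r"
    have "measure_pmf.expectation (h x) (\<lambda>z. ln_packing (K \<inter> ball z s) r) \<le> t * (- ln r)" if x: "x \<in> X" for x
    proof -
      have "measure_pmf.expectation (h x) (\<lambda>z. ln_packing (K \<inter> ball z s) r)
        \<le> measure_pmf.expectation (h x) (\<lambda>z. ln_packing (K \<inter> ball z (\<sigma> x)) r)"
        unfolding expectation_fin_supp[OF fin[OF x]]
      proof (intro sum_mono mult_left_mono ln_packing_mono r)
        show "K \<inter> ball z s \<subseteq> K \<inter> ball z (\<sigma> x)" for z using s(2)[OF x] by auto
      qed (use K in \<open>auto simp: compact_imp_bounded bounded_Int\<close>)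
      then show ?thesis using le x by fastforce
    qed
    then have "(\<Sum>x\<in>X. pmf q x * measure_pmf.expectation (h x) (\<lambda>z. ln_packing (K \<inter> ball z s) r)) \<le> (\<Sum>x\<in>X. pmf q x * (t * (- ln r)))"
      by (intro sum_mono mult_left_mono) auto
    also have "\<dots> = t * (- ln r)"
      using sum_pmf_fin_supp[of q] X(1) by (simp only: sum_distrib_right[symmetric] X_def)
    finally show "measure_pmf.expectation (bind_pmf q h) (\<lambda>z. ln_packing (K \<inter> ball z s) r) \<le> t * (- ln r)"
      using X(1) fin by (simp add: expectation_bind_fin_supp X_def)
  qed
  moreover have "fin_supp K (bind_pmf q h)" using fh by (intro fin_supp_bind q) (auto simp: X_def)
  ultimately show ?thesis using s(1) by (auto simp: packs_below_def)
qed

text \<open>The atoms in \<open>L\<close> are spread uniformly over maximal packings at a common scale; the resulting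
  entropy is at least the average of the logarithms of the packing numbers.\<close>

lemma large_quot_nbhd:
  fixes K :: "'a::euclidean_space set"
  assumes K: "compact K" and W: "openin (weak_topology K) W" and q: "fin_supp K q" "atomic K q \<in> W"
    and L: "L \<subseteq> K" and s: "0 < s" "s \<le> measure_pmf.prob q L" and t: "0 \<le> t" "ereal t < conv_box_dim L"
    and r0: "0 < r0"
  obtains V r where "openin (weak_topology K) V" "V \<inter> W \<noteq> {}" "0 < r" "r < r0" "r < 1"
    "\<And>M. M \<in> V \<Longrightarrow> s * t < renyi1_quot K M r"
proof -
  define X where "X = set_pmf q"
  have X: "finite X" "X \<subseteq> K" using q by (auto simp: X_def fin_supp_def)
  have bL: "bounded L" using bounded_subset[OF compact_imp_bounded[OF K] L] .
  have ne: "set_pmf q \<inter> L \<noteq> {}"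
    using s measure_pmf_zero_iff[of q L] by force
  \<comment> \<open>The dimension of \<open>L\<close> can be tested only by points of
    \<open>L\<close>, so \<open>q\<close> is conditioned on \<open>L\<close>; the factor
    \<open>prob q L\<close> restores the original weights and is the source of \<open>s\<close> in
    the conclusion.\<close>
  define p where "p = cond_pmf q L"
  have sp: "set_pmf p = X \<inter> L" unfolding p_def X_def by (rule set_cond_pmf[OF ne])
  have pp: "pmf p x * measure_pmf.prob q L = pmf q x" if "x \<in> L" for x
    using that s unfolding p_def by (simp add: pmf_cond[OF ne])
  have fp: "fin_supp L p" using X by (auto simp: fin_supp_def sp)
  obtain \<rho>1 where \<rho>1: "\<rho>1 > 0"
    "\<And>h. (\<And>x. x \<in> set_pmf q \<Longrightarrow> fin_supp (K \<inter> ball x \<rho>1) (h x)) \<Longrightarrow> atomic K (bind_pmf q h) \<in> W"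
    using atomic_perturb[OF K W q] by blast
  obtain s0 where s0: "s0 > 0" "\<And>x y. x \<in> X \<Longrightarrow> y \<in> X \<Longrightarrow> x \<noteq> y \<Longrightarrow> 2 * s0 \<le> dist x y"
    using finite_separated[OF X(1)] by blast
  \<comment> \<open>Atoms are at least \<open>2 * s0\<close> apart and are moved by less than
    \<open>s0 / 2\<close>, so points arising from different atoms stay at distance at least
    \<open>s0\<close>, which exceeds \<open>2 * r\<close>.\<close>
  define \<rho> where "\<rho> = min \<rho>1 (s0 / 2)"
  have \<rho>: "\<rho> > 0" "\<rho> \<le> \<rho>1" "\<rho> \<le> s0 / 2" using \<rho>1 s0 by (auto simp: \<rho>_def)
  have "\<exists>\<^sub>F r in at_right 0. t * (- ln r) < measure_pmf.expectation p (\<lambda>x. ln_packing (L \<inter> ball x \<rho>) r) \<and>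
      (0 < r \<and> r < min (min 1 r0) (s0 / 2))"
    using conv_box_dim_greaterD[OF t(2) fp \<rho>(1)] r0 s0(1)
    by (intro frequently_eventually_frequently eventually_less_at_right_0) auto
  from frequently_ex[OF this] obtain r where
    r': "t * (- ln r) < measure_pmf.expectation p (\<lambda>x. ln_packing (L \<inter> ball x \<rho>) r) \<and>
      (0 < r \<and> r < min (min 1 r0) (s0 / 2))" ..
  then have r: "0 < r" "r < 1" "r < r0" "r < s0 / 2"
    and big: "t * (- ln r) < measure_pmf.expectation p (\<lambda>x. ln_packing (L \<inter> ball x \<rho>) r)"
    by auto
  have "\<exists>C. packing (L \<inter> ball x \<rho>) r C \<and> card C = packing_number (L \<inter> ball x \<rho>) r" for x
    using packing_number_attained[of "L \<inter> ball x \<rho>" r] bL r by (metis bounded_Int)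
  then obtain C where C: "\<And>x. packing (L \<inter> ball x \<rho>) r (C x)" "\<And>x. card (C x) = packing_number (L \<inter> ball x \<rho>) r"
    by metis
  have C1: "finite (C x)" "C x \<subseteq> L" "C x \<subseteq> ball x \<rho>" for x using C(1)[of x] by (auto simp: packing_def)
  have Cne: "C x \<noteq> {}" if "x \<in> L" for x
  proof -
    have "1 \<le> packing_number (L \<inter> ball x \<rho>) r"
      using that \<rho> bL r by (intro packing_number_pos) (auto intro: bounded_Int)
    then show ?thesis using C(2)[of x] by auto
  qed
  define h where "h x = (if x \<in> L then pmf_of_set (C x) else return_pmf x)" for x
  have sh: "set_pmf (h x) = (if x \<in> L then C x else {x})" for x
    using C1(1)[of x] Cne[of x] by (simp add: h_def set_pmf_of_set)
  have shb: "set_pmf (h x) \<subseteq> ball x \<rho>" for x using C1(3)[of x] \<rho>(1) by (simp add: sh)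
  have fh: "finite (set_pmf (h x))" for x using C1(1)[of x] by (simp add: sh)
  define q' where "q' = bind_pmf q h"
  have W': "atomic K q' \<in> W"
    unfolding q'_def
  proof (rule \<rho>1(2))
    fix x assume "x \<in> set_pmf q"
    then have "set_pmf (h x) \<subseteq> K" using C1(2)[of x] L X by (auto simp: sh X_def)
    then show "fin_supp (K \<inter> ball x \<rho>1) (h x)"
      using shb[of x] fh[of x] \<rho>(2) by (auto simp: fin_supp_def)
  qed
  have fq': "fin_supp K q'"
    unfolding q'_def using C1(2) L X fh by (intro fin_supp_bind q) (auto simp: fin_supp_def sh X_def split: if_splits)
  have far: "2 * r \<le> dist u v" if "x \<in> X" "y \<in> X" "x \<noteq> y" "u \<in> set_pmf (h x)" "v \<in> set_pmf (h y)" for x y u v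
  proof -
    have "dist x u < s0 / 2" "dist y v < s0 / 2" using shb[of x] shb[of y] that \<rho>(3) by auto
    moreover have "dist x y \<le> dist x u + dist u v + dist y v"
      using dist_triangle[of x y u] dist_triangle[of u y v] by (simp add: dist_commute)
    ultimately show ?thesis using s0(2)[OF that(1-3)] r by simp
  qed
  have sep: "2 * r \<le> dist u v" if u: "u \<in> set_pmf q'" and v: "v \<in> set_pmf q'" and uv: "u \<noteq> v" for u v
  proof -
    obtain x y where x: "x \<in> X" "u \<in> set_pmf (h x)" and y: "y \<in> X" "v \<in> set_pmf (h y)"
      using u v by (auto simp: q'_def X_def)
    show ?thesis
    proof (cases "x = y")
      case True
      then have "u \<in> C x" "v \<in> C x" using x y uv by (auto simp: sh split: if_splits)
      then show ?thesis using C(1)[of x] uv disjnt_ball_iff[OF r(1), of u v] by (auto simp: packing_def pairwise_def)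
    next
      case False
      then show ?thesis using far x y by blast
    qed
  qed
  have small: "pmf q' u \<le> 1 / real (card (C x))" if x: "x \<in> X" "x \<in> L" and u: "u \<in> C x" for x u
  proof -
    have "pmf (h a) u = 0" if "a \<in> X" "a \<noteq> x" for a
    proof (rule ccontr)
      assume "pmf (h a) u \<noteq> 0"
      then have "u \<in> set_pmf (h a)" by (simp add: set_pmf_iff)
      then have "2 * r \<le> dist u u" using that x u by (intro far[of a x]) (auto simp: sh)
      then show False using r by simp
    qed
    then have "(\<Sum>a\<in>X. pmf q a * pmf (h a) u) = (\<Sum>a\<in>X. if a = x then pmf q x * pmf (h x) u else 0)"
      by (intro sum.cong) auto
    also have "\<dots> = pmf q x * (1 / real (card (C x)))"
      using X(1) x u C1(1)[of x] Cne[of x] by (simp add: h_def pmf_of_set)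
    \<comment> \<open>Replacing \<open>pmf q x\<close> by 1 discards only the nonnegative term
      \<open>- ln (pmf q x)\<close>, which does not depend on the scale.\<close>
    also have "\<dots> \<le> 1 * (1 / real (card (C x)))" by (intro mult_right_mono pmf_le_1) simp
    finally show ?thesis
      using X(1) by (simp add: q'_def pmf_bind expectation_fin_supp X_def)
  qed
  have ln_small: "ln_packing (L \<inter> ball x \<rho>) r \<le> measure_pmf.expectation (h x) (\<lambda>u. - ln (pmf q' u))"
    if x: "x \<in> X" "x \<in> L" for x
  proof -
    have "ln (real (card (C x))) \<le> - ln (pmf q' u)" if u: "u \<in> C x" for u
    proof -
      have "u \<in> set_pmf q'" using x u by (auto simp: q'_def X_def sh)
      then have p0: "0 < pmf q' u" by (rule pmf_positive)
      then have "ln (pmf q' u) \<le> ln (1 / real (card (C x)))" using small[OF x u] by (intro ln_mono) auto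
      also have "\<dots> = - ln (real (card (C x)))"
        using C1(1)[of x] Cne[OF x(2)] by (simp add: ln_div card_gt_0_iff)
      finally show ?thesis by simp
    qed
    then have "(\<Sum>u\<in>set_pmf (h x). pmf (h x) u * ln (real (card (C x)))) \<le> (\<Sum>u\<in>set_pmf (h x). pmf (h x) u * - ln (pmf q' u))"
      using x by (intro sum_mono mult_left_mono) (auto simp: sh)
    then show ?thesis
      using sum_pmf_fin_supp[OF fh[of x]]
      by (simp only: expectation_fin_supp[OF fh] sum_distrib_right[symmetric] C(2))
  qed
  have nn: "0 \<le> measure_pmf.expectation (h x) (\<lambda>u. - ln (pmf q' u))" for x
  proof -
    have "0 \<le> - ln (pmf q' u)" for u
      using pmf_le_1[of q' u] pmf_nonneg[of q' u] by (cases "pmf q' u = 0") auto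
    then show ?thesis by (intro Bochner_Integration.integral_nonneg) auto
  qed
  have tr: "0 \<le> t * (- ln r)" using t r by (intro mult_nonneg_nonneg) auto
  have "s * t * (- ln r) \<le> measure_pmf.prob q L * (t * (- ln r))"
    using s mult_right_mono[OF s(2) tr] by (simp only: mult.assoc)
  also have "\<dots> < measure_pmf.prob q L * measure_pmf.expectation p (\<lambda>x. ln_packing (L \<inter> ball x \<rho>) r)"
    using big s by (intro mult_strict_left_mono) auto
  also have "\<dots> = (\<Sum>x\<in>X \<inter> L. pmf q x * ln_packing (L \<inter> ball x \<rho>) r)"
  proof -
    have fin: "finite (set_pmf p)" using X(1) by (simp add: sp)
    show ?thesis
      unfolding expectation_fin_supp[OF fin] sum_distrib_left unfolding sp
    proof (rule sum.cong[OF refl])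
      fix x assume "x \<in> X \<inter> L"
      then show "measure_pmf.prob q L * (pmf p x * ln_packing (L \<inter> ball x \<rho>) r) = pmf q x * ln_packing (L \<inter> ball x \<rho>) r"
        using pp[of x] by (metis IntD2 mult.assoc mult.commute)
    qed
  qed
  also have "\<dots> \<le> (\<Sum>x\<in>X \<inter> L. pmf q x * measure_pmf.expectation (h x) (\<lambda>u. - ln (pmf q' u)))"
    using ln_small by (intro sum_mono mult_left_mono) auto
  \<comment> \<open>The atoms left in place outside \<open>L\<close> contribute nonnegative
    entropy.\<close>
  also have "\<dots> \<le> (\<Sum>x\<in>X. pmf q x * measure_pmf.expectation (h x) (\<lambda>u. - ln (pmf q' u)))"
    by (intro sum_mono2 X(1) mult_nonneg_nonneg pmf_nonneg nn) blast
  also have "\<dots> = measure_pmf.expectation q' (\<lambda>u. - ln (pmf q' u))"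
    unfolding q'_def X_def using X(1) fh
    by (intro expectation_bind_fin_supp[symmetric]) (auto simp: X_def)
  finally have "s * t * (- ln r) < measure_pmf.expectation q' (\<lambda>u. - ln (pmf q' u))" .
  then obtain V where V: "openin (weak_topology K) V" "atomic K q' \<in> V"
    "\<And>M. M \<in> V \<Longrightarrow> s * t * (- ln r) < ball_entropy K M r"
    using entropy_lower_nbhd[OF K fq' r(1) sep] by blast
  show thesis
  proof (rule that[OF V(1) _ r(1,3,2)])
    show "V \<inter> W \<noteq> {}" using V(2) W' by blast
    show "s * t < renyi1_quot K M r" if "M \<in> V" for M
      unfolding renyi1_quot_eq using V(3)[OF that] r by (subst pos_less_divide_eq) auto
  qed
qed

subsection \<open>Typical measures\<close>

lemma Liminf_at_right_0_le:
  fixes f :: "real \<Rightarrow> real"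
  assumes "\<And>n. \<exists>r. 0 < r \<and> r < 1 / real (Suc n) \<and> f r < 1 / real (Suc n)"
  shows "Liminf (at_right 0) (\<lambda>r. ereal (f r)) \<le> 0"
proof (rule ccontr)
  assume "\<not> Liminf (at_right 0) (\<lambda>r. ereal (f r)) \<le> 0"
  then have "0 < Liminf (at_right 0) (\<lambda>r. ereal (f r))" by simp
  then obtain e where e: "0 < ereal e" "ereal e < Liminf (at_right 0) (\<lambda>r. ereal (f r))"
    using ereal_dense2 by blast
  have "\<forall>\<^sub>F r in at_right 0. ereal e < ereal (f r)" by (rule less_LiminfD[OF e(2)])
  then obtain b where b: "0 < b" "\<And>r. 0 < r \<Longrightarrow> r < b \<Longrightarrow> e < f r"
    by (auto simp: eventually_at_right_field)
  have "0 < min b e" using b(1) e(1) by simp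
  then obtain n where n: "1 / real (Suc n) < min b e" by (rule nat_approx_posE)
  obtain r where "0 < r" "r < 1 / real (Suc n)" "f r < 1 / real (Suc n)" using assms by blast
  then show False using b(2)[of r] n by linarith
qed

lemma le_Limsup_at_right_0:
  fixes f :: "real \<Rightarrow> real"
  assumes "\<And>n. \<exists>r. 0 < r \<and> r < 1 / real (Suc n) \<and> t < f r"
  shows "ereal t \<le> Limsup (at_right 0) (\<lambda>r. ereal (f r))"
proof (rule ccontr)
  assume "\<not> ereal t \<le> Limsup (at_right 0) (\<lambda>r. ereal (f r))"
  then have "\<forall>\<^sub>F r in at_right 0. ereal (f r) < ereal t" by (intro Limsup_lessD) simp
  then obtain b where b: "0 < b" "\<And>r. 0 < r \<Longrightarrow> r < b \<Longrightarrow> f r < t"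
    by (auto simp: eventually_at_right_field)
  obtain n where n: "1 / real (Suc n) < b" using b(1) by (rule nat_approx_posE)
  obtain r where "0 < r" "r < 1 / real (Suc n)" "t < f r" using assms by blast
  then show False using b(2)[of r] n by linarith
qed

lemma ereal_dense_Rats:
  assumes "x < y"
  obtains t where "t \<in> \<rat>" "x < ereal t" "ereal t < y"
  using ereal_dense3[OF assms] Rats_of_rat that by blast

text \<open>Openness is built in, so a bound proved on neighbourhoods of sufficiently many atomic
  measures gives a dense open set directly, without a semicontinuity argument for
  \<open>renyi1_quot\<close>.\<close>

definition open_hull :: "'a::euclidean_space set \<Rightarrow> ('a measure set \<Rightarrow> bool) \<Rightarrow> 'a measure set" where
  "open_hull K Q = \<Union>{V. openin (weak_topology K) V \<and> Q V}"

lemma openin_open_hull: "openin (weak_topology K) (open_hull K Q)"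
  unfolding open_hull_def by (rule openin_Union) auto

lemma open_hull_dense:
  assumes "\<And>W. openin (weak_topology K) W \<Longrightarrow> W \<noteq> {} \<Longrightarrow> \<exists>V. openin (weak_topology K) V \<and> Q V \<and> V \<inter> W \<noteq> {}"
  shows "weak_topology K closure_of open_hull K Q = prob_measures K"
proof -
  have "open_hull K Q \<inter> W \<noteq> {}" if W: "openin (weak_topology K) W \<and> W \<noteq> {}" for W
  proof -
    obtain V where V: "openin (weak_topology K) V" "Q V" "V \<inter> W \<noteq> {}" using assms W by blast
    then have "V \<subseteq> open_hull K Q" unfolding open_hull_def by blast
    then show ?thesis using V(3) by blast
  qed
  then have "weak_topology K closure_of open_hull K Q = topspace (weak_topology K)"
    unfolding dense_intersects_open by blast
  then show ?thesis by simp
qed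

lemma typicalI:
  fixes K :: "'a::euclidean_space set"
  assumes K: "compact K" and \<G>: "countable \<G>"
    "\<And>T. T \<in> \<G> \<Longrightarrow> openin (weak_topology K) T \<and> weak_topology K closure_of T = prob_measures K"
    and P: "\<And>M. M \<in> prob_measures K \<Longrightarrow> (\<And>T. T \<in> \<G> \<Longrightarrow> M \<in> T) \<Longrightarrow> P M"
  shows "typical K P"
  unfolding typical_def
proof (intro exI conjI ballI)
  \<comment> \<open>Inserting the whole space keeps the intersected family nonempty and the result
    inside the space.\<close>
  let ?G = "\<Inter>(insert (topspace (weak_topology K)) \<G>)"
  have eq: "topspace (weak_topology K) \<inter> \<Inter>\<G> = ?G" by simp
  show "gdelta_in (weak_topology K) ?G"
    using \<G> by (intro gdelta_in_Inter) (auto intro: open_imp_gdelta_in gdelta_in_topspace[of "weak_topology K", simplified])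
  show "weak_topology K closure_of ?G = topspace (weak_topology K)"
    using weak_topology_Baire[OF K \<G>] unfolding eq by simp
  show "P M" if "M \<in> ?G" for M using that P by auto
qed

lemma dense_meets_open:
  assumes "weak_topology K closure_of G = topspace (weak_topology K)"
    "openin (weak_topology K) W" "M \<in> W"
  obtains N where "N \<in> G" "N \<in> W"
  using assms dense_intersects_open[of "weak_topology K" G] by blast

lemma renyi1_quot_nonneg:
  assumes "compact K" "M \<in> prob_measures K" "0 < r" "r < 1"
  shows "0 \<le> renyi1_quot K M r"
  unfolding renyi1_quot_eq using ball_entropy_nonneg[OF assms(1-3)] assms by (intro divide_nonneg_pos) auto

lemma eventually_renyi1_quot_nonneg:
  assumes "compact K" "M \<in> prob_measures K"
  shows "\<forall>\<^sub>F r in at_right 0. 0 \<le> ereal (renyi1_quot K M r)"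
  using eventually_less_at_right_0[of 1, simplified]
  by eventually_elim (use renyi1_quot_nonneg[OF assms] in simp)

lemma lower_D1_nonneg: "compact K \<Longrightarrow> M \<in> prob_measures K \<Longrightarrow> 0 \<le> lower_D1 K M"
  unfolding lower_D1_def by (intro Liminf_bounded eventually_renyi1_quot_nonneg)

lemma upper_D1_nonneg: "compact K \<Longrightarrow> M \<in> prob_measures K \<Longrightarrow> 0 \<le> upper_D1 K M"
  using lower_D1_nonneg[of K M] Liminf_le_Limsup[of "at_right (0::real)" "\<lambda>r. ereal (renyi1_quot K M r)"]
  by (auto simp: lower_D1_def upper_D1_def intro: order_trans)

lemma fin_supp_return: "y \<in> K \<Longrightarrow> fin_supp K (return_pmf y)"
  by (simp add: fin_supp_def)

text \<open>A strict lower bound on the integral of a tent function is an open condition. The point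
  mass at \<open>y\<close> satisfies it for every \<open>s < 1\<close> because the tent has height
  1.\<close>

lemma ball_mass_open:
  fixes K :: "'a::euclidean_space set"
  assumes K: "compact K" and y: "y \<in> K" and \<rho>: "\<rho> > 0" and s: "s < 1"
  obtains B where "openin (weak_topology K) B" "B \<noteq> {}"
    "\<And>q. fin_supp K q \<Longrightarrow> atomic K q \<in> B \<Longrightarrow> s \<le> measure_pmf.prob q (K \<inter> ball y \<rho>)"
proof -
  obtain b :: "'a \<Rightarrow> real" where b: "continuous_on K b" "b y = 1" "\<And>x. 0 \<le> b x" "\<And>x. b x \<le> indicator (ball y \<rho>) x"
    using ball_mass_nbhd[OF K \<rho>, of y] by metis
  define B where "B = {M \<in> prob_measures K. (\<integral>x. b x \<partial>M) \<in> {s<..}}"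
  show thesis
  proof (rule that[of B])
    show "openin (weak_topology K) B"
      unfolding B_def by (rule openin_weak_basic[OF b(1) open_greaterThan])
    have "atomic K (return_pmf y) \<in> B"
      using y s b(2) by (auto simp: B_def atomic_in_prob_measures fin_supp_return integral_atomic[OF _ b(1)])
    then show "B \<noteq> {}" by blast
    fix q assume q: "fin_supp K q" "atomic K q \<in> B"
    have fq: "finite (set_pmf q)" "set_pmf q \<subseteq> K" using q by (auto simp: fin_supp_def)
    have "s < measure_pmf.expectation q b"
      using q by (simp add: B_def integral_atomic[OF q(1) b(1)])
    also have "\<dots> \<le> measure_pmf.expectation q (indicator (K \<inter> ball y \<rho>))"
      unfolding expectation_fin_supp[OF fq(1)]
    proof (intro sum_mono mult_left_mono)
      fix x assume "x \<in> set_pmf q"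
      then have "indicator (K \<inter> ball y \<rho>) x = (indicator (ball y \<rho>) x :: real)"
        using fq by (auto simp: indicator_def)
      then show "b x \<le> indicator (K \<inter> ball y \<rho>) x" using b(4)[of x] by simp
    qed auto
    finally show "s \<le> measure_pmf.prob q (K \<inter> ball y \<rho>)" by simp
  qed
qed

section \<open>Open sets for the category argument\<close>

definition small_quot_set :: "'a::euclidean_space set \<Rightarrow> nat \<Rightarrow> 'a measure set" where
  "small_quot_set K n = open_hull K (\<lambda>V. \<exists>r. 0 < r \<and> r < 1 / real (Suc n) \<and>
     (\<forall>M\<in>V. renyi1_quot K M r < 1 / real (Suc n)))"

text \<open>As in \<open>small_quot_set\<close>, the scale may vary with the neighbourhood and is
  only kept below \<open>1 / (n + 1)\<close>; membership for all \<open>n\<close> then provides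
  scales tending to 0, hence a bound for the limsup.\<close>

definition large_quot_set :: "'a::euclidean_space set \<Rightarrow> real \<Rightarrow> nat \<Rightarrow> 'a measure set" where
  "large_quot_set K t n = open_hull K (\<lambda>V. \<exists>r. 0 < r \<and> r < 1 / real (Suc n) \<and>
     (\<forall>M\<in>V. t < renyi1_quot K M r))"

definition upper_le_set :: "'a::euclidean_space set \<Rightarrow> real \<Rightarrow> 'a measure set" where
  "upper_le_set K t = open_hull K (\<lambda>V. \<forall>M\<in>V. upper_D1 K M \<le> ereal t)"

lemma small_quot_set_dense:
  assumes K: "compact K"
  shows "weak_topology K closure_of small_quot_set K n = prob_measures K"
  unfolding small_quot_set_def
proof (rule open_hull_dense)
  fix W assume W: "openin (weak_topology K) W" "W \<noteq> {}"
  then obtain q where q: "fin_supp K q" "atomic K q \<in> W" using atomic_dense[OF K W(1)] by blast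
  have p: "0 < 1 / real (Suc n)" by simp
  from small_quot_nbhd[OF K q(1) p p]
  obtain V r where "openin (weak_topology K) V" "atomic K q \<in> V" "0 < r" "r < 1 / real (Suc n)"
    "\<And>M. M \<in> V \<Longrightarrow> renyi1_quot K M r < 1 / real (Suc n)" by metis
  then show "\<exists>V. openin (weak_topology K) V \<and> (\<exists>r>0. r < 1 / real (Suc n) \<and>
      (\<forall>M\<in>V. renyi1_quot K M r < 1 / real (Suc n))) \<and> V \<inter> W \<noteq> {}"
    using q(2) by (intro exI[of _ V] conjI exI[of _ r]) auto
qed

text \<open>Each atom of an approximating measure is replaced by a nearly optimal family in a small
  ball around it. The supremum in \<open>conv_max_box_dim\<close> allows the same threshold
  \<open>t'\<close> for every atom, so the mixture obeys it too; the gap from \<open>t'\<close> to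
  \<open>t\<close> pays for the passage to a neighbourhood.\<close>

lemma upper_le_set_dense:
  fixes K :: "'a::euclidean_space set"
  assumes K: "compact K" and t: "conv_max_box_dim K < ereal t"
  shows "weak_topology K closure_of upper_le_set K t = prob_measures K"
  unfolding upper_le_set_def
proof (rule open_hull_dense)
  fix W assume W: "openin (weak_topology K) W" "W \<noteq> {}"
  then obtain q where q: "fin_supp K q" "atomic K q \<in> W" using atomic_dense[OF K W(1)] by blast
  obtain \<rho> where \<rho>: "\<rho> > 0"
    "\<And>h. (\<And>x. x \<in> set_pmf q \<Longrightarrow> fin_supp (K \<inter> ball x \<rho>) (h x)) \<Longrightarrow> atomic K (bind_pmf q h) \<in> W"
    using atomic_perturb[OF K W(1) q] by blast
  obtain t' where t': "conv_max_box_dim K < ereal t'" "t' < t" using ereal_dense2[OF t] by auto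
  have "\<exists>p. fin_supp (K \<inter> ball x \<rho>) p \<and> packs_below K p t'" if "x \<in> K" for x
  proof -
    have "conv_box_dim (K \<inter> ball x \<rho>) \<le> conv_max_box_dim K"
      unfolding conv_max_box_dim_def using that \<rho>(1) by (intro Sup_upper) blast
    then have "conv_box_dim (K \<inter> ball x \<rho>) < ereal t'" using t'(1) by simp
    from packs_below_local[OF K this] show ?thesis by blast
  qed
  then obtain h where h: "\<And>x. x \<in> K \<Longrightarrow> fin_supp (K \<inter> ball x \<rho>) (h x)" "\<And>x. x \<in> K \<Longrightarrow> packs_below K (h x) t'"
    by metis
  have sK: "set_pmf q \<subseteq> K" using q by (simp add: fin_supp_def)
  have "atomic K (bind_pmf q h) \<in> W" using h(1) sK by (intro \<rho>(2)) auto
  moreover have "packs_below K (bind_pmf q h) t'" using h(2) sK by (intro packs_below_bind[OF K q(1)]) auto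
  moreover have "t - t' > 0" using t'(2) by simp
  ultimately obtain V where "openin (weak_topology K) V" "atomic K (bind_pmf q h) \<in> V"
    "\<And>M. M \<in> V \<Longrightarrow> upper_D1 K M \<le> ereal (t' + (t - t'))"
    using packs_below_nbhd[OF K, of "bind_pmf q h" t' "t - t'"] by blast
  then show "\<exists>V. openin (weak_topology K) V \<and> (\<forall>M\<in>V. upper_D1 K M \<le> ereal t) \<and> V \<inter> W \<noteq> {}"
    using \<open>atomic K (bind_pmf q h) \<in> W\<close> by (intro exI[of _ V]) auto
qed

text \<open>The form relative to \<open>W\<close> and \<open>L\<close> serves two purposes: with
  \<open>L = K\<close> and \<open>s = 1\<close> it gives density, and with a piece of
  \<open>K\<close> and \<open>s < 1\<close> it gives density within the measures concentrated near
  that piece.\<close>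

lemma large_quot_set_meets:
  fixes K :: "'a::euclidean_space set"
  assumes K: "compact K" and L: "L \<subseteq> K" and s: "0 < s" and t: "0 \<le> t" "ereal t < conv_box_dim L"
    and W: "openin (weak_topology K) W" "W \<noteq> {}"
    and mass: "\<And>q. fin_supp K q \<Longrightarrow> atomic K q \<in> W \<Longrightarrow> s \<le> measure_pmf.prob q L"
  shows "large_quot_set K (s * t) n \<inter> W \<noteq> {}"
proof -
  obtain q where q: "fin_supp K q" "atomic K q \<in> W" using atomic_dense[OF K W(1)] W(2) by blast
  have p: "0 < 1 / real (Suc n)" by simp
  from large_quot_nbhd[OF K W(1) q L s mass[OF q] t p]
  obtain V r where V: "openin (weak_topology K) V" "V \<inter> W \<noteq> {}" "0 < r" "r < 1 / real (Suc n)"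
    "\<And>M. M \<in> V \<Longrightarrow> s * t < renyi1_quot K M r" by metis
  then have "V \<subseteq> large_quot_set K (s * t) n"
    unfolding large_quot_set_def open_hull_def by blast
  then show ?thesis using V(2) by blast
qed

lemma upper_D1_ge:
  assumes "\<And>n. M \<in> large_quot_set K t n"
  shows "ereal t \<le> upper_D1 K M"
  unfolding upper_D1_def
proof (rule le_Limsup_at_right_0)
  show "\<exists>r. 0 < r \<and> r < 1 / real (Suc n) \<and> t < renyi1_quot K M r" for n
    using assms[of n] unfolding large_quot_set_def open_hull_def by blast
qed

lemma lower_D1_le:
  assumes "\<And>n. M \<in> small_quot_set K n"
  shows "lower_D1 K M \<le> 0"
  unfolding lower_D1_def
proof (rule Liminf_at_right_0_le)
  show "\<exists>r. 0 < r \<and> r < 1 / real (Suc n) \<and> renyi1_quot K M r < 1 / real (Suc n)" for n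
    using assms[of n] unfolding small_quot_set_def open_hull_def by blast
qed

section \<open>The typical range and its sharpness\<close>

lemma typical_bounds:
  fixes K :: "'a::euclidean_space set"
  assumes K: "compact K"
  shows "typical K (\<lambda>M. lower_D1 K M = 0 \<and> conv_box_dim K \<le> upper_D1 K M \<and> upper_D1 K M \<le> conv_max_box_dim K)"
proof -
  \<comment> \<open>Rational thresholds keep the family countable. The condition
    \<open>0 \<le> t\<close> is what \<open>large_quot_set_meets\<close> asks for; it holds for
    every threshold above \<open>upper_D1 K M\<close>, which is nonnegative.\<close>
  define \<G> where "\<G> = range (small_quot_set K)
     \<union> upper_le_set K ` {t \<in> \<rat>. conv_max_box_dim K < ereal t}
     \<union> (\<lambda>(t, n). large_quot_set K t n) ` ({t \<in> \<rat>. 0 \<le> t \<and> ereal t < conv_box_dim K} \<times> UNIV)"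
  show ?thesis
  proof (rule typicalI[OF K, of \<G>])
    have "countable {t \<in> \<rat>. conv_max_box_dim K < ereal t}" "countable {t \<in> \<rat>. 0 \<le> t \<and> ereal t < conv_box_dim K}"
      by (auto intro: countable_subset[OF _ countable_rat])
    then show "countable \<G>" unfolding \<G>_def by auto
  next
    fix T assume "T \<in> \<G>"
    then consider n where "T = small_quot_set K n" | t where "T = upper_le_set K t" "conv_max_box_dim K < ereal t"
      | t n where "T = large_quot_set K t n" "0 \<le> t" "ereal t < conv_box_dim K"
      unfolding \<G>_def by auto
    then show "openin (weak_topology K) T \<and> weak_topology K closure_of T = prob_measures K"
    proof cases
      case 1
      then show ?thesis using small_quot_set_dense[OF K] by (simp add: small_quot_set_def openin_open_hull)
    next
      case 2
      then show ?thesis using upper_le_set_dense[OF K] by (simp add: upper_le_set_def openin_open_hull)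
    next
      case 3
      have "T \<inter> W \<noteq> {}" if W: "openin (weak_topology K) W \<and> W \<noteq> {}" for W
      proof -
        have "large_quot_set K (1 * t) n \<inter> W \<noteq> {}"
        proof (rule large_quot_set_meets[OF K order_refl _ 3(2,3)])
          fix q assume "fin_supp K q"
          then have "measure_pmf.prob q K = 1"
            by (intro measure_pmf.prob_eq_1[THEN iffD2]) (auto simp: fin_supp_def AE_measure_pmf_iff)
          then show "1 \<le> measure_pmf.prob q K" by simp
        qed (use W in auto)
        then show ?thesis using 3(1) by simp
      qed
      then have "weak_topology K closure_of T = topspace (weak_topology K)"
        unfolding dense_intersects_open by blast
      then show ?thesis using 3(1) by (simp add: large_quot_set_def openin_open_hull)
    qed
  next
    fix M assume MP: "M \<in> prob_measures K" and M: "\<And>T. T \<in> \<G> \<Longrightarrow> M \<in> T"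
    have "lower_D1 K M \<le> 0" by (rule lower_D1_le, rule M) (auto simp: \<G>_def)
    moreover have "0 \<le> lower_D1 K M" by (rule lower_D1_nonneg[OF K MP])
    moreover have "upper_D1 K M \<le> conv_max_box_dim K"
    proof (rule ccontr)
      assume "\<not> upper_D1 K M \<le> conv_max_box_dim K"
      then have "conv_max_box_dim K < upper_D1 K M" by simp
      then obtain t where t: "t \<in> \<rat>" "conv_max_box_dim K < ereal t" "ereal t < upper_D1 K M"
        by (rule ereal_dense_Rats)
      then have "M \<in> upper_le_set K t" by (intro M) (auto simp: \<G>_def)
      then have "upper_D1 K M \<le> ereal t" by (auto simp: upper_le_set_def open_hull_def)
      then show False using t(3) by simp
    qed
    moreover have "conv_box_dim K \<le> upper_D1 K M"
    proof (rule ccontr)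
      assume "\<not> conv_box_dim K \<le> upper_D1 K M"
      then have "upper_D1 K M < conv_box_dim K" by simp
      then obtain t where t: "t \<in> \<rat>" "upper_D1 K M < ereal t" "ereal t < conv_box_dim K"
        by (rule ereal_dense_Rats)
      then have "0 \<le> t" using upper_D1_nonneg[OF K MP] order_le_less_trans[of 0 "upper_D1 K M" "ereal t"] by simp
      then have "M \<in> large_quot_set K t n" for n using t by (intro M) (auto simp: \<G>_def)
      then have "ereal t \<le> upper_D1 K M" by (rule upper_D1_ge)
      then show False using t(2) by simp
    qed
    ultimately show "lower_D1 K M = 0 \<and> conv_box_dim K \<le> upper_D1 K M \<and> upper_D1 K M \<le> conv_max_box_dim K"
      by auto
  qed
qed

text \<open>One competitor \<open>q\<close> for the infimum has a neighbourhood in which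
  \<open>upper_D1\<close> stays below the midpoint of \<open>t\<close> and \<open>a\<close>; a dense
  set must meet it.\<close>

lemma typical_lower_optimal:
  fixes K :: "'a::euclidean_space set"
  assumes K: "compact K" and ty: "typical K (\<lambda>M. ereal a \<le> upper_D1 K M)"
  shows "ereal a \<le> conv_box_dim K"
proof (rule ccontr)
  assume "\<not> ereal a \<le> conv_box_dim K"
  then have "conv_box_dim K < ereal a" by simp
  then obtain t where t: "conv_box_dim K < ereal t" "ereal t < ereal a"
    using ereal_dense2 by blast
  obtain q \<rho> where "fin_supp K q" "\<rho> > 0"
    "\<forall>\<^sub>F r in at_right 0. measure_pmf.expectation q (\<lambda>x. ln_packing (K \<inter> ball x \<rho>) r) \<le> t * (- ln r)"
    using conv_box_dim_lessD[OF t(1)] by blast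
  then have q: "packs_below K q t" by (auto simp: packs_below_def)
  have e: "(a - t) / 2 > 0" using t(2) by simp
  obtain V where V: "openin (weak_topology K) V" "atomic K q \<in> V"
    "\<And>M. M \<in> V \<Longrightarrow> upper_D1 K M \<le> ereal (t + (a - t) / 2)"
    using packs_below_nbhd[OF K q e] by blast
  obtain G where G: "weak_topology K closure_of G = topspace (weak_topology K)" "\<And>M. M \<in> G \<Longrightarrow> ereal a \<le> upper_D1 K M"
    using ty unfolding typical_def by blast
  obtain M where "M \<in> G" "M \<in> V" using dense_meets_open[OF G(1) V(1,2)] by blast
  then have "ereal a \<le> ereal (t + (a - t) / 2)" using G(2) V(3) order_trans by blast
  then show False using t(2) by (simp add: field_simps)
qed

text \<open>Measures with mass at least about \<open>s\<close> near \<open>y\<close> see the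
  dimension \<open>t\<close> of the piece with factor \<open>s\<close>. This happens generically
  only inside the open set \<open>B\<close>, so the given typical set has to be intersected with
  large-quotient sets within \<open>B\<close>.\<close>

lemma typical_upper_optimal:
  fixes K :: "'a::euclidean_space set"
  assumes K: "compact K" and ty: "typical K (\<lambda>M. upper_D1 K M \<le> ereal b)"
  shows "conv_max_box_dim K \<le> ereal b"
  unfolding conv_max_box_dim_def
proof (rule Sup_least, clarify)
  fix y \<rho> assume y: "y \<in> K" and \<rho>: "(0::real) < \<rho>"
  let ?L = "K \<inter> ball y \<rho>" and ?T = "weak_topology K"
  obtain G where G: "gdelta_in ?T G" "?T closure_of G = topspace ?T" "\<And>M. M \<in> G \<Longrightarrow> upper_D1 K M \<le> ereal b"
    using ty unfolding typical_def by blast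
  have "atomic K (return_pmf y) \<in> prob_measures K"
    using y by (intro atomic_in_prob_measures fin_supp_return)
  then obtain M0 where "M0 \<in> G" "M0 \<in> prob_measures K"
    using dense_meets_open[OF G(2) openin_topspace, of "atomic K (return_pmf y)"] by auto
  \<comment> \<open>A typical set is nonempty and \<open>upper_D1\<close> is nonnegative; this makes
    \<open>t\<close> positive below.\<close>
  then have b: "0 \<le> b"
    using order_trans[OF upper_D1_nonneg[OF K] G(3), of M0] by simp
  show "conv_box_dim ?L \<le> ereal b"
  proof (rule ccontr)
    assume "\<not> conv_box_dim ?L \<le> ereal b"
    then have "ereal b < conv_box_dim ?L" by simp
    then obtain t where t: "ereal b < ereal t" "ereal t < conv_box_dim ?L"
      using ereal_dense2 by blast
    \<comment> \<open>Chosen so that \<open>s * t\<close> is the midpoint of \<open>b\<close> and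
      \<open>t\<close>; then \<open>s < 1\<close> as well.\<close>
    define s where "s = (b + t) / (2 * t)"
    have s: "0 < s" "s < 1" "b < s * t" using t(1) b by (auto simp: s_def field_simps)
    obtain B where B: "openin ?T B" "B \<noteq> {}"
      "\<And>q. fin_supp K q \<Longrightarrow> atomic K q \<in> B \<Longrightarrow> s \<le> measure_pmf.prob q ?L"
      using ball_mass_open[OF K y \<rho> s(2)] by metis
    \<comment> \<open>Adding the exterior of \<open>B\<close> makes \<open>U n\<close> dense in the
      whole space, so that Baire's theorem applies, without adding any point of
      \<open>B\<close>.\<close>
    define U where "U n = large_quot_set K (s * t) n \<union> (topspace ?T - ?T closure_of B)" for n
    have oU: "openin ?T (U n)" for n
      unfolding U_def large_quot_set_def by (intro openin_Un openin_open_hull openin_diff openin_topspace closedin_closure_of)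
    have dU: "?T closure_of (U n) = topspace ?T" for n
      unfolding dense_intersects_open
    proof (intro allI impI)
      fix W assume W: "openin ?T W \<and> W \<noteq> {}"
      show "U n \<inter> W \<noteq> {}"
      proof (cases "W \<inter> B = {}")
        case True
        then have "W \<inter> ?T closure_of B = {}"
          using W by (simp add: openin_Int_closure_of_eq_empty)
        then show ?thesis using W openin_subset[of ?T W] by (auto simp: U_def)
      next
        case False
        have "large_quot_set K (s * t) n \<inter> (W \<inter> B) \<noteq> {}"
          using t b False W B by (intro large_quot_set_meets[OF K _ s(1)]) auto
        then show ?thesis by (auto simp: U_def)
      qed
    qed
    obtain \<U> where \<U>: "countable \<U>" "\<And>T. T \<in> \<U> \<Longrightarrow> openin ?T T" "\<Inter>\<U> = G"
      using G(1) unfolding gdelta_in_alt intersection_of_def by (auto simp: subset_iff)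
    \<comment> \<open>Open sets containing the dense set \<open>G\<close> are dense, so
      \<open>G\<close> itself enters Baire's theorem as a countable family of dense open
      sets.\<close>
    have dG: "?T closure_of T = topspace ?T" if "T \<in> \<U>" for T
      using G(2) closure_of_mono[of G T ?T] closure_of_subset_topspace[of ?T T] \<U>(3) that by blast
    have "?T closure_of (topspace ?T \<inter> \<Inter>(\<U> \<union> range U)) = prob_measures K"
      using \<U> oU dU dG by (intro weak_topology_Baire[OF K]) auto
    then have "?T closure_of (topspace ?T \<inter> \<Inter>(\<U> \<union> range U)) = topspace ?T" by simp
    moreover obtain M1 where "M1 \<in> B" using B(2) by blast
    ultimately obtain M where M: "M \<in> topspace ?T \<inter> \<Inter>(\<U> \<union> range U)" "M \<in> B"
      using dense_meets_open[OF _ B(1)] by metis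
    have "M \<in> ?T closure_of B" using M(2) closure_of_subset[OF openin_subset[OF B(1)]] by blast
    moreover have "M \<in> U n" for n using M(1) by blast
    ultimately have "M \<in> large_quot_set K (s * t) n" for n by (auto simp: U_def)
    then have "ereal (s * t) \<le> upper_D1 K M" by (rule upper_D1_ge)
    also have "\<dots> \<le> ereal b" using M(1) \<U>(3) by (intro G(3)) auto
    finally show False using s(3) by simp
  qed
qed

lemma typical_mono: "typical K P \<Longrightarrow> (\<And>M. P M \<Longrightarrow> Q M) \<Longrightarrow> typical K Q"
  unfolding typical_def by blast

theorem theorem1p2:
  fixes K :: "'a::euclidean_space set"
  assumes "compact K" and "infinite K"
  shows "typical K (\<lambda>M. lower_D1 K M = 0 \<and> conv_box_dim K \<le> upper_D1 K M
                        \<and> upper_D1 K M \<le> conv_max_box_dim K)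
         \<and> (\<forall>a b :: real. typical K (\<lambda>M. upper_D1 K M \<in> {ereal a .. ereal b})
            \<longrightarrow> ereal a \<le> conv_box_dim K \<and> ereal b \<ge> conv_max_box_dim K)"
proof (intro conjI allI impI)
  show "typical K (\<lambda>M. lower_D1 K M = 0 \<and> conv_box_dim K \<le> upper_D1 K M \<and> upper_D1 K M \<le> conv_max_box_dim K)"
    by (rule typical_bounds[OF assms(1)])
  fix a b :: real
  assume ty: "typical K (\<lambda>M. upper_D1 K M \<in> {ereal a .. ereal b})"
  show "ereal a \<le> conv_box_dim K"
    by (rule typical_lower_optimal[OF assms(1) typical_mono[OF ty]]) simp
  show "conv_max_box_dim K \<le> ereal b"
    by (rule typical_upper_optimal[OF assms(1) typical_mono[OF ty]]) simp
qed

end
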